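(* Let $n,m\ge1$, let $t_0<T$ be real numbers, let $U\subseteq\mathbb{R}^m$ be a nonempty compact set, and let $f=(f_1,\dots,f_n)^T:\mathbb{R}^n\times U\times[t_0,T]\to\mathbb{R}^n$ and $F:\mathbb{R}^n\times U\times[t_0,T]\to\mathbb{R}$. Assume: (i) $f$ and $F$ are continuous, and there is a modulus $\omega$ such that for each $t\in[t_0,T]$ and each of the functions $\phi(x,u)=f_1(x,u,t),\dots,f_n(x,u,t),F(x,u,t)$, $$|\phi(x,u)-\phi(y,u)|\le\omega(R,\|x-y\|)\qquad\text{for all }R>0,\ x,y\in B_R(\mathbb{R}^n),\ u\in U.$$ (ii) $\frac{\partial f}{\partial x}:\mathbb{R}^n\times U\times[t_0,T]\to\mathbb{R}^{n\times n}$ and $\frac{\partial F}{\partial x}:\mathbb{R}^n\times U\times[t_0,T]\to\mathbb{R}^n$ exist and are continuous, and there is a function $\omega_1:\mathbb{R}_+\to\mathbb{R}_+$ with $\lim_{R\to0}\omega_1(R)=0$ such that for each $t\in[t_0,T]$, each of the functions $\phi$ in (i) and each $x\in\mathbb{R}^n$, $$\Big|\phi(x+\Delta x,u)-\phi(x,u)-\frac{\partial\phi}{\partial x}(x,u)\Delta x\Big|\le\|\Delta x\|\,\omega_1(\|\Delta x\|)$$ for all sufficiently small $\Delta x\in\mathbb{R}^n$ and all $u\in U$ (smallness uniform in $u$). (iii) The Hamiltonian system $$\dot x=\frac{\partial}{\partial p}H(x,p,t),\qquad \dot p=-\frac{\partial}{\partial x}H(x,p,t),\qquad p(T)=0$$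 is a complete system. Then the following holds: if for every initial data $(x^0,\tau)\in\mathbb{R}^n\times[t_0,T)$ there exists a unique control (up to equality almost everywhere) $u^*(\cdot)\in\mathcal{U}(\tau)$ satisfying the Pontryagin maximum condition on $[\tau,T]$ under the initial data $(x^0,\tau)$, then for every such $(x^0,\tau)$ this control is optimal, i.e. it minimizes $\int_\tau^T F(x(t),u(t),t)\,dt$ over all $u(\cdot)\in\mathcal{U}(\tau)$, where $x(\cdot)$ solves $\dot x=f(x,u(t),t)$, $x(\tau)=x^0$.
   Context: Notation: $\mathbb{R}_+=[0,+\infty)$; $B_R(\mathbb{R}^n)$ is the open ball of radius $R$ centered at $0$. A modulus is a function $\omega:\mathbb{R}_+\times\mathbb{R}_+\to\mathbb{R}_+$ with $\omega(r,d)\le\omega(R,D)$ whenever $r\le R$, $d\le D$, and $\lim_{D\to0+}\omega(R,D)=0$ for every $R>0$. For $\tau\in[t_0,T]$, $\mathcal{U}(\tau)$ is the set of Lebesgue measurable functions $u(\cdot):[\tau,T]\to U$. Standing assumption: for every $(x^0,\tau)$ and $u(\cdot)\in\mathcal{U}(\tau)$ the system $\dot x(t)=f(x(t),u(t),t)$, $x(\tau)=x^0$, has a unique (absolutely continuous) solution on $[\tau,T]$. Control Hamiltonian: $\mathscr{H}(x,p,u,t):=\sum_{i=1}^n p_if_i(x,u,t)-F(x,u,t)$. Hamiltonian: $H(x,p,t):=\sup_{u\in U}\mathscr{H}(x,p,u,t)$ on $\mathbb{R}^n\times\mathbb{R}^n\times[t_0,T]$. Writing the Hamiltonian system in (iii)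 presupposes that $H$ is differentiable with respect to $(x,p)$. Pontryagin maximum condition: a control $u^*(\cdot):[\tau,T]\to U$ satisfies it on $[\tau,T]$ under the initial data $(x^0,\tau)$ if the unique solution $(x^*(\cdot),p^*(\cdot))$ of the control Hamiltonian system $$\dot x=\frac{\partial\mathscr{H}(x,p,u^*(t),t)}{\partial p},\qquad\dot p=-\frac{\partial\mathscr{H}(x,p,u^*(t),t)}{\partial x},\qquad x(\tau)=x^0,\quad p(T)=0,$$ satisfies $\mathscr{H}(x^*(t),p^*(t),u^*(t),t)\ge\mathscr{H}(x^*(t),p^*(t),u,t)$ for all $u\in U$, for a.e. $t\in[\tau,T]$. Complete system: the Hamiltonian system in (iii) (including the condition $p(T)=0$) is called complete if for any $\xi\in\mathbb{R}^n$ it has, under the terminal condition $x(T)=\xi$, a unique solution $(x(\cdot),p(\cdot))$ on $[t_0,T]$; and moreover, for any sequence of solutions $(x^i(\cdot),p^i(\cdot))$ of the system and times $\tau_i$ with $\lim_{i\to+\infty}(x^i(\tau_i),p^i(\tau_i),\tau_i)=(\xi,\eta,\tau)\in\mathbb{R}^n\times\mathbb{R}^n\times[t_0,T]$, the $(x^i(\cdot),p^i(\cdot))$ converge uniformly on $[t_0,T]$ to the solution $(x(\cdot),p(\cdot))$ of the system with $(x(\tau),p(\tau))=(\xi,\eta)$. *)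

theory Defs
  imports "HOL-Analysis.Analysis"
begin

definition modulus :: "(real \<Rightarrow> real \<Rightarrow> real) \<Rightarrow> bool" where
  "modulus \<omega> \<longleftrightarrow>
     (\<forall>R\<ge>0. \<forall>D\<ge>0. 0 \<le> \<omega> R D) \<and>
     (\<forall>r R d D. 0 \<le> r \<and> r \<le> R \<and> 0 \<le> d \<and> d \<le> D \<longrightarrow> \<omega> r d \<le> \<omega> R D) \<and>
     (\<forall>R>0. ((\<lambda>D. \<omega> R D) \<longlongrightarrow> 0) (at_right 0))"

text \<open>Meaningful only where \<open>g\<close> is differentiable; the entries are then the partial derivatives.\<close>
definition gradient :: "(real^'n \<Rightarrow> real) \<Rightarrow> real^'n \<Rightarrow> real^'n" where
  "gradient g x = (\<chi> i. frechet_derivative g (at x) (axis i 1))"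

text \<open>Absolute continuity of a function on \<open>[a, b]\<close>. The pairs \<open>(r, s) \<in> I\<close> are the endpoints of
  finitely many non-overlapping subintervals. The constant \<open>absolutely_continuous\<close> of the
  library is a different notion, about measures.\<close>
definition abs_cont_on :: "real \<Rightarrow> real \<Rightarrow> (real \<Rightarrow> 'a::real_normed_vector) \<Rightarrow> bool" where
  "abs_cont_on a b x \<longleftrightarrow>
     (\<forall>\<epsilon>>0. \<exists>\<delta>>0. \<forall>I. finite I \<and> (\<forall>(r, s)\<in>I. a \<le> r \<and> r \<le> s \<and> s \<le> b) \<and>
        pairwise (\<lambda>(r, s) (r', s'). {r<..<s} \<inter> {r'<..<s'} = {}) I \<and>
        (\<Sum>(r, s)\<in>I. s - r) < \<delta>
        \<longrightarrow> (\<Sum>(r, s)\<in>I. norm (x s - x r)) < \<epsilon>)"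

text \<open>Solution of \<open>x' = g t\<close> almost everywhere on \<open>[a, b]\<close>; in the uses below \<open>g t\<close> depends on
  \<open>t\<close> also through the solution itself. Values of \<open>x\<close> outside \<open>[a, b]\<close> are irrelevant.\<close>
definition ae_solves ::
    "real \<Rightarrow> real \<Rightarrow> (real \<Rightarrow> 'a::real_normed_vector) \<Rightarrow> (real \<Rightarrow> 'a) \<Rightarrow> bool" where
  "ae_solves a b x g \<longleftrightarrow> abs_cont_on a b x \<and>
     (AE t in lebesgue_on {a..b}. (x has_vector_derivative g t) (at t within {a..b}))"

definition controls :: "(real^'m) set \<Rightarrow> real \<Rightarrow> real \<Rightarrow> (real \<Rightarrow> real^'m) set" where
  "controls U T \<tau> = {u \<in> borel_measurable (lebesgue_on {\<tau>..T}). \<forall>t\<in>{\<tau>..T}. u t \<in> U}"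

definition trajectory ::
    "(real^'n \<Rightarrow> real^'m \<Rightarrow> real \<Rightarrow> real^'n) \<Rightarrow> real \<Rightarrow> real^'n \<Rightarrow> real \<Rightarrow>
     (real \<Rightarrow> real^'m) \<Rightarrow> (real \<Rightarrow> real^'n) \<Rightarrow> bool" where
  "trajectory f T x0 \<tau> u x \<longleftrightarrow> ae_solves \<tau> T x (\<lambda>t. f (x t) (u t) t) \<and> x \<tau> = x0"

definition control_hamiltonian ::
    "(real^'n \<Rightarrow> real^'m \<Rightarrow> real \<Rightarrow> real^'n) \<Rightarrow> (real^'n \<Rightarrow> real^'m \<Rightarrow> real \<Rightarrow> real) \<Rightarrow>
     real^'n \<Rightarrow> real^'n \<Rightarrow> real^'m \<Rightarrow> real \<Rightarrow> real" where
  "control_hamiltonian f F x p u t = (\<Sum>i\<in>UNIV. p $ i * f x u t $ i) - F x u t"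

definition hamiltonian ::
    "(real^'m) set \<Rightarrow> (real^'n \<Rightarrow> real^'m \<Rightarrow> real \<Rightarrow> real^'n) \<Rightarrow>
     (real^'n \<Rightarrow> real^'m \<Rightarrow> real \<Rightarrow> real) \<Rightarrow> real^'n \<Rightarrow> real^'n \<Rightarrow> real \<Rightarrow> real" where
  "hamiltonian U f F x p t = (SUP u\<in>U. control_hamiltonian f F x p u t)"

definition control_hamiltonian_solution ::
    "(real^'n \<Rightarrow> real^'m \<Rightarrow> real \<Rightarrow> real^'n) \<Rightarrow> (real^'n \<Rightarrow> real^'m \<Rightarrow> real \<Rightarrow> real) \<Rightarrow>
     real \<Rightarrow> real^'n \<Rightarrow> real \<Rightarrow> (real \<Rightarrow> real^'m) \<Rightarrow>
     (real \<Rightarrow> real^'n) \<Rightarrow> (real \<Rightarrow> real^'n) \<Rightarrow> bool" where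
  "control_hamiltonian_solution f F T x0 \<tau> u x p \<longleftrightarrow>
     ae_solves \<tau> T x (\<lambda>t. gradient (\<lambda>q. control_hamiltonian f F (x t) q (u t) t) (p t)) \<and>
     ae_solves \<tau> T p (\<lambda>t. - gradient (\<lambda>y. control_hamiltonian f F y (p t) (u t) t) (x t)) \<and>
     x \<tau> = x0 \<and> p T = 0"

definition pontryagin_max_condition ::
    "(real^'m) set \<Rightarrow> (real^'n \<Rightarrow> real^'m \<Rightarrow> real \<Rightarrow> real^'n) \<Rightarrow>
     (real^'n \<Rightarrow> real^'m \<Rightarrow> real \<Rightarrow> real) \<Rightarrow> real \<Rightarrow> real^'n \<Rightarrow> real \<Rightarrow> (real \<Rightarrow> real^'m) \<Rightarrow> bool" where
  "pontryagin_max_condition U f F T x0 \<tau> u \<longleftrightarrow>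
     (\<exists>x p. control_hamiltonian_solution f F T x0 \<tau> u x p \<and>
        (\<forall>y q. control_hamiltonian_solution f F T x0 \<tau> u y q
               \<longrightarrow> (\<forall>t\<in>{\<tau>..T}. y t = x t \<and> q t = p t)) \<and>
        (AE t in lebesgue_on {\<tau>..T}. \<forall>v\<in>U.
           control_hamiltonian f F (x t) (p t) (u t) t \<ge> control_hamiltonian f F (x t) (p t) v t))"

text \<open>The terminal condition \<open>p T = 0\<close> is part of the system.\<close>
definition hamiltonian_solution ::
    "(real^'n \<Rightarrow> real^'n \<Rightarrow> real \<Rightarrow> real) \<Rightarrow> real \<Rightarrow> real \<Rightarrow>
     (real \<Rightarrow> real^'n) \<Rightarrow> (real \<Rightarrow> real^'n) \<Rightarrow> bool" where
  "hamiltonian_solution H t0 T x p \<longleftrightarrow>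
     ae_solves t0 T x (\<lambda>t. gradient (\<lambda>q. H (x t) q t) (p t)) \<and>
     ae_solves t0 T p (\<lambda>t. - gradient (\<lambda>y. H y (p t) t) (x t)) \<and>
     p T = 0"

text \<open>In the second conjunct the limit is ``the'' solution through \<open>(\<xi>, \<eta>)\<close> at time \<open>\<tau>\<close>: if there
  were two such solutions, the sequence alternating between them would have no uniform limit, so
  uniqueness is implied and not stated separately.\<close>
definition complete_hamiltonian_system ::
    "(real^'n \<Rightarrow> real^'n \<Rightarrow> real \<Rightarrow> real) \<Rightarrow> real \<Rightarrow> real \<Rightarrow> bool" where
  "complete_hamiltonian_system H t0 T \<longleftrightarrow>
     (\<forall>\<xi>. \<exists>x p. hamiltonian_solution H t0 T x p \<and> x T = \<xi> \<and>
        (\<forall>y q. hamiltonian_solution H t0 T y q \<and> y T = \<xi>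
               \<longrightarrow> (\<forall>t\<in>{t0..T}. y t = x t \<and> q t = p t))) \<and>
     (\<forall>X P s \<xi> \<eta> \<tau>.
        (\<forall>i::nat. hamiltonian_solution H t0 T (X i) (P i) \<and> s i \<in> {t0..T}) \<and>
        \<tau> \<in> {t0..T} \<and>
        (\<lambda>i. (X i (s i), P i (s i), s i)) \<longlonglongrightarrow> (\<xi>, \<eta>, \<tau>)
        \<longrightarrow> (\<exists>x p. hamiltonian_solution H t0 T x p \<and> x \<tau> = \<xi> \<and> p \<tau> = \<eta> \<and>
               uniform_limit {t0..T} (\<lambda>i t. (X i t, P i t)) (\<lambda>t. (x t, p t)) sequentially))"

definition optimal_control ::
    "(real^'m) set \<Rightarrow> (real^'n \<Rightarrow> real^'m \<Rightarrow> real \<Rightarrow> real^'n) \<Rightarrow>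
     (real^'n \<Rightarrow> real^'m \<Rightarrow> real \<Rightarrow> real) \<Rightarrow> real \<Rightarrow> real^'n \<Rightarrow> real \<Rightarrow> (real \<Rightarrow> real^'m) \<Rightarrow> bool" where
  "optimal_control U f F T x0 \<tau> u \<longleftrightarrow>
     u \<in> controls U T \<tau> \<and>
     (\<forall>v\<in>controls U T \<tau>. \<forall>x y. trajectory f T x0 \<tau> u x \<and> trajectory f T x0 \<tau> v y \<longrightarrow>
        (\<integral>t. F (x t) (u t) t \<partial>lebesgue_on {\<tau>..T}) \<le> (\<integral>t. F (y t) (v t) t \<partial>lebesgue_on {\<tau>..T}))"

text \<open>The two estimates imposed, for fixed \<open>t\<close>, on each \<open>\<phi> = f\<^sub>1, \<dots>, f\<^sub>n, F\<close>.\<close>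
definition has_modulus_in_x ::
    "(real^'m) set \<Rightarrow> (real \<Rightarrow> real \<Rightarrow> real) \<Rightarrow> (real^'n \<Rightarrow> real^'m \<Rightarrow> real) \<Rightarrow> bool" where
  "has_modulus_in_x U \<omega> \<phi> \<longleftrightarrow>
     (\<forall>R>0. \<forall>x\<in>ball 0 R. \<forall>y\<in>ball 0 R. \<forall>u\<in>U. \<bar>\<phi> x u - \<phi> y u\<bar> \<le> \<omega> R (norm (x - y)))"

definition uniformly_differentiable_in_x ::
    "(real^'m) set \<Rightarrow> (real \<Rightarrow> real) \<Rightarrow> (real^'n \<Rightarrow> real^'m \<Rightarrow> real) \<Rightarrow> bool" where
  "uniformly_differentiable_in_x U \<omega>1 \<phi> \<longleftrightarrow>
     (\<forall>x. \<exists>\<delta>>0. \<forall>h u. norm h < \<delta> \<and> u \<in> U \<longrightarrow>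
        \<bar>\<phi> (x + h) u - \<phi> x u - gradient (\<lambda>y. \<phi> y u) x \<bullet> h\<bar> \<le> norm h * \<omega>1 (norm h))"

end

theory Submission
  imports Defs "HOL-Complex_Analysis.Great_Picard"
begin

text \<open>
  Fix \<open>x0\<close> and \<open>\<tau>\<close>. It suffices to find one optimal control that satisfies the maximum condition: by the
  assumed uniqueness it agrees almost everywhere with the given control, which is then optimal too.
  The velocities \<open>f x u t\<close>, \<open>u \<in> U\<close>, need not form a convex set, so a minimizing sequence of controls
  \<open>u\<^sub>k\<close> has in general no limit that is a control. What does converge are the states \<open>x\<^sub>k\<close> and the
  adjoint states \<open>p\<^sub>k\<close>, and differentiability of the Hamiltonian recovers a control from their limit.

  Write \<open>ham x p u t\<close> for the control Hamiltonian. If a control is changed on a set \<open>E\<close> of small measure so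
  that \<open>ham\<close> increases there by at least \<open>\<epsilon>\<close> along the given state and adjoint state, the cost drops
  by at least \<open>\<epsilon> / 2\<close> times the measure of \<open>E\<close>; how small \<open>E\<close> has to be does not depend on the control
  (\<open>needle_variation\<close>). Hence an almost optimal control satisfies the maximum condition up to a small
  error outside a set of small measure, and along a suitable minimizing sequence \<open>u\<^sub>k(t)\<close> is, for almost
  every \<open>t\<close>, eventually a \<open>(1/2)\<^sup>k\<close>-maximizer of \<open>ham (x\<^sub>k t) (p\<^sub>k t)\<close> (\<open>minimizing_sequence\<close>).

  By the theorem of Arzela and Ascoli \<open>(x\<^sub>k, p\<^sub>k)\<close> converges uniformly to some \<open>(x, p)\<close> after passing to a
  subsequence. The Hamiltonian is the supremum of \<open>ham\<close> over \<open>U\<close> and is differentiable; its gradient at a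
  point is therefore the gradient of \<open>ham\<close> for every maximizer \<open>u\<close> there (\<open>hamiltonian_envelope\<close>). So
  \<open>f\<close>, \<open>F\<close> and the \<open>x\<close>-gradient of \<open>ham\<close> take one common value on all maximizers, and their values at the
  near-maximizers \<open>u\<^sub>k(t)\<close> converge to it although \<open>u\<^sub>k(t)\<close> itself may oscillate
  (\<open>near_maximizers_converge\<close>). By dominated convergence \<open>(x, p)\<close> solves the control Hamiltonian system for
  every measurable selection \<open>w\<close> of maximizers, and the cost of \<open>w\<close> is the infimum
  (\<open>ex_optimal_extremal\<close>). This \<open>w\<close> is the required optimal control.

  All these estimates are uniform only because the trajectories from \<open>x0\<close> stay in one bounded set,
  whatever the control (\<open>reach_bounded\<close>). This follows from global
  existence for all initial states. If the bound failed, one could build a control and an initial state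
  whose trajectory explodes, by splicing pieces of trajectories and pulling each endpoint back to the
  initial time; that the flow maps are open, by invariance of domain, makes the pull-back possible.
\<close>

section \<open>Absolutely continuous functions\<close>

lemma AE_lebesgue_on_negligible:
  assumes "AE t in lebesgue_on S. P t" "S \<in> sets lebesgue"
  obtains N where "negligible N" "\<And>t. t \<in> S - N \<Longrightarrow> P t"
proof -
  from assms have "AE t in lebesgue. t \<in> S \<longrightarrow> P t"
    by (simp add: AE_restrict_space_iff)
  then obtain N where "N \<in> null_sets lebesgue" "{t \<in> space lebesgue. \<not> (t \<in> S \<longrightarrow> P t)} \<subseteq> N"
    unfolding eventually_ae_filter by blast
  then show ?thesis
    by (intro that[of N]) (auto simp: negligible_iff_null_sets)
qed

lemma negligible_outer_open:
  assumes "negligible N" "e > 0"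
  obtains G where "open G" "N \<subseteq> G" "G \<in> lmeasurable" "measure lebesgue G < e"
proof -
  have N: "N \<in> null_sets lebesgue" using assms(1) by (simp add: negligible_iff_null_sets)
  then have "N \<in> sets lebesgue" by auto
  from sets_lebesgue_outer_open[OF this assms(2)] obtain G where
    G: "open G" "N \<subseteq> G" "(G - N) \<in> lmeasurable" "emeasure lebesgue (G - N) < ennreal e" by blast
  have Gs: "G \<in> sets lebesgue" using G(1) by auto
  have "emeasure lebesgue G = emeasure lebesgue (G - N)"
    using emeasure_Diff_null_set[OF N Gs] by simp
  then have "emeasure lebesgue G < ennreal e" using G(4) by simp
  then have Gm: "G \<in> lmeasurable"
    using Gs by (intro fmeasurableI) (auto intro: order.strict_trans)
  then have "measure lebesgue G < e"
    using \<open>emeasure lebesgue G < ennreal e\<close> by (metis emeasure_eq_measure2 ennreal_less_iff measure_nonneg)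
  then show ?thesis using G Gm that by blast
qed

lemma abs_cont_onE:
  assumes "abs_cont_on a b x" "e > 0"
  obtains \<delta> where "\<delta> > 0"
    "\<And>I. finite I \<Longrightarrow> (\<forall>(r, s)\<in>I. a \<le> r \<and> r \<le> s \<and> s \<le> b) \<Longrightarrow>
        pairwise (\<lambda>(r, s) (r', s'). {r<..<s} \<inter> {r'<..<s'} = {}) I \<Longrightarrow>
        (\<Sum>(r, s)\<in>I. s - r) < \<delta> \<Longrightarrow> (\<Sum>(r, s)\<in>I. norm (x s - x r)) < e"
  using assms unfolding abs_cont_on_def by meson

lemma abs_cont_on_subset:
  assumes "abs_cont_on a b x" "a \<le> c" "d \<le> b"
  shows "abs_cont_on c d x"
  unfolding abs_cont_on_def
proof (intro allI impI)
  fix e :: real assume "e > 0"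
  from abs_cont_onE[OF assms(1) this] obtain \<delta> where \<delta>: "\<delta> > 0"
    "\<And>I. finite I \<Longrightarrow> (\<forall>(r, s)\<in>I. a \<le> r \<and> r \<le> s \<and> s \<le> b) \<Longrightarrow>
        pairwise (\<lambda>(r, s) (r', s'). {r<..<s} \<inter> {r'<..<s'} = {}) I \<Longrightarrow>
        (\<Sum>(r, s)\<in>I. s - r) < \<delta> \<Longrightarrow> (\<Sum>(r, s)\<in>I. norm (x s - x r)) < e"
    by blast
  show "\<exists>\<delta>>0. \<forall>I. finite I \<and> (\<forall>(r, s)\<in>I. c \<le> r \<and> r \<le> s \<and> s \<le> d) \<and>
        pairwise (\<lambda>(r, s) (r', s'). {r<..<s} \<inter> {r'<..<s'} = {}) I \<and>
        (\<Sum>(r, s)\<in>I. s - r) < \<delta> \<longrightarrow> (\<Sum>(r, s)\<in>I. norm (x s - x r)) < e"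
  proof (intro exI[of _ \<delta>] conjI allI impI \<open>\<delta> > 0\<close>, elim conjE)
    fix I assume I: "finite I" "\<forall>(r, s)\<in>I. c \<le> r \<and> r \<le> s \<and> s \<le> d"
      "pairwise (\<lambda>(r, s) (r', s'). {r<..<s} \<inter> {r'<..<s'} = {}) I" "(\<Sum>(r, s)\<in>I. s - r) < \<delta>"
    have "\<forall>(r, s)\<in>I. a \<le> r \<and> r \<le> s \<and> s \<le> b"
      using I(2) assms(2,3) by fastforce
    with I show "(\<Sum>(r, s)\<in>I. norm (x s - x r)) < e" by (intro \<delta>(2)) auto
  qed
qed

lemma ae_solves_subset:
  assumes "ae_solves a b x g" "a \<le> c" "d \<le> b"
  shows "ae_solves c d x g"
proof -
  obtain N where N: "negligible N" "\<And>t. t \<in> {a..b} - N \<Longrightarrow> (x has_vector_derivative g t) (at t within {a..b})"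
    using assms(1) AE_lebesgue_on_negligible[of _ "{a..b}"] unfolding ae_solves_def by auto
  have "AE t in lebesgue. t \<in> {c..d} \<longrightarrow> (x has_vector_derivative g t) (at t within {c..d})"
  proof (rule AE_I')
    show "N \<in> null_sets lebesgue" using N(1) by (simp add: negligible_iff_null_sets)
    show "{t \<in> space lebesgue. \<not> (t \<in> {c..d} \<longrightarrow> (x has_vector_derivative g t) (at t within {c..d}))} \<subseteq> N"
      using N(2) assms(2,3) has_vector_derivative_within_subset[of x _ _ "{a..b}" "{c..d}"] by fastforce
  qed
  then show ?thesis
    using assms abs_cont_on_subset[of a b x c d] unfolding ae_solves_def
    by (simp add: AE_restrict_space_iff)
qed

text \<open>The intervals of a partial division do not overlap and their total length is at most the measure of a set
  containing them, so the definition of absolute continuity applies to their endpoints. The premise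
  \<open>ac\<close> is that definition for fixed \<open>\<delta>\<close> and \<open>e\<close>.\<close>
lemma abs_cont_on_tagged_sum:
  fixes x :: "real \<Rightarrow> 'a::real_normed_vector"
  assumes ac: "\<And>I. finite I \<Longrightarrow> (\<forall>(r, s)\<in>I. a \<le> r \<and> r \<le> s \<and> s \<le> b) \<Longrightarrow>
        pairwise (\<lambda>(r, s) (r', s'). {r<..<s} \<inter> {r'<..<s'} = {}) I \<Longrightarrow>
        (\<Sum>(r, s)\<in>I. s - r) < \<delta> \<Longrightarrow> (\<Sum>(r, s)\<in>I. norm (x s - x r)) < e"
    and D: "D tagged_partial_division_of {a..b}"
    and O: "O' \<in> lmeasurable" "measure lebesgue O' < \<delta>" "\<And>t k. (t, k) \<in> D \<Longrightarrow> k \<subseteq> O'"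
  shows "(\<Sum>(t, k)\<in>D. norm (x (Sup k) - x (Inf k))) < e"
proof -
  note td = tagged_partial_division_ofD[OF D]
  have iv: "\<exists>r s. k = {r..s} \<and> r \<le> s \<and> a \<le> r \<and> s \<le> b" if tk: "(t, k) \<in> D" for t k
  proof -
    obtain r s where rs: "k = {r..s}" using td(4)[OF tk] by auto
    have "t \<in> {r..s}" "{r..s} \<subseteq> {a..b}" using td(2,3)[OF tk] rs by auto
    then show ?thesis using rs by fastforce
  qed
  define \<phi> where "\<phi> = (\<lambda>(t::real, k::real set). (Inf k, Sup k))"
  have inj: "inj_on \<phi> D"
  proof (rule inj_onI, clarify)
    fix t k t' k' assume A: "(t, k) \<in> D" "(t', k') \<in> D" "\<phi> (t, k) = \<phi> (t', k')"
    obtain r s where rs: "k = {r..s}" "r \<le> s" using iv[OF A(1)] by auto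
    obtain r' s' where rs': "k' = {r'..s'}" "r' \<le> s'" using iv[OF A(2)] by auto
    have eq: "r = r'" "s = s'" using A(3) rs rs' by (auto simp: \<phi>_def)
    show "t = t' \<and> k = k'"
    proof (cases "t = t'")
      case False
      then have "interior k \<inter> interior k' = {}" using td(5)[OF A(1,2)] by auto
      then have "r = s" using rs rs' eq by auto
      then show ?thesis using td(2)[OF A(1)] td(2)[OF A(2)] rs rs' eq by auto
    qed (use rs rs' eq in auto)
  qed
  have sums: "(\<Sum>(r, s)\<in>\<phi> ` D. h r s) = (\<Sum>(t, k)\<in>D. h (Inf k) (Sup k))" for h :: "real \<Rightarrow> real \<Rightarrow> real"
    by (subst sum.reindex[OF inj]) (auto simp: \<phi>_def intro!: sum.cong)
  have "(\<Sum>(r, s)\<in>\<phi> ` D. norm (x s - x r)) < e"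
  proof (rule ac)
    show "finite (\<phi> ` D)" using td(1) by simp
    show "\<forall>(r, s)\<in>\<phi> ` D. a \<le> r \<and> r \<le> s \<and> s \<le> b"
    proof clarify
      fix r s t k assume "(r, s) = \<phi> (t, k)" "(t, k) \<in> D"
      then show "a \<le> r \<and> r \<le> s \<and> s \<le> b" using iv[of t k] by (auto simp: \<phi>_def)
    qed
    show "pairwise (\<lambda>(r, s) (r', s'). {r<..<s} \<inter> {r'<..<s'} = {}) (\<phi> ` D)"
    proof (rule pairwiseI)
      fix c c' assume "c \<in> \<phi> ` D" "c' \<in> \<phi> ` D" and neq: "c \<noteq> c'"
      then obtain t k t' k' where A: "(t, k) \<in> D" "c = \<phi> (t, k)" "(t', k') \<in> D" "c' = \<phi> (t', k')"
        by auto
      obtain p q where pq: "k = {p..q}" "p \<le> q" using iv[OF A(1)] by auto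
      obtain p' q' where pq': "k' = {p'..q'}" "p' \<le> q'" using iv[OF A(3)] by auto
      have "interior k \<inter> interior k' = {}" using td(5)[OF A(1,3)] A neq by auto
      then show "(case c of (r, s) \<Rightarrow> \<lambda>(r', s'). {r<..<s} \<inter> {r'<..<s'} = {}) c'"
        using A(2,4) pq pq' by (simp add: \<phi>_def)
    qed
    have "(\<Sum>(r, s)\<in>\<phi> ` D. s - r) = (\<Sum>(t, k)\<in>D. measure lborel k)"
    proof -
      have "(\<Sum>(t, k)\<in>D. Sup k - Inf k) = (\<Sum>(t, k)\<in>D. measure lborel k)"
      proof (rule sum.cong, simp, clarify)
        fix t k assume "(t, k) \<in> D"
        then show "Sup k - Inf k = measure lborel k" using iv[of t k] by auto
      qed
      then show ?thesis by (simp add: sums)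
    qed
    also have "\<dots> = sum (measure lborel) (snd ` D)"
    proof -
      have D': "D tagged_division_of \<Union> (snd ` D)"
        using D by (rule tagged_partial_division_of_Union_self)
      have "(\<Sum>(t, k)\<in>D. measure lborel k) = sum (measure lborel) (snd ` D)"
        by (rule sum.over_tagged_division_lemma[OF D']) (simp add: content_eq_0_interior del: box_real)
      then show ?thesis .
    qed
    also have "\<dots> = measure lebesgue (\<Union> (snd ` D))"
    proof -
      have "measure lborel k = measure lebesgue k" if "k \<in> snd ` D" for k
      proof -
        obtain r s where "k = {r..s}" using \<open>k \<in> snd ` D\<close> iv by force
        then show ?thesis by simp
      qed
      then show ?thesis
        using content_division[OF partial_division_of_tagged_division[OF D]] by simp
    qed
    also have "\<dots> \<le> measure lebesgue O'"
      using O by (intro measure_mono_fmeasurable sets.finite_Union)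
        (use td(1) iv in \<open>fastforce+\<close>)
    also have "\<dots> < \<delta>" by fact
    finally show "(\<Sum>(r, s)\<in>\<phi> ` D. s - r) < \<delta>" .
  qed
  then show ?thesis by (simp add: sums)
qed

text \<open>The fundamental theorem of calculus for absolutely continuous functions, by Riemann sums. Tags at which
  \<open>x\<close> is differentiable contribute an error proportional to the length of their interval. The other tags
  form a null set; their intervals lie in an open set of small measure, over which absolute continuity makes
  the total increment of \<open>x\<close> small.\<close>
theorem ae_solves_has_integral:
  fixes x :: "real \<Rightarrow> 'a::euclidean_space"
  assumes sol: "ae_solves a b x g" and ab: "a \<le> b"
  shows "(g has_integral (x b - x a)) {a..b}"
proof -
  obtain N where N: "negligible N" "\<And>t. t \<in> {a..b} - N \<Longrightarrow> (x has_vector_derivative g t) (at t within {a..b})"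
    using sol AE_lebesgue_on_negligible[of _ "{a..b}"] unfolding ae_solves_def by auto
  define g0 where "g0 t = (if t \<in> N then 0 else g t)" for t
  have "(g0 has_integral (x b - x a)) (cbox a b)"
    unfolding has_integral
  proof (intro allI impI)
    fix e :: real assume e: "e > 0"
    define e1 where "e1 = e / (2 * (b - a + 1))"
    have e1: "e1 > 0" "e1 * (b - a) < e / 2" using e ab by (auto simp: e1_def field_simps)
    obtain \<delta> where \<delta>: "\<delta> > 0"
      "\<And>I. finite I \<Longrightarrow> (\<forall>(r, s)\<in>I. a \<le> r \<and> r \<le> s \<and> s \<le> b) \<Longrightarrow>
        pairwise (\<lambda>(r, s) (r', s'). {r<..<s} \<inter> {r'<..<s'} = {}) I \<Longrightarrow>
        (\<Sum>(r, s)\<in>I. s - r) < \<delta> \<Longrightarrow> (\<Sum>(r, s)\<in>I. norm (x s - x r)) < e / 2"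
      using abs_cont_onE[of a b x "e / 2"] sol e unfolding ae_solves_def by auto
    obtain O' where O: "open O'" "N \<subseteq> O'" "O' \<in> lmeasurable" "measure lebesgue O' < \<delta>"
      using negligible_outer_open[OF N(1) \<delta>(1)] by blast
    have "\<exists>d>0. \<forall>s\<in>{a..b}. \<bar>s - t\<bar> < d \<longrightarrow> norm (x s - x t - (s - t) *\<^sub>R g t) \<le> e1 * \<bar>s - t\<bar>"
      if "t \<in> {a..b} - N" for t
      using N(2)[OF that] e1(1)
      unfolding has_vector_derivative_def has_derivative_within_alt by auto
    then obtain d where d: "\<And>t. t \<in> {a..b} - N \<Longrightarrow> d t > 0"
      "\<And>t s. t \<in> {a..b} - N \<Longrightarrow> s \<in> {a..b} \<Longrightarrow> \<bar>s - t\<bar> < d t \<Longrightarrow>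
         norm (x s - x t - (s - t) *\<^sub>R g t) \<le> e1 * \<bar>s - t\<bar>"
      by metis
    \<comment> \<open>At the tags in \<open>N\<close> the gauge keeps the intervals inside the open cover of \<open>N\<close>.\<close>
    define \<gamma> where "\<gamma> t = (if t \<in> N then O' else if t \<in> {a..b} then ball t (d t) else UNIV)" for t
    have \<gamma>: "gauge \<gamma>" unfolding gauge_def \<gamma>_def using O(1,2) d(1) by auto
    show "\<exists>\<gamma>. gauge \<gamma> \<and> (\<forall>D. D tagged_division_of cbox a b \<and> \<gamma> fine D \<longrightarrow>
              norm ((\<Sum>(t, k)\<in>D. measure lborel k *\<^sub>R g0 t) - (x b - x a)) < e)"
    proof (intro exI[of _ \<gamma>] conjI \<gamma> allI impI, elim conjE)
      fix D assume D: "D tagged_division_of cbox a b" and fine: "\<gamma> fine D"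
      note td = tagged_division_ofD[OF D]
      have iv: "\<exists>r s. k = {r..s} \<and> r \<le> t \<and> t \<le> s \<and> a \<le> r \<and> s \<le> b" if tk: "(t, k) \<in> D" for t k
  proof -
    obtain r s where rs: "k = {r..s}" using td(4)[OF tk] by auto
    have "t \<in> {r..s}" "{r..s} \<subseteq> {a..b}" using td(2,3)[OF tk] rs by auto
    then show ?thesis using rs by fastforce
  qed
      define D1 where "D1 = {(t, k) \<in> D. t \<in> N}"
      define D2 where "D2 = {(t, k) \<in> D. t \<notin> N}"
      have DD: "D = D1 \<union> D2" "D1 \<inter> D2 = {}" "finite D1" "finite D2"
        using td(1) by (auto simp: D1_def D2_def intro: finite_subset)
      let ?h = "\<lambda>(t, k). measure lborel k *\<^sub>R g0 t - (x (Sup k) - x (Inf k))"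
      have "(\<Sum>(t, k)\<in>D. x (Sup k) - x (Inf k)) = x b - x a"
        using additive_tagged_division_1[OF ab, of D x] D by simp
      then have "norm ((\<Sum>(t, k)\<in>D. measure lborel k *\<^sub>R g0 t) - (x b - x a)) = norm (sum ?h D)"
        by (simp add: sum_subtractf split_def)
      also have "\<dots> \<le> norm (sum ?h D1) + norm (sum ?h D2)"
        unfolding DD(1) by (simp only: sum.union_disjoint[OF DD(3,4,2)] norm_triangle_ineq)
      also have "norm (sum ?h D1) \<le> (\<Sum>(t, k)\<in>D1. norm (x (Sup k) - x (Inf k)))"
        by (rule sum_norm_le) (auto simp: D1_def g0_def norm_minus_commute)
      also have "\<dots> < e / 2"
      proof (rule abs_cont_on_tagged_sum[OF \<delta>(2)])
        show "D1 tagged_partial_division_of {a..b}"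
          using D by (auto simp: tagged_division_of_def D1_def intro: tagged_partial_division_subset)
        show "k \<subseteq> O'" if "(t, k) \<in> D1" for t k
          using that fineD[OF fine, of t k] by (auto simp: D1_def \<gamma>_def)
      qed (use O in auto)
      also have "norm (sum ?h D2) \<le> (\<Sum>(t, k)\<in>D2. e1 * measure lborel k)"
      proof (rule sum_norm_le, clarify)
        fix t k assume tk: "(t, k) \<in> D2"
        then have tk': "(t, k) \<in> D" "t \<notin> N" by (auto simp: D2_def)
        obtain r s where rs: "k = {r..s}" "r \<le> t" "t \<le> s" "a \<le> r" "s \<le> b" using iv[OF tk'(1)] by auto
        have t: "t \<in> {a..b} - N" using rs tk' by auto
        have sub: "k \<subseteq> ball t (d t)" using fineD[OF fine tk'(1)] tk' t by (auto simp: \<gamma>_def)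
        have "r \<in> k" "s \<in> k" using rs by auto
        then have rs': "\<bar>r - t\<bar> < d t" "\<bar>s - t\<bar> < d t"
          using sub by (auto simp: dist_real_def abs_minus_commute)
        have "norm (measure lborel k *\<^sub>R g0 t - (x (Sup k) - x (Inf k)))
            = norm ((x r - x t - (r - t) *\<^sub>R g t) - (x s - x t - (s - t) *\<^sub>R g t))"
          using rs tk'(2) by (simp add: g0_def algebra_simps)
        also have "\<dots> \<le> e1 * \<bar>r - t\<bar> + e1 * \<bar>s - t\<bar>"
          using d(2)[OF t _ rs'(1)] d(2)[OF t _ rs'(2)] rs
          by (intro order_trans[OF norm_triangle_ineq4 add_mono]) (simp_all del: scaleR_left_diff_distrib)
        also have "\<dots> = e1 * measure lborel k" using rs by (simp add: algebra_simps)
        finally show "norm (measure lborel k *\<^sub>R g0 t - (x (Sup k) - x (Inf k))) \<le> e1 * measure lborel k" .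
      qed
      also have "\<dots> \<le> (\<Sum>(t, k)\<in>D. e1 * measure lborel k)"
        by (rule sum_mono2) (use td(1) e1(1) in \<open>auto simp: D2_def\<close>)
      also have "\<dots> = e1 * (b - a)"
        using additive_content_tagged_division[OF D] ab by (simp add: sum_distrib_left[symmetric] split_def)
      finally show "norm ((\<Sum>(t, k)\<in>D. measure lborel k *\<^sub>R g0 t) - (x b - x a)) < e"
        using e1(2) by simp
    qed
  qed
  then have "(g0 has_integral (x b - x a)) {a..b}" by simp
  then show ?thesis
    by (rule has_integral_spike[OF N(1), rotated]) (auto simp: g0_def)
qed

lemma ae_solves_cong:
  assumes "ae_solves a b x g" "\<And>t. t \<in> {a..b} \<Longrightarrow> g t = h t"
  shows "ae_solves a b x h"
proof -
  have "AE t in lebesgue_on {a..b}. (x has_vector_derivative g t) (at t within {a..b})"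
    using assms(1) by (simp add: ae_solves_def)
  then have "AE t in lebesgue_on {a..b}. (x has_vector_derivative h t) (at t within {a..b})"
    using AE_space by eventually_elim (use assms(2) in auto)
  then show ?thesis using assms(1) by (simp add: ae_solves_def)
qed

lemma abs_cont_on_lipschitz:
  assumes C: "C \<ge> 0" and lip: "\<And>r s. a \<le> r \<Longrightarrow> r \<le> s \<Longrightarrow> s \<le> b \<Longrightarrow> norm (x s - x r) \<le> C * (s - r)"
  shows "abs_cont_on a b x"
  unfolding abs_cont_on_def
proof (intro allI impI)
  fix e :: real assume e: "e > 0"
  show "\<exists>\<delta>>0. \<forall>I. finite I \<and> (\<forall>(r, s)\<in>I. a \<le> r \<and> r \<le> s \<and> s \<le> b) \<and>
        pairwise (\<lambda>(r, s) (r', s'). {r<..<s} \<inter> {r'<..<s'} = {}) I \<and>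
        (\<Sum>(r, s)\<in>I. s - r) < \<delta> \<longrightarrow> (\<Sum>(r, s)\<in>I. norm (x s - x r)) < e"
  proof (intro exI[of _ "e / (C + 1)"] conjI allI impI, goal_cases)
    case 1
    then show ?case using e C by simp
  next
    case (2 I)
    have "(\<Sum>(r, s)\<in>I. norm (x s - x r)) \<le> (\<Sum>(r, s)\<in>I. C * (s - r))"
      using 2 by (intro sum_mono) (auto intro: lip)
    also have "\<dots> = C * (\<Sum>(r, s)\<in>I. s - r)" by (simp add: sum_distrib_left split_def)
    also have "\<dots> \<le> (C + 1) * (\<Sum>(r, s)\<in>I. s - r)"
    proof (intro mult_right_mono sum_nonneg)
      show "0 \<le> (case z of (r, s) \<Rightarrow> s - r)" if "z \<in> I" for z using 2 that by auto
    qed simp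
    also have "\<dots> < e" using 2 C by (simp add: pos_less_divide_eq mult.commute)
    finally show ?case .
  qed
qed

lemma ae_solves_of_has_vector_derivative:
  assumes deriv: "\<And>t. t \<in> {a..b} \<Longrightarrow> (x has_vector_derivative g t) (at t within {a..b})"
    and C: "\<And>t. t \<in> {a..b} \<Longrightarrow> norm (g t) \<le> C" "C \<ge> 0"
  shows "ae_solves a b x g"
  unfolding ae_solves_def
proof
  show "abs_cont_on a b x"
  proof (rule abs_cont_on_lipschitz[OF C(2)])
    fix r s assume rs: "a \<le> r" "r \<le> s" "s \<le> b"
    have "norm (x s - x r) \<le> C * norm (s - r)"
    proof (rule differentiable_bound[of "{a..b}" x "\<lambda>t h. h *\<^sub>R g t"])
      show "(x has_derivative (\<lambda>h. h *\<^sub>R g t)) (at t within {a..b})" if "t \<in> {a..b}" for t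
        using deriv[OF that] by (simp add: has_vector_derivative_def)
      show "onorm (\<lambda>h. h *\<^sub>R g t) \<le> C" if "t \<in> {a..b}" for t
        using mult_left_mono[OF C(1)[OF that] abs_ge_zero]
        by (intro onorm_bound[OF C(2)]) (simp add: mult.commute)
    qed (use rs in auto)
    then show "norm (x s - x r) \<le> C * (s - r)" using rs by simp
  qed
  show "AE t in lebesgue_on {a..b}. (x has_vector_derivative g t) (at t within {a..b})"
    by (rule AE_I2) (use deriv in auto)
qed

section \<open>Integral inequalities and integral equations\<close>

text \<open>The right-hand side of the hypothesis, multiplied by \<open>exp (- L * (t - a))\<close>, is nonincreasing.\<close>
lemma gronwall_integral:
  fixes e :: "real \<Rightarrow> real"
  assumes cont: "continuous_on {a..b} e" and L: "L \<ge> 0"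
    and le: "\<And>t. t \<in> {a..b} \<Longrightarrow> e t \<le> c + L * integral {a..t} e"
    and t: "t \<in> {a..b}"
  shows "e t \<le> c * exp (L * (t - a))"
proof -
  define E where "E s = c + L * integral {a..s} e" for s
  have E': "(E has_real_derivative L * e r) (at r within {a..b})" if r: "r \<in> {a..b}" for r
  proof -
    have "((\<lambda>s. integral {a..s} e) has_real_derivative e r) (at r within {a..b})"
      using integral_has_vector_derivative[OF cont r]
      by (simp add: has_real_derivative_iff_has_vector_derivative)
    then have "((\<lambda>s. c + L * integral {a..s} e) has_real_derivative L * e r) (at r within {a..b})"
      by (auto intro!: derivative_eq_intros)
    then show "(E has_real_derivative L * e r) (at r within {a..b})" by (simp add: E_def[abs_def])
  qed
  define \<phi> where "\<phi> s = E s * exp (- L * (s - a))" for s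
  have \<phi>': "(\<phi> has_real_derivative (L * e s - L * E s) * exp (- L * (s - a))) (at s within {a..b})"
    if "s \<in> {a..b}" for s
    unfolding \<phi>_def using E'[OF that] by (auto intro!: derivative_eq_intros simp: algebra_simps)
  have "\<phi> t \<le> \<phi> a"
  proof (rule DERIV_nonpos_imp_decreasing_open[where f = \<phi>])
    show "a \<le> t" using t by simp
    show "continuous_on {a..t} \<phi>"
      by (rule continuous_on_subset[OF DERIV_continuous_on[OF \<phi>']]) (use t in auto)
    fix s assume s: "a < s" "s < t"
    have "(\<phi> has_real_derivative (L * e s - L * E s) * exp (- L * (s - a))) (at s)"
      using \<phi>'[of s] s t at_within_Icc_at[of a s b] by simp
    moreover have "(L * e s - L * E s) * exp (- L * (s - a)) \<le> 0"
      using le[of s] s t L unfolding E_def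
      by (intro mult_nonpos_nonneg) (auto intro: mult_left_mono)
    ultimately show "\<exists>y. (\<phi> has_real_derivative y) (at s) \<and> y \<le> 0" by blast
  qed
  then have "E t * exp (- L * (t - a)) \<le> c" by (simp add: \<phi>_def E_def)
  then have "E t * exp (- L * (t - a)) * exp (L * (t - a)) \<le> c * exp (L * (t - a))"
    by (rule mult_right_mono) simp
  then have "E t \<le> c * exp (L * (t - a))"
    by (simp add: mult.assoc exp_add[symmetric])
  then show ?thesis using le[OF t] by (simp add: E_def)
qed

lemma gronwall_integral_backward:
  fixes e :: "real \<Rightarrow> real"
  assumes cont: "continuous_on {a..b} e" and L: "L \<ge> 0"
    and le: "\<And>t. t \<in> {a..b} \<Longrightarrow> e t \<le> c + L * integral {t..b} e"
    and t: "t \<in> {a..b}"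
  shows "e t \<le> c * exp (L * (b - t))"
proof -
  have "(\<lambda>s. e (- s)) (- t) \<le> c * exp (L * (- t - - b))"
  proof (rule gronwall_integral[OF _ L])
    show "continuous_on {- b..- a} (\<lambda>s. e (- s))"
      by (rule continuous_on_compose2[OF cont]) (auto intro!: continuous_intros)
    fix s assume "s \<in> {- b..- a}"
    then show "e (- s) \<le> c + L * integral {- b..s} (\<lambda>s. e (- s))"
      using le[of "- s"] Henstock_Kurzweil_Integration.integral_reflect_real[of b "- s" e] by simp
  qed (use t in auto)
  then show ?thesis by simp
qed

text \<open>Lipschitz constants are available on bounded sets only, so an estimate for the distance \<open>e\<close> of two solutions
  holds only as long as \<open>e\<close> stays below a threshold \<open>k\<close>. If the estimate is strictly better than the
  threshold, the threshold is never reached: at the first time with \<open>e = k\<close> the estimate would give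
  \<open>e < k\<close>.\<close>
lemma continuity_bootstrap:
  fixes e :: "real \<Rightarrow> real"
  assumes cont: "continuous_on {a..b} e" and k: "\<eta> < k"
    and imp: "\<And>r. r \<in> {a..b} \<Longrightarrow> (\<And>r'. r' \<in> {a..r} \<Longrightarrow> e r' \<le> k) \<Longrightarrow> e r \<le> \<eta>"
    and init: "e a \<le> k" and r: "r \<in> {a..b}"
  shows "e r \<le> \<eta>"
proof -
  have all: "e s \<le> k" if "s \<in> {a..b}" for s
  proof (rule ccontr)
    assume "\<not> e s \<le> k"
    define A where "A = {q \<in> {a..b}. k \<le> e q}"
    have "closed A" unfolding A_def
      using continuous_closed_preimage[OF cont, of "{k..}"] by (auto simp: vimage_def Int_def)
    moreover have "bounded A" by (rule bounded_subset[of "{a..b}"]) (auto simp: A_def)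
    moreover have "A \<noteq> {}" using that \<open>\<not> e s \<le> k\<close> by (auto simp: A_def)
    ultimately obtain q where q: "q \<in> A" "\<And>q'. q' \<in> A \<Longrightarrow> q \<le> q'"
      using compact_attains_inf[of A] by (auto simp: compact_eq_bounded_closed)
    have "e q \<le> \<eta>"
    proof (rule imp)
      show "q \<in> {a..b}" using q by (simp add: A_def)
      have lt: "e q' < k" if "q' \<in> {a..<q}" for q'
      proof (rule ccontr)
        assume "\<not> e q' < k"
        then have "q' \<in> A" using that q(1) by (auto simp: A_def)
        then show False using q(2) that by fastforce
      qed
      have "e q \<le> k"
      proof (cases "q = a")
        case False
        then have "a < q" using q(1) by (auto simp: A_def)
        have "(e \<longlongrightarrow> e q) (at_left q)"
        proof -
          have "(e \<longlongrightarrow> e q) (at q within {a..b})"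
            using cont q(1) by (auto simp: A_def continuous_on_def)
          then have "(e \<longlongrightarrow> e q) (at q within {a..q})"
            by (rule tendsto_within_subset) (use q(1) in \<open>auto simp: A_def\<close>)
          then show ?thesis using \<open>a < q\<close> by (simp add: at_within_Icc_at_left)
        qed
        then show ?thesis
        proof (rule tendsto_upperbound)
          show "\<forall>\<^sub>F q' in at_left q. e q' \<le> k"
            unfolding eventually_at_left[OF \<open>a < q\<close>]
            using lt \<open>a < q\<close> by (intro exI[of _ a]) (auto intro: less_imp_le)
        qed simp
      qed (use init in simp)
      then show "e q' \<le> k" if "q' \<in> {a..q}" for q'
        using that lt[of q'] by (cases "q' = q") auto
    qed
    then show False using q(1) k by (simp add: A_def)
  qed
  show ?thesis by (rule imp[OF r]) (use r all in auto)
qed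

lemma has_integral_exp_backward:
  fixes k :: real
  assumes "k > 0" "t \<le> b"
  shows "((\<lambda>s. exp (k * (b - s))) has_integral (exp (k * (b - t)) - 1) / k) {t..b}"
proof -
  have "((\<lambda>s. exp (k * (b - s))) has_integral (- exp (k * (b - b)) / k) - (- exp (k * (b - t)) / k)) {t..b}"
    using assms
    by (intro fundamental_theorem_of_calculus)
       (auto intro!: derivative_eq_intros simp: has_real_derivative_iff_has_vector_derivative[symmetric])
  then show ?thesis by (simp add: diff_divide_distrib)
qed

text \<open>Picard iteration. In the norm weighted by \<open>exp (k * (b - t))\<close> with \<open>k \<ge> 2 * L\<close> each step halves the
  distance of consecutive iterates, so the iteration converges on the whole interval at once.\<close>
theorem backward_integral_equation:
  fixes G :: "real \<Rightarrow> 'a::euclidean_space \<Rightarrow> 'a"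
  assumes ab: "a \<le> b" and L: "L \<ge> 0"
    and int: "\<And>q. continuous_on {a..b} q \<Longrightarrow> (\<lambda>s. G s (q s)) integrable_on {a..b}"
    and lip: "\<And>s p q. s \<in> {a..b} \<Longrightarrow> norm (G s p - G s q) \<le> L * norm (p - q)"
  obtains p where "continuous_on {a..b} p" "\<And>t. t \<in> {a..b} \<Longrightarrow> p t = integral {t..b} (\<lambda>s. G s (p s))"
proof -
  define P where "P = rec_nat (\<lambda>_. 0) (\<lambda>k q t. integral {t..b} (\<lambda>s. G s (q s)))"
  have P0: "P 0 = (\<lambda>_. 0)" and PS: "P (Suc k) t = integral {t..b} (\<lambda>s. G s (P k s))" for k t
    by (simp_all add: P_def)
  have Pc: "continuous_on {a..b} (P k)" for k
  proof (induction k)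
    case (Suc k)
    have "continuous_on {a..b} (\<lambda>t. integral {t..b} (\<lambda>s. G s (P k s)))"
      by (rule indefinite_integral_continuous_1'[OF int[OF Suc]])
    then show ?case by (simp add: PS[abs_def])
  qed (simp add: P0)
  have sub: "f integrable_on {t..b}" if "f integrable_on {a..b}" "t \<in> {a..b}" for f :: "real \<Rightarrow> 'a" and t
    using that integrable_on_subinterval[of f "{a..b}" t b] by auto
  have diffbound: "norm (integral {t..b} (\<lambda>s. G s (q s)) - integral {t..b} (\<lambda>s. G s (q' s)))
      \<le> integral {t..b} (\<lambda>s. L * h s)"
    if q: "continuous_on {a..b} q" "continuous_on {a..b} q'" and t: "t \<in> {a..b}"
      and h: "h integrable_on {t..b}" "\<And>s. s \<in> {t..b} \<Longrightarrow> norm (q s - q' s) \<le> h s" for q q' t and h :: "real \<Rightarrow> real"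
  proof -
    have i: "(\<lambda>s. G s (q s)) integrable_on {t..b}" "(\<lambda>s. G s (q' s)) integrable_on {t..b}"
      using sub[OF int[OF q(1)] t] sub[OF int[OF q(2)] t] by auto
    have "norm (integral {t..b} (\<lambda>s. G s (q s) - G s (q' s))) \<le> integral {t..b} (\<lambda>s. L * h s)"
    proof (rule integral_norm_bound_integral)
      show "(\<lambda>s. G s (q s) - G s (q' s)) integrable_on {t..b}" using i by (rule integrable_diff)
      show "(\<lambda>s. L * h s) integrable_on {t..b}" using h(1) integrable_cmul[of h "{t..b}" L] by simp
      fix s assume s: "s \<in> {t..b}"
      then have "norm (G s (q s) - G s (q' s)) \<le> L * norm (q s - q' s)" using lip t by auto
      also have "\<dots> \<le> L * h s" using h(2)[OF s] L by (rule mult_left_mono)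
      finally show "norm (G s (q s) - G s (q' s)) \<le> L * h s" .
    qed
    then show ?thesis by (simp add: integral_diff[OF i])
  qed
  \<comment> \<open>The summand 1 keeps the weight positive when \<open>L = 0\<close>.\<close>
  define k where "k = 2 * L + 1"
  have k: "k > 0" "2 * L \<le> k" using L by (auto simp: k_def)
  obtain C where C: "C \<ge> 0" "\<And>t. t \<in> {a..b} \<Longrightarrow> norm (P 1 t) \<le> C"
  proof -
    have "bounded (P 1 ` {a..b})"
      by (intro compact_imp_bounded compact_continuous_image Pc) simp
    then obtain C where "\<And>t. t \<in> {a..b} \<Longrightarrow> norm (P 1 t) \<le> C" unfolding bounded_iff by blast
    then show ?thesis using that[of "max C 0"] by fastforce
  qed
  have step: "norm (P (Suc n) t - P n t) \<le> C / 2 ^ n * exp (k * (b - t))" if "t \<in> {a..b}" for n t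
    using that
  proof (induction n arbitrary: t)
    case 0
    have "norm (P (Suc 0) t - P 0 t) \<le> C * 1" using C(2)[OF 0] by (simp add: P0)
    also have "\<dots> \<le> C * exp (k * (b - t))" using 0 k C(1) by (intro mult_left_mono) auto
    finally show ?case by simp
  next
    case (Suc n)
    let ?h = "\<lambda>s. C / 2 ^ n * exp (k * (b - s))"
    have hi: "((\<lambda>s. L * ?h s) has_integral L * (C / 2 ^ n * ((exp (k * (b - t)) - 1) / k))) {t..b}"
      using Suc.prems k by (intro has_integral_mult_right has_integral_exp_backward) auto
    have "norm (P (Suc (Suc n)) t - P (Suc n) t) \<le> integral {t..b} (\<lambda>s. L * ?h s)"
      unfolding PS[of "Suc n"] PS[of n t]
    proof (rule diffbound[OF Pc Pc Suc.prems])
      show "?h integrable_on {t..b}" using Suc.prems by (intro integrable_continuous_interval continuous_intros)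
      show "norm (P (Suc n) s - P n s) \<le> C / 2 ^ n * exp (k * (b - s))" if "s \<in> {t..b}" for s
        using Suc that by auto
    qed
    also have "\<dots> = L * (C / 2 ^ n * ((exp (k * (b - t)) - 1) / k))"
      using hi by (rule integral_unique)
    also have "\<dots> \<le> (k / 2) * (C / 2 ^ n * (exp (k * (b - t)) / k))"
      using k L C(1) Suc.prems by (intro mult_mono divide_right_mono mult_nonneg_nonneg) auto
    also have "\<dots> = C / 2 ^ Suc n * exp (k * (b - t))" using k by simp
    finally show ?case .
  qed
  define M where "M n = C * exp (k * (b - a)) * (1 / 2) ^ n" for n :: nat
  define p where "p t = (\<Sum>n. P (Suc n) t - P n t)" for t
  have "uniform_limit {a..b} (\<lambda>n t. \<Sum>i<n. P (Suc i) t - P i t) p sequentially"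
    unfolding p_def
  proof (rule Weierstrass_m_test)
    show "summable M" unfolding M_def by (intro summable_mult summable_geometric) simp
    fix n t assume t: "t \<in> {a..b}"
    have "norm (P (Suc n) t - P n t) \<le> C / 2 ^ n * exp (k * (b - t))" by (rule step[OF t])
    also have "\<dots> \<le> C / 2 ^ n * exp (k * (b - a))" using t k C(1) by (intro mult_left_mono) auto
    finally show "norm (P (Suc n) t - P n t) \<le> M n" by (simp add: M_def power_divide mult.commute)
  qed
  moreover have "(\<lambda>n t. \<Sum>i<n. P (Suc i) t - P i t) = P"
    using sum_lessThan_telescope[of "\<lambda>i. P i t" for t] by (simp add: P0 fun_eq_iff)
  ultimately have ul: "uniform_limit {a..b} P p sequentially" by simp
  have pc: "continuous_on {a..b} p"
    by (rule uniform_limit_theorem[OF _ ul]) (auto simp: Pc)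
  have "p t = integral {t..b} (\<lambda>s. G s (p s))" if t: "t \<in> {a..b}" for t
  proof (rule LIMSEQ_unique)
    show "(\<lambda>n. P (Suc n) t) \<longlonglongrightarrow> p t"
      using tendsto_uniform_limitI[OF ul t] by (rule LIMSEQ_Suc)
    show "(\<lambda>n. P (Suc n) t) \<longlonglongrightarrow> integral {t..b} (\<lambda>s. G s (p s))"
    proof (rule LIMSEQ_I)
      fix r :: real assume r: "r > 0"
      define \<eta> where "\<eta> = r / (L * (b - a) + 1)"
      have pos: "L * (b - a) + 1 > 0" using L ab by (simp add: add_nonneg_pos)
      then have \<eta>: "\<eta> > 0" "L * \<eta> * (b - a) < r"
        using r L ab by (auto simp: \<eta>_def field_simps)
      obtain N where N: "\<And>n s. n \<ge> N \<Longrightarrow> s \<in> {a..b} \<Longrightarrow> norm (P n s - p s) < \<eta>"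
        using uniform_limitD[OF ul \<eta>(1)] unfolding eventually_sequentially dist_norm by blast
      show "\<exists>N. \<forall>n\<ge>N. norm (P (Suc n) t - integral {t..b} (\<lambda>s. G s (p s))) < r"
      proof (intro exI[of _ N] allI impI)
        fix n assume n: "n \<ge> N"
        have "norm (P (Suc n) t - integral {t..b} (\<lambda>s. G s (p s))) \<le> integral {t..b} (\<lambda>s. L * \<eta>)"
          unfolding PS using N[OF n] t
          by (intro diffbound Pc pc) (auto intro: less_imp_le)
        also have "\<dots> = L * \<eta> * (b - t)" using t by simp
        also have "\<dots> \<le> L * \<eta> * (b - a)" using L \<eta> t by (intro mult_left_mono) auto
        also have "\<dots> < r" by (rule \<eta>)
        finally show "norm (P (Suc n) t - integral {t..b} (\<lambda>s. G s (p s))) < r" .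
      qed
    qed
  qed
  then show ?thesis using pc that by blast
qed

text \<open>The difference \<open>E\<close> of the two sides, as a function of the endpoint, satisfies
  \<open>\<bar>E s - E r\<bar> \<le> 2 * C\<^sup>2 * (s - r)\<^sup>2\<close>, hence has derivative zero. In this way the product rule for indefinite
  integrals needs no statement about their differentiability almost everywhere.\<close>
lemma has_integral_inner_product_rule:
  fixes p d \<pi> \<delta> :: "real \<Rightarrow> 'a::euclidean_space"
  assumes p: "\<And>r s. a \<le> r \<Longrightarrow> r \<le> s \<Longrightarrow> s \<le> b \<Longrightarrow> (\<pi> has_integral p s - p r) {r..s}"
    and d: "\<And>r s. a \<le> r \<Longrightarrow> r \<le> s \<Longrightarrow> s \<le> b \<Longrightarrow> (\<delta> has_integral d s - d r) {r..s}"
    and C: "\<And>t. t \<in> {a..b} \<Longrightarrow> norm (\<pi> t) \<le> C" "\<And>t. t \<in> {a..b} \<Longrightarrow> norm (\<delta> t) \<le> C"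
    and int: "(\<lambda>t. p t \<bullet> \<delta> t + \<pi> t \<bullet> d t) integrable_on {a..b}" and ab: "a \<le> b"
  shows "((\<lambda>t. p t \<bullet> \<delta> t + \<pi> t \<bullet> d t) has_integral p b \<bullet> d b - p a \<bullet> d a) {a..b}"
proof -
  let ?h = "\<lambda>t. p t \<bullet> \<delta> t + \<pi> t \<bullet> d t"
  have C0: "C \<ge> 0" using order_trans[OF norm_ge_zero C(1)[of a]] ab by simp
  have lip: "norm (q s - q r) \<le> C * (s - r)"
    if "a \<le> r" "r \<le> s" "s \<le> b" "(g has_integral q s - q r) {r..s}"
       "\<And>t. t \<in> {a..b} \<Longrightarrow> norm (g t) \<le> C" for r s q and g :: "real \<Rightarrow> 'a"
    using has_integral_bound[of C g "q s - q r" r s] that C0 by auto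
  define E where "E t = p t \<bullet> d t - integral {a..t} ?h" for t
  have E: "\<bar>E s - E r\<bar> \<le> 2 * C ^ 2 * (s - r) ^ 2" if rs: "a \<le> r" "r \<le> s" "s \<le> b" for r s
  proof -
    have hrs: "(?h has_integral integral {r..s} ?h) {r..s}"
      using integrable_on_subinterval[OF int, of r s] rs by (intro integrable_integral) auto
    have "integral {a..s} ?h = integral {a..r} ?h + integral {r..s} ?h"
      using Henstock_Kurzweil_Integration.integral_combine[of a r s ?h] integrable_on_subinterval[OF int, of a s] rs by auto
    then have eq: "E s - E r = p r \<bullet> (d s - d r) + (p s - p r) \<bullet> d s - integral {r..s} ?h"
      by (simp add: E_def algebra_simps)
    have "((\<lambda>t. p r \<bullet> \<delta> t + \<pi> t \<bullet> d s - ?h t) has_integral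
        p r \<bullet> (d s - d r) + (p s - p r) \<bullet> d s - integral {r..s} ?h) {r..s}"
      using has_integral_linear[OF d[OF rs] bounded_linear_inner_right[of "p r"]]
        has_integral_linear[OF p[OF rs] bounded_linear_inner_left[of "d s"]] hrs
      by (intro has_integral_diff has_integral_add) (simp_all add: o_def)
    then have "((\<lambda>t. p r \<bullet> \<delta> t + \<pi> t \<bullet> d s - ?h t) has_integral E s - E r) {r..s}"
      by (simp add: eq)
    moreover have "norm (p r \<bullet> \<delta> t + \<pi> t \<bullet> d s - ?h t) \<le> 2 * C ^ 2 * (s - r)" if t: "t \<in> {r..s}" for t
    proof -
      have "norm (p t - p r) \<le> C * (t - r)"
        using t rs by (intro lip[OF _ _ _ p C(1)]) auto
      moreover have "norm (d s - d t) \<le> C * (s - t)"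
        using t rs by (intro lip[OF _ _ _ d C(2)]) auto
      moreover have "C * (t - r) \<le> C * (s - r)" "C * (s - t) \<le> C * (s - r)"
        using t C0 by (auto intro: mult_left_mono)
      ultimately have n: "norm (p r - p t) \<le> C * (s - r)" "norm (d s - d t) \<le> C * (s - r)"
        by (auto simp: norm_minus_commute)
      have "norm (p r \<bullet> \<delta> t + \<pi> t \<bullet> d s - ?h t) = \<bar>(p r - p t) \<bullet> \<delta> t + \<pi> t \<bullet> (d s - d t)\<bar>"
        by (simp add: algebra_simps)
      also have "\<dots> \<le> norm (p r - p t) * norm (\<delta> t) + norm (\<pi> t) * norm (d s - d t)"
        by (intro order_trans[OF abs_triangle_ineq] add_mono Cauchy_Schwarz_ineq2)
      also have "\<dots> \<le> (C * (s - r)) * C + C * (C * (s - r))"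
        using C(1)[of t] C(2)[of t] t rs n C0 by (intro add_mono mult_mono) auto
      finally show ?thesis by (simp add: power2_eq_square algebra_simps)
    qed
    ultimately have "norm (E s - E r) \<le> 2 * C ^ 2 * (s - r) * (s - r)"
      using has_integral_bound[of "2 * C ^ 2 * (s - r)" _ "E s - E r" r s] rs by auto
    then show ?thesis by (simp add: power2_eq_square mult.assoc)
  qed
  have "(E has_derivative (\<lambda>h. 0)) (at t within {a..b})" if t: "t \<in> {a..b}" for t
    unfolding has_derivative_within_alt
  proof (intro conjI allI impI)
    fix e :: real assume e: "e > 0"
    show "\<exists>\<delta>>0. \<forall>y\<in>{a..b}. norm (y - t) < \<delta> \<longrightarrow> norm (E y - E t - 0) \<le> e * norm (y - t)"
    proof (intro exI[of _ "e / (2 * C ^ 2 + 1)"] conjI ballI impI)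
      show "e / (2 * C ^ 2 + 1) > 0" using e by (simp add: add_nonneg_pos)
      fix y assume y: "y \<in> {a..b}" "norm (y - t) < e / (2 * C ^ 2 + 1)"
      then have "\<bar>y - t\<bar> * (2 * C ^ 2 + 1) \<le> e"
        by (subst pos_le_divide_eq[symmetric]) (auto simp: add_nonneg_pos)
      then have "2 * C ^ 2 * \<bar>y - t\<bar> \<le> e" by (simp add: algebra_simps)
      then have "2 * C ^ 2 * \<bar>y - t\<bar> * \<bar>y - t\<bar> \<le> e * \<bar>y - t\<bar>" by (intro mult_right_mono) auto
      moreover have "\<bar>E y - E t\<bar> \<le> 2 * C ^ 2 * (y - t) ^ 2"
        using E[of t y] E[of y t] y t by (cases "t \<le> y") (auto simp: power2_commute abs_minus_commute)
      ultimately show "norm (E y - E t - 0) \<le> e * norm (y - t)"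
        by (simp add: power2_eq_square abs_mult_self_eq mult.assoc)
    qed
  qed simp
  then have "E b = E a"
    using has_derivative_zero_unique[of "{a..b}" E a b] ab by auto
  then have "integral {a..b} ?h = p b \<bullet> d b - p a \<bullet> d a" by (simp add: E_def)
  then show ?thesis using int by (metis integrable_integral)
qed

lemma borel_measurable_comp_control:
  fixes g :: "'a::euclidean_space \<Rightarrow> 'b::euclidean_space \<Rightarrow> real \<Rightarrow> 'c::euclidean_space"
  assumes g: "continuous_on (UNIV \<times> U \<times> D) (\<lambda>(x, u, t). g x u t)" and U: "closed U" "closed D"
    and x: "continuous_on {a..b} x" and u: "u \<in> borel_measurable (lebesgue_on {a..b})"
    and uU: "\<And>t. t \<in> {a..b} \<Longrightarrow> u t \<in> U" and D: "{a..b} \<subseteq> D"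
  shows "(\<lambda>t. g (x t) (u t) t) \<in> borel_measurable (lebesgue_on {a..b})"
proof -
  have m: "(\<lambda>t. (x t, u t, t)) \<in> borel_measurable (lebesgue_on {a..b})"
    by (intro borel_measurable_Pair u continuous_imp_measurable_on_sets_lebesgue x continuous_on_id) auto
  have "(\<lambda>t. (x t, u t, t)) \<in> measurable (lebesgue_on {a..b}) (restrict_space borel (UNIV \<times> U \<times> D))"
    by (rule measurable_restrict_space2[OF _ m]) (use uU D in auto)
  from measurable_compose[OF this borel_measurable_continuous_on_restrict[OF g]]
  show ?thesis by simp
qed

lemma bounded_measurable_integrable_on:
  fixes g :: "real \<Rightarrow> 'c::euclidean_space"
  assumes "g \<in> borel_measurable (lebesgue_on {a..b})" "\<And>t. t \<in> {a..b} \<Longrightarrow> norm (g t) \<le> C"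
  shows "g integrable_on {a..b}"
  by (rule measurable_bounded_by_integrable_imp_integrable[OF assms(1) integrable_const_ivl assms(2)]) auto

lemma has_vector_derivative_of_integral:
  fixes h :: "real \<Rightarrow> 'c::euclidean_space"
  assumes h: "continuous_on {a..b} h" and z: "\<And>s. s \<in> {a..b} \<Longrightarrow> (h has_integral z s - z a) {a..s}"
    and t: "t \<in> {a..b}"
  shows "(z has_vector_derivative h t) (at t within {a..b})"
proof (rule has_vector_derivative_transform[OF t])
  show "((\<lambda>s. z a + integral {a..s} h) has_vector_derivative h t) (at t within {a..b})"
    using integral_has_vector_derivative[OF h t] by (auto intro!: derivative_eq_intros)
  show "z s = z a + integral {a..s} h" if "s \<in> {a..b}" for s
    using integral_unique[OF z[OF that]] by simp
qed

lemma dominated_convergence_ae: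
  fixes f :: "nat \<Rightarrow> real \<Rightarrow> 'c::euclidean_space"
  assumes f: "\<And>k. f k integrable_on S" and h: "h integrable_on S"
    and le: "\<And>k t. t \<in> S \<Longrightarrow> norm (f k t) \<le> h t" and N: "negligible N"
    and lim: "\<And>t. t \<in> S - N \<Longrightarrow> (\<lambda>k. f k t) \<longlonglongrightarrow> g t"
  shows "g integrable_on S" "(\<lambda>k. integral S (f k)) \<longlonglongrightarrow> integral S g"
proof -
  define f' where "f' k t = (if t \<in> N then 0 else f k t)" for k t
  define g' where "g' t = (if t \<in> N then 0 else g t)" for t
  have fi: "f' k integrable_on S" for k
    by (rule integrable_spike[OF f N]) (auto simp: f'_def)
  have fe: "integral S (f' k) = integral S (f k)" for k
    by (rule integral_spike[OF N]) (auto simp: f'_def)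
  have le': "norm (f' k t) \<le> h t" if "t \<in> S" for k t
    using le[OF that, of k] order_trans[OF norm_ge_zero le[OF that, of k]] by (simp add: f'_def)
  have lim': "(\<lambda>k. f' k t) \<longlonglongrightarrow> g' t" if "t \<in> S" for t
    using lim[of t] that by (auto simp: f'_def g'_def)
  note dc = dominated_convergence[OF fi h le' lim']
  show "g integrable_on S"
    by (rule integrable_spike[OF dc(1) N]) (auto simp: g'_def)
  have "integral S g' = integral S g"
    by (rule integral_spike[OF N]) (auto simp: g'_def)
  then show "(\<lambda>k. integral S (f k)) \<longlonglongrightarrow> integral S g"
    using dc(2) by (simp add: fe)
qed

lemma gradient_bound:
  fixes g :: "'a::euclidean_space \<Rightarrow> real"
  assumes S: "convex S" and g: "\<And>z. z \<in> S \<Longrightarrow> (g has_derivative (\<lambda>h. G z \<bullet> h)) (at z)"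
    and B: "\<And>z. z \<in> S \<Longrightarrow> norm (G z) \<le> B" and xy: "x \<in> S" "y \<in> S"
  shows "\<bar>g x - g y\<bar> \<le> B * norm (x - y)"
proof -
  have "norm (g x - g y) \<le> B * norm (x - y)"
  proof (rule differentiable_bound[OF S _ _ xy, where f' = "\<lambda>z h. G z \<bullet> h"])
    show "(g has_derivative (\<lambda>h. G z \<bullet> h)) (at z within S)" if "z \<in> S" for z
      using g[OF that] by (rule has_derivative_at_withinI)
    show "onorm (\<lambda>h. G z \<bullet> h) \<le> B" if "z \<in> S" for z
    proof (rule onorm_bound)
      show "B \<ge> 0" using B[OF that] norm_ge_zero[of "G z"] by linarith
      show "norm (G z \<bullet> h) \<le> B * norm h" for h
        using Cauchy_Schwarz_ineq2[of "G z" h] mult_right_mono[OF B[OF that] norm_ge_zero[of h]] by simp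
    qed
  qed
  then show ?thesis by simp
qed

lemma continuous_on_compact_bounded:
  fixes g :: "'x::topological_space \<Rightarrow> 'b::real_normed_vector"
  assumes "compact S" "continuous_on S g"
  obtains M where "M \<ge> 0" "\<And>z. z \<in> S \<Longrightarrow> norm (g z) \<le> M"
proof -
  have "bounded (g ` S)" by (intro compact_imp_bounded compact_continuous_image assms)
  then obtain M where "\<And>z. z \<in> S \<Longrightarrow> norm (g z) \<le> M" unfolding bounded_iff by blast
  then show ?thesis using that[of "max M 0"] by fastforce
qed

lemma continuous_on_Icc_bounded:
  fixes x :: "real \<Rightarrow> 'a::real_normed_vector"
  assumes "continuous_on {a..b} x"
  obtains K where "K \<ge> 0" "\<And>t. t \<in> {a..b} \<Longrightarrow> norm (x t) \<le> K"
proof -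
  have "bounded (x ` {a..b})" by (intro compact_imp_bounded compact_continuous_image assms) simp
  then obtain K where "\<And>t. t \<in> {a..b} \<Longrightarrow> norm (x t) \<le> K" unfolding bounded_iff by blast
  then show ?thesis using that[of "max K 0"] by fastforce
qed

section \<open>Measurable selection of maximizers\<close>

definition argmax_on :: "'b set \<Rightarrow> ('b \<Rightarrow> real) \<Rightarrow> 'b set" where
  "argmax_on U \<phi> = {u \<in> U. \<forall>v\<in>U. \<phi> v \<le> \<phi> u}"

lemma argmax_on_nonempty:
  assumes "compact U" "U \<noteq> {}" "continuous_on U \<phi>"
  obtains u where "u \<in> argmax_on U \<phi>"
  using continuous_attains_sup[OF assms] by (auto simp: argmax_on_def)

text \<open>The near-maximizers \<open>u k\<close> need not converge. But every cluster point of them is a maximizer of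
  \<open>\<phi> x\<close>, by continuity, and \<open>g x\<close> has the same value \<open>c\<close> at all of these.\<close>
lemma near_argmax_tendsto:
  fixes \<phi> :: "'x::metric_space \<Rightarrow> 'b::metric_space \<Rightarrow> real" and g :: "'x \<Rightarrow> 'b \<Rightarrow> 'c::metric_space"
  assumes U: "compact U"
    and \<phi>: "continuous_on (S \<times> U) (\<lambda>(x, u). \<phi> x u)" and g: "continuous_on (S \<times> U) (\<lambda>(x, u). g x u)"
    and X: "X \<longlonglongrightarrow> x" "\<And>k. X k \<in> S" "x \<in> S"
    and u: "\<And>k. u k \<in> U" "\<And>k v. v \<in> U \<Longrightarrow> \<phi> (X k) v \<le> \<phi> (X k) (u k) + \<epsilon> k"
    and \<epsilon>: "\<epsilon> \<longlonglongrightarrow> 0"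
    and c: "\<And>v. v \<in> argmax_on U (\<phi> x) \<Longrightarrow> g x v = c"
  shows "(\<lambda>k. g (X k) (u k)) \<longlonglongrightarrow> c"
proof (rule ccontr)
  assume "\<not> ?thesis"
  then obtain e where e: "e > 0" "\<And>n. \<exists>k\<ge>n. dist (g (X k) (u k)) c \<ge> e"
    unfolding LIMSEQ_def by (meson not_le)
  have "infinite {k. dist (g (X k) (u k)) c \<ge> e}"
    using e(2) by (auto simp: infinite_nat_iff_unbounded_le)
  then obtain r :: "nat \<Rightarrow> nat" where r: "strict_mono r" "\<And>n. dist (g (X (r n)) (u (r n))) c \<ge> e"
    using infinite_enumerate[of "{k. dist (g (X k) (u k)) c \<ge> e}"] by auto
  obtain v q where v: "v \<in> U" and q: "strict_mono q" "((\<lambda>n. u (r n)) \<circ> q) \<longlonglongrightarrow> v"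
    using U[unfolded compact_def, rule_format, of "\<lambda>n. u (r n)"] u(1) by blast
  let ?s = "\<lambda>n. r (q n)"
  have s: "strict_mono ?s" using r(1) q(1) by (auto simp: strict_mono_def)
  have uv: "(\<lambda>n. u (?s n)) \<longlonglongrightarrow> v" using q(2) by (simp add: o_def)
  have Xs: "(\<lambda>n. X (?s n)) \<longlonglongrightarrow> x" using LIMSEQ_subseq_LIMSEQ[OF X(1) s] by (simp add: o_def)
  have \<epsilon>s: "(\<lambda>n. \<epsilon> (?s n)) \<longlonglongrightarrow> 0" using LIMSEQ_subseq_LIMSEQ[OF \<epsilon> s] by (simp add: o_def)
  have lim: "(\<lambda>n. h (X (?s n)) (y n)) \<longlonglongrightarrow> h x z"
    if "continuous_on (S \<times> U) (\<lambda>(x, u). h x u)" "y \<longlonglongrightarrow> z" "\<And>n. y n \<in> U" "z \<in> U"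
    for h :: "'x \<Rightarrow> 'b \<Rightarrow> 'd::metric_space" and y z
    using continuous_on_tendsto_compose[OF that(1) tendsto_Pair[OF Xs that(2)]] that X by auto
  have "\<phi> x w \<le> \<phi> x v" if "w \<in> U" for w
  proof (rule LIMSEQ_le)
    show "(\<lambda>n. \<phi> (X (?s n)) w) \<longlonglongrightarrow> \<phi> x w" by (rule lim[OF \<phi>]) (use that in auto)
    have "(\<lambda>n. \<phi> (X (?s n)) (u (?s n)) + \<epsilon> (?s n)) \<longlonglongrightarrow> \<phi> x v + 0"
      by (intro tendsto_add \<epsilon>s lim[OF \<phi> uv] u v)
    then show "(\<lambda>n. \<phi> (X (?s n)) (u (?s n)) + \<epsilon> (?s n)) \<longlonglongrightarrow> \<phi> x v" by simp
  qed (use u(2) that in blast)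
  then have "g x v = c" using c v by (auto simp: argmax_on_def)
  then have "(\<lambda>n. g (X (?s n)) (u (?s n))) \<longlonglongrightarrow> c" using lim[OF g uv u(1) v] by simp
  then obtain n where "dist (g (X (?s n)) (u (?s n))) c < e"
    using e(1) unfolding LIMSEQ_def by blast
  then show False using r(2)[of "q n"] by simp
qed

text \<open>The construction of Kuratowski and Ryll-Nardzewski: measurable functions with values in a countable dense
  set come closer and closer to the set of maximizers and form a Cauchy sequence. Measurability holds
  because the set of times at which a given closed ball contains a maximizer is closed, being the projection
  of a compact set.\<close>
theorem measurable_argmax_selection:
  fixes \<phi> :: "real \<Rightarrow> 'b::euclidean_space \<Rightarrow> real"
  assumes U: "compact U" "U \<noteq> {}" and \<phi>: "continuous_on ({a..b} \<times> U) (\<lambda>(t, u). \<phi> t u)"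
  obtains w where "w \<in> borel_measurable (lebesgue_on {a..b})"
    "\<And>t. t \<in> {a..b} \<Longrightarrow> w t \<in> argmax_on U (\<phi> t)"
proof -
  let ?M = "lebesgue_on {a..b}"
  define A where "A t = argmax_on U (\<phi> t)" for t
  have \<phi>t: "continuous_on U (\<phi> t)" if "t \<in> {a..b}" for t
  proof -
    have "continuous_on U (\<lambda>u. (\<lambda>(t, u). \<phi> t u) (t, u))"
      by (rule continuous_on_compose2[OF \<phi> continuous_on_Pair[OF continuous_on_const continuous_on_id]])
         (use that in auto)
    then show ?thesis by simp
  qed
  have A_ne: "A t \<noteq> {}" if "t \<in> {a..b}" for t
  proof -
    from argmax_on_nonempty[OF U \<phi>t[OF that]] show ?thesis unfolding A_def by blast
  qed
  have hit_closed: "closed {t \<in> {a..b}. A t \<inter> cball z r \<noteq> {}}" for z r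
  proof -
    let ?B = "{a..b} \<times> (U \<inter> cball z r)"
    define K where "K = ?B \<inter> (\<Inter>v\<in>U. ({a..b} \<times> U) \<inter> (\<lambda>(t, u). \<phi> t u - \<phi> t v) -` {0..})"
    have "closed (({a..b} \<times> U) \<inter> (\<lambda>(t, u). \<phi> t u - \<phi> t v) -` {0..})" if "v \<in> U" for v
    proof (rule continuous_closed_preimage)
      have "continuous_on ({a..b} \<times> U) (\<lambda>z. (\<lambda>(t, u). \<phi> t u) (fst z, v))"
        by (rule continuous_on_compose2[OF \<phi> continuous_on_Pair[OF continuous_on_fst[OF continuous_on_id] continuous_on_const]])
           (use that in auto)
      then show "continuous_on ({a..b} \<times> U) (\<lambda>(t, u). \<phi> t u - \<phi> t v)"
        using \<phi> by (auto simp: split_def intro: continuous_on_diff)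
    qed (auto intro: closed_Times compact_imp_closed U)
    then have "compact K" unfolding K_def
      by (intro compact_Int_closed compact_Times compact_Icc compact_Int_closed[OF U(1)] closed_INT) auto
    then have "closed (fst ` K)"
      by (intro compact_imp_closed compact_continuous_image continuous_on_fst continuous_on_id)
    also have "fst ` K = {t \<in> {a..b}. A t \<inter> cball z r \<noteq> {}}"
    proof (intro equalityI subsetI)
      fix t assume "t \<in> fst ` K"
      then obtain u where "(t, u) \<in> K" by auto
      then have "t \<in> {a..b}" "u \<in> A t \<inter> cball z r" using U(2) by (auto simp: K_def A_def argmax_on_def)
      then show "t \<in> {t \<in> {a..b}. A t \<inter> cball z r \<noteq> {}}" by blast
    next
      fix t assume "t \<in> {t \<in> {a..b}. A t \<inter> cball z r \<noteq> {}}"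
      then obtain u where "t \<in> {a..b}" "u \<in> A t" "u \<in> cball z r" by blast
      then have "(t, u) \<in> K" using U(2) by (auto simp: K_def A_def argmax_on_def)
      then show "t \<in> fst ` K" by force
    qed
    finally show ?thesis .
  qed
  have hit_meas: "Measurable.pred ?M (\<lambda>t. A t \<inter> cball z r \<noteq> {})" for z r
    unfolding pred_def
    using hit_closed[of z r] by (auto simp: sets_restrict_space_iff)
  obtain D :: "'b set" where D: "countable D" "\<And>X. open X \<Longrightarrow> X \<noteq> {} \<Longrightarrow> \<exists>d\<in>D. d \<in> X"
    using countable_dense_setE by blast
  define d where "d = from_nat_into D"
  have "D \<noteq> {}" using D(2)[of UNIV] by auto
  have d: "\<exists>n. dist (d n) z < r" if "r > 0" for z r
  proof -
    obtain y where "y \<in> D" "y \<in> ball z r" using D(2)[of "ball z r"] \<open>r > 0\<close> by force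
    moreover obtain n where "d n = y" using \<open>y \<in> D\<close> D(1) \<open>D \<noteq> {}\<close> by (metis d_def from_nat_into_surj)
    ultimately show ?thesis by (auto simp: dist_commute)
  qed
  define \<rho> where "\<rho> k = (1 / 2 :: real) ^ k" for k
  have \<rho>: "\<rho> k > 0" "\<rho> k = 2 * \<rho> (Suc k)" for k by (auto simp: \<rho>_def)
  \<comment> \<open>The bound \<open>3 * \<rho> (Suc k)\<close> is \<open>\<rho> k + \<rho> (Suc k)\<close>, the length of the way from one dense point to the next via a maximizer.\<close>
  define I where "I = rec_nat (\<lambda>t. LEAST n. A t \<inter> cball (d n) (\<rho> 0) \<noteq> {})
    (\<lambda>k J t. LEAST n. A t \<inter> cball (d n) (\<rho> (Suc k)) \<noteq> {} \<and> dist (d n) (d (J t)) < 3 * \<rho> (Suc k))"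
  have I0: "I 0 = (\<lambda>t. LEAST n. A t \<inter> cball (d n) (\<rho> 0) \<noteq> {})"
    and IS: "I (Suc k) = (\<lambda>t. LEAST n. A t \<inter> cball (d n) (\<rho> (Suc k)) \<noteq> {} \<and> dist (d n) (d (I k t)) < 3 * \<rho> (Suc k))" for k
    by (simp_all add: I_def)
  have I_meas: "I k \<in> measurable ?M (count_space UNIV)" for k
  proof (induction k)
    case 0
    show ?case unfolding I0 by (rule measurable_Least) (rule hit_meas)
  next
    case (Suc k)
    have "Measurable.pred ?M (\<lambda>t. dist (d n) (d (I k t)) < 3 * \<rho> (Suc k))" for n
      by (rule measurable_compose[OF Suc]) simp
    then show ?case unfolding IS by (intro measurable_Least pred_intros_logic hit_meas)
  qed
  have near: "A t \<inter> cball (d (I k t)) (\<rho> k) \<noteq> {} \<and> (k > 0 \<longrightarrow> dist (d (I k t)) (d (I (k - 1) t)) < 3 * \<rho> k)"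
    if t: "t \<in> {a..b}" for k t
  proof (induction k)
    case 0
    obtain u where "u \<in> A t" using A_ne[OF t] by auto
    moreover obtain n where "dist (d n) u < \<rho> 0" using d \<rho>(1) by blast
    ultimately have "A t \<inter> cball (d n) (\<rho> 0) \<noteq> {}" by (auto intro: less_imp_le)
    from LeastI[of "\<lambda>n. A t \<inter> cball (d n) (\<rho> 0) \<noteq> {}", OF this] show ?case by (simp add: I0)
  next
    case (Suc k)
    then obtain u where u: "u \<in> A t" "dist (d (I k t)) u \<le> \<rho> k" by auto
    obtain n where n: "dist (d n) u < \<rho> (Suc k)" using d \<rho>(1) by blast
    have "dist (d n) (d (I k t)) \<le> dist (d n) u + dist (d (I k t)) u" by (rule dist_triangle2)
    then have "A t \<inter> cball (d n) (\<rho> (Suc k)) \<noteq> {} \<and> dist (d n) (d (I k t)) < 3 * \<rho> (Suc k)"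
      using u n \<rho>(2)[of k] by (auto intro: less_imp_le)
    from LeastI[of "\<lambda>n. A t \<inter> cball (d n) (\<rho> (Suc k)) \<noteq> {} \<and> dist (d n) (d (I k t)) < 3 * \<rho> (Suc k)", OF this]
    show ?case by (simp add: IS)
  qed
  define w where "w t = lim (\<lambda>k. d (I k t))" for t
  have w: "(\<lambda>k. d (I k t)) \<longlonglongrightarrow> w t" if t: "t \<in> {a..b}" for t
  proof -
    have "summable (\<lambda>k. d (I (Suc k) t) - d (I k t))"
    proof (rule summable_comparison_test')
      show "summable (\<lambda>k. 3 * \<rho> (Suc k))" unfolding \<rho>_def
        by (intro summable_mult) (simp add: summable_geometric)
      show "norm (d (I (Suc k) t) - d (I k t)) \<le> 3 * \<rho> (Suc k)" if "k \<ge> 0" for k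
        using near[OF t, of "Suc k"] by (simp add: dist_norm)
    qed
    then obtain l where "(\<lambda>n. \<Sum>k<n. d (I (Suc k) t) - d (I k t)) \<longlonglongrightarrow> l"
      using summable_LIMSEQ by blast
    then have "(\<lambda>n. d (I n t) - d (I 0 t)) \<longlonglongrightarrow> l"
      by (simp add: sum_lessThan_telescope[of "\<lambda>k. d (I k t)"])
    then have "(\<lambda>n. (d (I n t) - d (I 0 t)) + d (I 0 t)) \<longlonglongrightarrow> l + d (I 0 t)"
      by (intro tendsto_add tendsto_const)
    then have "(\<lambda>n. d (I n t)) \<longlonglongrightarrow> l + d (I 0 t)" by simp
    then show ?thesis unfolding w_def by (simp add: limI)
  qed
  show ?thesis
  proof (rule that[of w])
    show "w \<in> borel_measurable ?M"
    proof (rule borel_measurable_LIMSEQ_metric[where f = "\<lambda>k t. d (I k t)"])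
      show "(\<lambda>t. d (I k t)) \<in> borel_measurable ?M" for k
        by (rule measurable_compose[OF I_meas]) simp
    qed (use w in auto)
    fix t assume t: "t \<in> {a..b}"
    have "\<exists>y. y \<in> A t \<and> dist (d (I k t)) y \<le> \<rho> k" for k using near[OF t, of k] by auto
    then obtain y where y: "\<And>k. y k \<in> A t" "\<And>k. dist (d (I k t)) (y k) \<le> \<rho> k"
      by metis
    have "\<rho> \<longlonglongrightarrow> 0" unfolding \<rho>_def by (intro LIMSEQ_realpow_zero) auto
    then have "(\<lambda>k. dist (d (I k t)) (y k)) \<longlonglongrightarrow> 0"
      by (rule tendsto_sandwich[OF _ _ tendsto_const, rotated 2]) (auto simp: y)
    then have "(\<lambda>k. y k - d (I k t)) \<longlonglongrightarrow> 0"
      by (subst tendsto_norm_zero_iff[symmetric]) (simp add: dist_norm norm_minus_commute)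
    then have yw: "y \<longlonglongrightarrow> w t" using Lim_transform[OF w[OF t]] by blast
    have "w t \<in> U"
      using closed_sequentially[OF compact_imp_closed[OF U(1)] _ yw] y(1) by (auto simp: A_def argmax_on_def)
    moreover have "\<phi> t v \<le> \<phi> t (w t)" if "v \<in> U" for v
    proof (rule LIMSEQ_le_const)
      show "(\<lambda>k. \<phi> t (y k)) \<longlonglongrightarrow> \<phi> t (w t)"
        using continuous_on_tendsto_compose[OF \<phi>t[OF t] yw \<open>w t \<in> U\<close>] y(1)
        by (auto simp: A_def argmax_on_def)
      show "\<exists>N. \<forall>n\<ge>N. \<phi> t v \<le> \<phi> t (y n)" using y(1) that by (auto simp: A_def argmax_on_def)
    qed
    ultimately show "w t \<in> argmax_on U (\<phi> t)" by (simp add: argmax_on_def)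
  qed
qed

section \<open>Solutions of a control system\<close>

text \<open>The integrated form of \<open>x' = f x u t\<close>. It restricts to subintervals, is insensitive to changes of \<open>u\<close> on null sets
  and passes to limits. The type of the controls is arbitrary because the adjoint equation, too, is of this
  form, with the pair of state and control as its control.\<close>
definition integral_solution ::
    "('a::euclidean_space \<Rightarrow> 'b \<Rightarrow> real \<Rightarrow> 'a) \<Rightarrow> (real \<Rightarrow> 'b) \<Rightarrow> real \<Rightarrow> real \<Rightarrow> (real \<Rightarrow> 'a) \<Rightarrow> bool" where
  "integral_solution f u a b x \<longleftrightarrow> continuous_on {a..b} x \<and>
     (\<forall>r s. a \<le> r \<and> r \<le> s \<and> s \<le> b \<longrightarrow> ((\<lambda>t. f (x t) (u t) t) has_integral x s - x r) {r..s})"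

lemma integral_solutionD:
  assumes "integral_solution f u a b x"
  shows "continuous_on {a..b} x"
    "\<And>r s. a \<le> r \<Longrightarrow> r \<le> s \<Longrightarrow> s \<le> b \<Longrightarrow> ((\<lambda>t. f (x t) (u t) t) has_integral x s - x r) {r..s}"
  using assms by (auto simp: integral_solution_def)

lemma integral_solution_subset:
  assumes "integral_solution f u a b x" "a \<le> c" "d \<le> b"
  shows "integral_solution f u c d x"
proof -
  have "continuous_on {c..d} x"
    using integral_solutionD(1)[OF assms(1)] by (rule continuous_on_subset) (use assms in auto)
  then show ?thesis using assms unfolding integral_solution_def by auto
qed

lemma integral_solution_cong_ae:
  assumes sol: "integral_solution f u a b x" and N: "negligible N"
    and eq: "\<And>t. t \<in> {a..b} - N \<Longrightarrow> v t = u t"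
  shows "integral_solution f v a b x"
  unfolding integral_solution_def
proof (intro conjI allI impI integral_solutionD(1)[OF sol])
  fix r s assume rs: "a \<le> r \<and> r \<le> s \<and> s \<le> b"
  then have "((\<lambda>t. f (x t) (u t) t) has_integral x s - x r) {r..s}"
    using integral_solutionD(2)[OF sol] by blast
  then show "((\<lambda>t. f (x t) (v t) t) has_integral x s - x r) {r..s}"
    by (rule has_integral_spike[OF N, rotated]) (use eq rs in auto)
qed

lemma integral_solution_of_ae_solves:
  fixes x :: "real \<Rightarrow> 'a::euclidean_space"
  assumes sol: "ae_solves a b x (\<lambda>t. f (x t) (u t) t)" and ab: "a \<le> b"
  shows "integral_solution f u a b x"
proof -
  let ?g = "\<lambda>t. f (x t) (u t) t"
  have int: "(?g has_integral x s - x r) {r..s}" if "a \<le> r" "r \<le> s" "s \<le> b" for r s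
    using ae_solves_has_integral[OF ae_solves_subset[OF sol that(1,3)] that(2)] .
  have "continuous_on {a..b} (\<lambda>s. x a + integral {a..s} ?g)"
    using int[of a b] ab by (intro continuous_intros indefinite_integral_continuous_1) auto
  moreover have "x a + integral {a..s} ?g = x s" if "s \<in> {a..b}" for s
    using integral_unique[OF int[of a s]] that by simp
  ultimately have "continuous_on {a..b} x" by (rule continuous_on_eq)
  then show ?thesis using int by (auto simp: integral_solution_def)
qed

lemma integral_solution_diff_le:
  assumes x: "integral_solution f u a b x" and y: "integral_solution f v a b y"
    and rs: "a \<le> r" "r \<le> s" "s \<le> b"
    and h: "h integrable_on {r..s}" "\<And>t. t \<in> {r..s} \<Longrightarrow> norm (f (x t) (u t) t - f (y t) (v t) t) \<le> h t"
  shows "norm ((x s - y s) - (x r - y r)) \<le> integral {r..s} h"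
proof -
  have i: "((\<lambda>t. f (x t) (u t) t - f (y t) (v t) t) has_integral (x s - x r) - (y s - y r)) {r..s}"
    by (intro has_integral_diff integral_solutionD(2)[OF x] integral_solutionD(2)[OF y] rs)
  have "norm (integral {r..s} (\<lambda>t. f (x t) (u t) t - f (y t) (v t) t)) \<le> integral {r..s} h"
    by (rule integral_norm_bound_integral) (use i h in auto)
  then show ?thesis using integral_unique[OF i] by (simp add: algebra_simps)
qed

lemma integral_solution_gronwall:
  assumes x: "integral_solution f u a b x" and y: "integral_solution f u a b y"
    and L: "L \<ge> 0" "\<And>t. t \<in> {a..b} \<Longrightarrow> norm (f (x t) (u t) t - f (y t) (u t) t) \<le> L * norm (x t - y t)"
    and rs: "a \<le> r" "r \<le> s" "s \<le> b"
  shows "norm (x s - y s) \<le> norm (x r - y r) * exp (L * (s - r))"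
    and "norm (x r - y r) \<le> norm (x s - y s) * exp (L * (s - r))"
proof -
  have c: "continuous_on {a'..b'} (\<lambda>t. norm (x t - y t))" if "a \<le> a'" "b' \<le> b" for a' b'
    using integral_solutionD(1)[OF x] integral_solutionD(1)[OF y] that
    by (auto intro!: continuous_intros intro: continuous_on_subset)
  have d: "norm ((x s' - y s') - (x r' - y r')) \<le> L * integral {r'..s'} (\<lambda>t. norm (x t - y t))"
    if "a \<le> r'" "r' \<le> s'" "s' \<le> b" for r' s'
  proof -
    have i: "(\<lambda>t. norm (x t - y t)) integrable_on {r'..s'}"
      using that by (intro integrable_continuous_interval c)
    have "norm ((x s' - y s') - (x r' - y r')) \<le> integral {r'..s'} (\<lambda>t. L * norm (x t - y t))"
      using that L i integrable_cmul[OF i, of L]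
      by (intro integral_solution_diff_le[OF x y]) auto
    then show ?thesis by simp
  qed
  show "norm (x s - y s) \<le> norm (x r - y r) * exp (L * (s - r))"
  proof (rule gronwall_integral[OF c L(1)])
    fix t assume t: "t \<in> {r..s}"
    have "norm (x t - y t) \<le> norm (x r - y r) + norm ((x t - y t) - (x r - y r))"
      by (rule norm_triangle_sub)
    then show "norm (x t - y t) \<le> norm (x r - y r) + L * integral {r..t} (\<lambda>t. norm (x t - y t))"
      using d[of r t] t rs by auto
  qed (use rs in auto)
  show "norm (x r - y r) \<le> norm (x s - y s) * exp (L * (s - r))"
  proof (rule gronwall_integral_backward[OF c L(1)])
    fix t assume t: "t \<in> {r..s}"
    have "norm (x t - y t) \<le> norm (x s - y s) + norm ((x t - y t) - (x s - y s))"
      by (rule norm_triangle_sub)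
    then show "norm (x t - y t) \<le> norm (x s - y s) + L * integral {t..s} (\<lambda>t. norm (x t - y t))"
      using d[of t s] t rs norm_minus_commute[of "x t - y t" "x s - y s"] by auto
  qed (use rs in auto)
qed

text \<open>The last assumption, for all initial times and states, yields trajectories from \<open>x0\<close> that are bounded
  uniformly in the control.\<close>
locale control_flow =
  fixes U :: "(real^'m) set" and t0 T :: real
    and f :: "'a::euclidean_space \<Rightarrow> real^'m \<Rightarrow> real \<Rightarrow> 'a"
  assumes U: "compact U" "U \<noteq> {}"
    and f_cont: "continuous_on (UNIV \<times> U \<times> {t0..T}) (\<lambda>(x, u, t). f x u t)"
    and f_lip: "\<And>R. \<exists>L\<ge>0. \<forall>x y u t. norm x \<le> R \<longrightarrow> norm y \<le> R \<longrightarrow> u \<in> U \<longrightarrow> t \<in> {t0..T} \<longrightarrow>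
          norm (f x u t - f y u t) \<le> L * norm (x - y)"
    and ex_solution: "\<And>s u y. s \<in> {t0..T} \<Longrightarrow> u \<in> controls U T s \<Longrightarrow>
          \<exists>x. integral_solution f u s T x \<and> x s = y"
begin

lemma f_bounded:
  obtains M where "M \<ge> 0" "\<And>x u t. norm x \<le> R \<Longrightarrow> u \<in> U \<Longrightarrow> t \<in> {t0..T} \<Longrightarrow> norm (f x u t) \<le> M"
proof -
  have "compact (cball (0::'a) R \<times> U \<times> {t0..T})" by (intro compact_Times U) auto
  then have "bounded ((\<lambda>(x, u, t). f x u t) ` (cball 0 R \<times> U \<times> {t0..T}))"
    by (intro compact_imp_bounded compact_continuous_image continuous_on_subset[OF f_cont]) auto
  then obtain M where M: "\<And>z. z \<in> (\<lambda>(x, u, t). f x u t) ` (cball 0 R \<times> U \<times> {t0..T}) \<Longrightarrow> norm z \<le> M"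
    unfolding bounded_iff by blast
  have "norm (f x u t) \<le> max M 0" if "norm x \<le> R" "u \<in> U" "t \<in> {t0..T}" for x u t
  proof -
    have "f x u t \<in> (\<lambda>(x, u, t). f x u t) ` (cball 0 R \<times> U \<times> {t0..T})"
      using that by (intro image_eqI[of _ _ "(x, u, t)"]) auto
    from M[OF this] show ?thesis by simp
  qed
  then show ?thesis using that[of "max M 0"] by simp
qed

definition lipschitz_upto :: "real \<Rightarrow> real \<Rightarrow> bool" where
  "lipschitz_upto R L \<longleftrightarrow> 0 \<le> L \<and> (\<forall>x y u t. norm x \<le> R \<longrightarrow> norm y \<le> R \<longrightarrow> u \<in> U \<longrightarrow> t \<in> {t0..T} \<longrightarrow>
      norm (f x u t - f y u t) \<le> L * norm (x - y))"

lemma lipschitz_uptoD: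
  assumes "lipschitz_upto R L"
  shows "0 \<le> L" "\<And>x y u t. norm x \<le> R \<Longrightarrow> norm y \<le> R \<Longrightarrow> u \<in> U \<Longrightarrow> t \<in> {t0..T} \<Longrightarrow>
      norm (f x u t - f y u t) \<le> L * norm (x - y)"
  using assms unfolding lipschitz_upto_def by blast+

lemma f_lipschitz: "\<exists>L. lipschitz_upto R L"
  using f_lip[of R] unfolding lipschitz_upto_def by blast

lemma controls_subset:
  assumes "u \<in> controls U T s" "s \<le> r"
  shows "u \<in> controls U T r"
proof -
  have u: "u \<in> borel_measurable (lebesgue_on {s..T})" "\<forall>t\<in>{s..T}. u t \<in> U"
    using assms(1) unfolding controls_def by blast+
  have sub: "{r..T} \<subseteq> {s..T}" using assms(2) by auto
  have "u \<in> borel_measurable (lebesgue_on {r..T})"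
    by (rule measurable_restrict_mono[OF u(1) sub])
  then show ?thesis unfolding controls_def using u(2) sub by blast
qed

lemma controls_in: "u \<in> controls U T s \<Longrightarrow> t \<in> {s..T} \<Longrightarrow> u t \<in> U"
  unfolding controls_def by blast

lemma controls_measurable: "u \<in> controls U T s \<Longrightarrow> u \<in> borel_measurable (lebesgue_on {s..T})"
  unfolding controls_def by blast

lemma controlsI:
  "u \<in> borel_measurable (lebesgue_on {s..T}) \<Longrightarrow> (\<And>t. t \<in> {s..T} \<Longrightarrow> u t \<in> U) \<Longrightarrow> u \<in> controls U T s"
  unfolding controls_def by blast

text \<open>A solution that starts close enough to a bounded one stays within distance 1 of it, hence in a ball on which
  one Lipschitz constant serves both; closeness is measured by the Gronwall factor only, not by the control.\<close>
lemma solution_stays_close: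
  assumes lip: "lipschitz_upto (K + 1) L"
    and x: "integral_solution f u a b x" and y: "integral_solution f u a b y"
    and ab: "t0 \<le> a" "b \<le> T" and u: "\<And>t. t \<in> {a..b} \<Longrightarrow> u t \<in> U"
    and K: "\<And>t. t \<in> {a..b} \<Longrightarrow> norm (x t) \<le> K"
    and c: "norm (x a - y a) * exp (L * (T - t0)) < 1" and r: "r \<in> {a..b}"
  shows "norm (x r - y r) \<le> norm (x a - y a) * exp (L * (T - t0))" "norm (y r) \<le> K + 1"
proof -
  note L = lipschitz_uptoD[OF lip]
  show A: "norm (x r - y r) \<le> norm (x a - y a) * exp (L * (T - t0))"
  proof (rule continuity_bootstrap[where e = "\<lambda>t. norm (x t - y t)", OF _ c, of a b])
    show "continuous_on {a..b} (\<lambda>t. norm (x t - y t))"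
      by (intro continuous_intros integral_solutionD(1)[OF x] integral_solutionD(1)[OF y])
    have "norm (x a - y a) * 1 \<le> norm (x a - y a) * exp (L * (T - t0))"
      using L(1) ab r by (intro mult_left_mono) auto
    then show "norm (x a - y a) \<le> 1" using c by simp
  next
    fix q assume q: "q \<in> {a..b}" "\<And>r'. r' \<in> {a..q} \<Longrightarrow> norm (x r' - y r') \<le> 1"
    have yK: "norm (y t) \<le> K + 1" if "t \<in> {a..q}" for t
    proof -
      have "norm (y t) \<le> norm (x t) + norm (x t - y t)"
        using norm_triangle_sub[of "y t" "x t"] by (simp add: norm_minus_commute)
      then show ?thesis using K[of t] q(2)[OF that] q(1) that by auto
    qed
    have "norm (x q - y q) \<le> norm (x a - y a) * exp (L * (q - a))"
    proof (rule integral_solution_gronwall(1)[of f u a q])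
      show "integral_solution f u a q x" "integral_solution f u a q y"
        using q(1) by (auto intro: integral_solution_subset[OF x] integral_solution_subset[OF y])
      show "norm (f (x t) (u t) t - f (y t) (u t) t) \<le> L * norm (x t - y t)" if "t \<in> {a..q}" for t
        using K[of t] yK[OF that] that q(1) ab by (intro L u) auto
    qed (use q(1) L in auto)
    also have "\<dots> \<le> norm (x a - y a) * exp (L * (T - t0))"
      using q(1) ab L(1) by (intro mult_left_mono) (auto intro: mult_left_mono)
    finally show "norm (x q - y q) \<le> norm (x a - y a) * exp (L * (T - t0))" .
  qed (use r in auto)
  have "norm (y r) \<le> norm (x r) + norm (x r - y r)"
    using norm_triangle_sub[of "y r" "x r"] by (simp add: norm_minus_commute)
  then show "norm (y r) \<le> K + 1" using A c K[OF r] by simp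
qed

lemma solution_unique:
  assumes x: "integral_solution f u a b x" and y: "integral_solution f u a b y"
    and ab: "t0 \<le> a" "b \<le> T" and u: "\<And>t. t \<in> {a..b} \<Longrightarrow> u t \<in> U"
    and rs: "r \<in> {a..b}" "x r = y r" and s: "s \<in> {a..b}"
  shows "x s = y s"
proof -
  obtain K1 where K1: "\<And>t. t \<in> {a..b} \<Longrightarrow> norm (x t) \<le> K1"
    using continuous_on_Icc_bounded[OF integral_solutionD(1)[OF x]] by blast
  obtain K2 where K2: "\<And>t. t \<in> {a..b} \<Longrightarrow> norm (y t) \<le> K2"
    using continuous_on_Icc_bounded[OF integral_solutionD(1)[OF y]] by blast
  obtain L where lip: "lipschitz_upto (max K1 K2) L" using f_lipschitz by blast
  note L = lipschitz_uptoD[OF lip]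
  have LL: "norm (f (x t) (u t) t - f (y t) (u t) t) \<le> L * norm (x t - y t)" if "t \<in> {a..b}" for t
    using K1[OF that] K2[OF that] that ab by (intro L u) auto
  note G = integral_solution_gronwall[OF x y L(1) LL]
  show ?thesis
  proof (cases "r \<le> s")
    case True then show ?thesis using G(1)[of r s] rs s by auto
  next
    case False then show ?thesis using G(2)[of s r] rs s by auto
  qed
qed

definition traj :: "(real \<Rightarrow> real^'m) \<Rightarrow> real \<Rightarrow> 'a \<Rightarrow> real \<Rightarrow> 'a" where
  "traj u s y = (SOME x. integral_solution f u s T x \<and> x s = y)"

lemma traj:
  assumes "s \<in> {t0..T}" "u \<in> controls U T s"
  shows "integral_solution f u s T (traj u s y)" "traj u s y s = y"
  using someI_ex[OF ex_solution[OF assms, of y]] by (auto simp: traj_def)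

lemma traj_eq:
  assumes "s \<in> {t0..T}" "u \<in> controls U T s" "integral_solution f u s b x" "x s = y" "b \<le> T" "r \<in> {s..b}"
  shows "traj u s y r = x r"
proof (rule solution_unique[where u = u and a = s and b = b and r = s])
  show "integral_solution f u s b (traj u s y)"
    by (rule integral_solution_subset[OF traj(1)[OF assms(1,2)]]) (use assms in auto)
qed (use assms traj(2)[OF assms(1,2)] controls_in[OF assms(2)] in auto)

lemma traj_restart:
  assumes "s \<in> {t0..T}" "u \<in> controls U T s" "s \<le> s'" "s' \<le> T" "r \<in> {s'..T}"
  shows "traj u s' (traj u s y s') r = traj u s y r"
  by (rule traj_eq[of s' u T])
     (use assms controls_subset[OF assms(2,3)] integral_solution_subset[OF traj(1)[OF assms(1,2)], of s' T y] in auto)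

lemma traj_cong_before:
  assumes "s \<in> {t0..T}" "u \<in> controls U T s" "v \<in> controls U T s" "s' \<le> T"
    and eq: "\<And>t. t \<in> {s..<s'} \<Longrightarrow> v t = u t" and r: "r \<in> {s..s'}"
  shows "traj v s y r = traj u s y r"
proof (rule traj_eq[of s v s'])
  have "integral_solution f u s s' (traj u s y)"
    by (rule integral_solution_subset[OF traj(1)]) (use assms in auto)
  then show "integral_solution f v s s' (traj u s y)"
    by (rule integral_solution_cong_ae[where N = "{s'}"]) (use eq in auto)
qed (use assms traj(2) in auto)

lemma traj_cong_after:
  assumes "s \<in> {t0..T}" "u \<in> controls U T s" "v \<in> controls U T s"
    and eq: "\<And>t. t \<in> {s..T} \<Longrightarrow> v t = u t" and r: "r \<in> {s..T}"
  shows "traj v s y r = traj u s y r"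
  by (rule traj_cong_before[of s u v T]) (use assms in auto)

lemma traj_close:
  assumes s: "s \<in> {t0..T}" and K: "\<And>r. r \<in> {s..s'} \<Longrightarrow> norm (traj u s y r) \<le> K"
    and u: "u \<in> controls U T s" and s': "s' \<le> T"
    and lip: "lipschitz_upto (K + 1) L"
    and c: "norm (y - y') * exp (L * (T - t0)) < 1" and r: "r \<in> {s..s'}"
  shows "norm (traj u s y r - traj u s y' r) \<le> norm (y - y') * exp (L * (T - t0))"
    "norm (traj u s y' r) \<le> K + 1"
    "norm (y - y') \<le> norm (traj u s y r - traj u s y' r) * exp (L * (T - t0))"
proof -
  note L = lipschitz_uptoD[OF lip]
  have sol: "integral_solution f u s s' (traj u s z)" for z
    by (rule integral_solution_subset[OF traj(1)[OF s u]]) (use s' in auto)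
  note close = solution_stays_close[of K L u s s' "traj u s y" "traj u s y'", unfolded traj(2)[OF s u]]
  have A: "norm (traj u s y q - traj u s y' q) \<le> norm (y - y') * exp (L * (T - t0))"
    "norm (traj u s y' q) \<le> K + 1" if "q \<in> {s..s'}" for q
  proof -
    show "norm (traj u s y q - traj u s y' q) \<le> norm (y - y') * exp (L * (T - t0))"
      by (rule close(1)[OF lip sol sol]) (use s s' that K c controls_in[OF u] in auto)
    show "norm (traj u s y' q) \<le> K + 1"
      by (rule close(2)[OF lip sol sol]) (use s s' that K c controls_in[OF u] in auto)
  qed
  show "norm (traj u s y r - traj u s y' r) \<le> norm (y - y') * exp (L * (T - t0))"
    "norm (traj u s y' r) \<le> K + 1" using A[OF r] by auto
  have "norm (traj u s y s - traj u s y' s) \<le> norm (traj u s y r - traj u s y' r) * exp (L * (r - s))"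
  proof (rule integral_solution_gronwall(2)[OF sol sol L(1)])
    fix t assume t: "t \<in> {s..s'}"
    show "norm (f (traj u s y t) (u t) t - f (traj u s y' t) (u t) t) \<le> L * norm (traj u s y t - traj u s y' t)"
      using K[OF t] A(2)[OF t] t s s' controls_in[OF u, of t] by (intro L) auto
  qed (use r in auto)
  also have "\<dots> \<le> norm (traj u s y r - traj u s y' r) * exp (L * (T - t0))"
    using r s s' L(1) by (intro mult_left_mono) (auto intro: mult_left_mono)
  finally show "norm (y - y') \<le> norm (traj u s y r - traj u s y' r) * exp (L * (T - t0))"
    by (simp add: traj(2)[OF s u])
qed

lemma traj_continuous:
  assumes s: "s \<in> {t0..T}" and u: "u \<in> controls U T s" and r: "r \<in> {s..T}"
  shows "continuous_on UNIV (\<lambda>y. traj u s y r)"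
  unfolding continuous_on_iff
proof (intro ballI allI impI)
  fix y :: 'a and e :: real assume e: "e > 0"
  obtain K where K: "\<And>t. t \<in> {s..T} \<Longrightarrow> norm (traj u s y t) \<le> K"
    using continuous_on_Icc_bounded[OF integral_solutionD(1)[OF traj(1)[OF s u]]] by blast
  obtain L where lip: "lipschitz_upto (K + 1) L" using f_lipschitz by blast
  note L = lipschitz_uptoD[OF lip]
  let ?E = "exp (L * (T - t0))"
  show "\<exists>d>0. \<forall>y'\<in>UNIV. dist y' y < d \<longrightarrow> dist (traj u s y' r) (traj u s y r) < e"
  proof (intro exI[of _ "min 1 e / ?E"] conjI ballI impI)
    show "min 1 e / ?E > 0" using e by simp
    fix y' assume "dist y' y < min 1 e / ?E"
    then have d: "norm (y - y') * ?E < min 1 e"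
      by (simp add: dist_norm norm_minus_commute pos_less_divide_eq)
    have "norm (traj u s y r - traj u s y' r) \<le> norm (y - y') * ?E"
      by (rule traj_close(1)[OF s K u _ lip]) (use d r in auto)
    then show "dist (traj u s y' r) (traj u s y r) < e"
      using d by (simp add: dist_norm norm_minus_commute)
  qed
qed

lemma traj_inj:
  assumes s: "s \<in> {t0..T}" and u: "u \<in> controls U T s" and r: "r \<in> {s..T}"
  shows "inj (\<lambda>y. traj u s y r)"
proof (rule injI)
  fix y y' assume "traj u s y r = traj u s y' r"
  then have "traj u s y s = traj u s y' s"
    by (rule solution_unique[OF traj(1)[OF s u] traj(1)[OF s u] _ _ controls_in[OF u], rotated 4])
       (use s r in auto)
  then show "y = y'" by (simp add: traj(2)[OF s u])
qed

text \<open>Solvability backwards in time is not assumed. Invariance of domain replaces it: the flow map is continuous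
  and injective, hence open, so all points near an endpoint are endpoints of trajectories that start
  nearby.\<close>
lemma traj_open_image:
  assumes "s \<in> {t0..T}" "u \<in> controls U T s" "r \<in> {s..T}" "open V"
  shows "open ((\<lambda>y. traj u s y r) ` V)"
  by (rule invariance_of_domain[OF continuous_on_subset[OF traj_continuous[OF assms(1-3)]] assms(4)])
     (use inj_on_subset[OF traj_inj[OF assms(1-3)] subset_UNIV] in auto)

text \<open>Openness of the flow map with a radius that does not depend on the control. By the backward Gronwall estimate
  the boundary of the ball around \<open>y\<close> is mapped outside the ball of radius \<open>\<rho> / exp (L * (T - t0))\<close>. On
  this connected ball the image of the open ball around \<open>y\<close> is therefore both open and closed.\<close>
lemma traj_covers_ball:
  assumes s: "s \<in> {t0..T}" and K: "\<And>r. r \<in> {s..s'} \<Longrightarrow> norm (traj u s y r) \<le> K"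
    and u: "u \<in> controls U T s" and s': "s' \<in> {s..T}"
    and lip: "lipschitz_upto (K + 1) L"
    and \<rho>: "\<rho> > 0" "\<rho> * exp (L * (T - t0)) < 1"
  shows "ball (traj u s y s') (\<rho> / exp (L * (T - t0))) \<subseteq> (\<lambda>y'. traj u s y' s') ` ball y \<rho>"
proof -
  let ?\<Phi> = "\<lambda>y'. traj u s y' s'" and ?E = "exp (L * (T - t0))"
  let ?B = "ball (?\<Phi> y) (\<rho> / ?E)"
  have op: "open (?\<Phi> ` ball y \<rho>)" by (rule traj_open_image[OF s u s']) simp
  have cl: "closed (?\<Phi> ` cball y \<rho>)"
    by (intro compact_imp_closed compact_continuous_image continuous_on_subset[OF traj_continuous[OF s u s']]) auto
  have "?B \<inter> ?\<Phi> ` cball y \<rho> \<subseteq> ?\<Phi> ` ball y \<rho>"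
  proof clarify
    fix y' assume y': "y' \<in> cball y \<rho>" "?\<Phi> y' \<in> ?B"
    have le: "norm (y - y') \<le> \<rho>" using y'(1) by (simp add: dist_norm)
    then have "norm (y - y') * ?E \<le> \<rho> * ?E" by (intro mult_right_mono) auto
    then have "norm (y - y') * ?E < 1" using \<rho>(2) by linarith
    then have "norm (y - y') \<le> norm (?\<Phi> y - ?\<Phi> y') * ?E"
      by (intro traj_close(3)[OF s K u _ lip]) (use s' in auto)
    also have "\<dots> < \<rho> / ?E * ?E"
      using y'(2) by (intro mult_strict_right_mono) (auto simp: dist_norm)
    finally have "y' \<in> ball y \<rho>" by (simp add: dist_norm)
    then show "?\<Phi> y' \<in> ?\<Phi> ` ball y \<rho>" by blast
  qed
  then have sub: "?B \<subseteq> ?\<Phi> ` ball y \<rho> \<union> - (?\<Phi> ` cball y \<rho>)" by blast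
  have disj: "?\<Phi> ` ball y \<rho> \<inter> - (?\<Phi> ` cball y \<rho>) \<inter> ?B = {}"
    using image_mono[OF ball_subset_cball[of y \<rho>], of ?\<Phi>] by blast
  have "?\<Phi> y \<in> ?\<Phi> ` ball y \<rho> \<inter> ?B" using \<rho> by auto
  then have "- (?\<Phi> ` cball y \<rho>) \<inter> ?B = {}"
    using connectedD[OF connected_ball op open_Compl[OF cl] disj sub] by blast
  then show ?thesis using sub by blast
qed

section \<open>Boundedness of the reachable sets\<close>

definition bounded_reach :: "'a \<Rightarrow> real \<Rightarrow> real \<Rightarrow> bool" where
  "bounded_reach y s s' \<longleftrightarrow> (\<exists>K. \<forall>u\<in>controls U T s. \<forall>r\<in>{s..s'}. norm (traj u s y r) \<le> K)"

lemma bounded_reach_mono: "bounded_reach y s s' \<Longrightarrow> s'' \<le> s' \<Longrightarrow> bounded_reach y s s''"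
  unfolding bounded_reach_def by force

lemma bounded_reach_short_time:
  obtains \<delta> where "\<delta> > 0"
    "\<And>s y u r. s \<in> {t0..T} \<Longrightarrow> norm y \<le> R \<Longrightarrow> u \<in> controls U T s \<Longrightarrow> r \<in> {s..min T (s + \<delta>)} \<Longrightarrow>
       norm (traj u s y r) \<le> R + 1"
proof -
  obtain M where M: "M \<ge> 0" "\<And>x u t. norm x \<le> R + 1 \<Longrightarrow> u \<in> U \<Longrightarrow> t \<in> {t0..T} \<Longrightarrow> norm (f x u t) \<le> M"
    using f_bounded[of "R + 1"] by blast
  define \<delta> where "\<delta> = 1 / (2 * (M + 1))"
  have \<delta>: "\<delta> > 0" "M * \<delta> \<le> 1 / 2" using M(1) by (auto simp: \<delta>_def field_simps)
  have "norm (traj u s y r) \<le> R + 1"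
    if s: "s \<in> {t0..T}" and y: "norm y \<le> R" and u: "u \<in> controls U T s" and r: "r \<in> {s..min T (s + \<delta>)}"
    for s y u r
  proof -
    let ?x = "traj u s y"
    note x = traj(1)[OF s u, of y] and x0 = traj(2)[OF s u, of y]
    have "norm (?x r - y) \<le> 1 / 2"
    proof (rule continuity_bootstrap[where e = "\<lambda>t. norm (?x t - y)" and a = s and b = "min T (s + \<delta>)" and k = 1])
      show "continuous_on {s..min T (s + \<delta>)} (\<lambda>t. norm (?x t - y))"
        by (intro continuous_intros continuous_on_subset[OF integral_solutionD(1)[OF x]]) auto
      show "norm (?x s - y) \<le> 1" by (simp add: x0)
      fix q assume q: "q \<in> {s..min T (s + \<delta>)}" "\<And>r'. r' \<in> {s..q} \<Longrightarrow> norm (?x r' - y) \<le> 1"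
      have "norm (?x q - ?x s) \<le> M * Henstock_Kurzweil_Integration.content {s..q}"
      proof (rule has_integral_bound_real[OF M(1)])
        show "((\<lambda>t. f (?x t) (u t) t) has_integral ?x q - ?x s) {s..q}"
          by (rule integral_solutionD(2)[OF x]) (use q(1) in auto)
        show "finite {}" by simp
        fix t assume t: "t \<in> {s..q} - {}"
        have "norm (?x t) \<le> norm y + norm (?x t - y)" by (rule norm_triangle_sub)
        then have "norm (?x t) \<le> R + 1" using q(2)[of t] t y by auto
        then show "norm (f (?x t) (u t) t) \<le> M"
          using t q(1) s controls_in[OF u, of t] by (intro M) auto
      qed
      also have "\<dots> \<le> M * \<delta>" using q(1) M(1) by (intro mult_left_mono) auto
      finally show "norm (?x q - y) \<le> 1 / 2" using \<delta>(2) x0 by simp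
    qed (use r in auto)
    then show "norm (?x r) \<le> R + 1"
      using norm_triangle_sub[of "?x r" y] y by simp
  qed
  then show ?thesis using \<delta>(1) that by blast
qed

text \<open>Uniform boundedness is an open condition on the initial state, because trajectories with the same control
  stay close.\<close>
lemma bounded_reach_nearby:
  assumes "bounded_reach y s s'" "s \<in> {t0..T}" "s' \<le> T"
  obtains \<epsilon> K where "\<epsilon> > 0"
    "\<And>y' u r. norm (y - y') < \<epsilon> \<Longrightarrow> u \<in> controls U T s \<Longrightarrow> r \<in> {s..s'} \<Longrightarrow> norm (traj u s y' r) \<le> K"
proof -
  obtain K where K: "\<And>u r. u \<in> controls U T s \<Longrightarrow> r \<in> {s..s'} \<Longrightarrow> norm (traj u s y r) \<le> K"
    using assms(1) unfolding bounded_reach_def by blast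
  obtain L where lip: "lipschitz_upto (K + 1) L" using f_lipschitz by blast
  note L = lipschitz_uptoD[OF lip]
  show ?thesis
  proof (rule that[of "1 / exp (L * (T - t0))" "K + 1"])
    fix y' u r
    assume "norm (y - y') < 1 / exp (L * (T - t0))" and u: "u \<in> controls U T s" and r: "r \<in> {s..s'}"
    then have "norm (y - y') * exp (L * (T - t0)) < 1" by (simp add: pos_less_divide_eq)
    then show "norm (traj u s y' r) \<le> K + 1"
      by (intro traj_close(2)[OF assms(2) K[OF u] u assms(3) lip _ r])
  qed simp
qed

text \<open>\<open>S\<close> is the time at which the reachable sets from \<open>(s, y)\<close> become unbounded. Whether they are bounded up to
  and including \<open>S\<close> is left open, except for \<open>S = T\<close>, where the failure of a bound is required.\<close>
definition explodes :: "'a \<Rightarrow> real \<Rightarrow> real \<Rightarrow> bool" where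
  "explodes y s S \<longleftrightarrow> s < S \<and> S \<le> T \<and> (\<forall>s'\<in>{s..<S}. bounded_reach y s s') \<and>
     (\<forall>s'\<in>{S..T}. S < s' \<or> s' = T \<longrightarrow> \<not> bounded_reach y s s')"

lemma ex_explodes:
  assumes s: "s \<in> {t0..T}" and nb: "\<not> bounded_reach y s T"
  obtains S where "explodes y s S"
proof -
  obtain \<delta> where \<delta>: "\<delta> > 0" "\<And>s' y' u r. s' \<in> {t0..T} \<Longrightarrow> norm y' \<le> norm y \<Longrightarrow> u \<in> controls U T s' \<Longrightarrow>
      r \<in> {s'..min T (s' + \<delta>)} \<Longrightarrow> norm (traj u s' y' r) \<le> norm y + 1"
    using bounded_reach_short_time[of "norm y"] by blast
  have b: "bounded_reach y s (min T (s + \<delta>))"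
    unfolding bounded_reach_def using \<delta>(2)[OF s order_refl] by blast
  then have sT: "s + \<delta> < T" using nb by (auto simp: min_def split: if_splits)
  define A where "A = {s' \<in> {s..T}. bounded_reach y s s'}"
  have A: "s + \<delta> \<in> A" "bdd_above A" using b sT \<delta>(1) by (auto simp: A_def min_def intro!: bdd_aboveI[of _ T] split: if_splits)
  define S where "S = Sup A"
  have "s + \<delta> \<le> S" unfolding S_def by (rule cSup_upper[OF A])
  moreover have "S \<le> T" unfolding S_def using A by (intro cSup_least) (auto simp: A_def)
  moreover have "bounded_reach y s s'" if s': "s' \<in> {s..<S}" for s'
  proof -
    have "A \<noteq> {}" using A by auto
    then obtain a where "a \<in> A" "s' < a" using less_cSupD[of A s'] s' unfolding S_def by auto
    then show ?thesis using bounded_reach_mono[of y s a s'] by (auto simp: A_def)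
  qed
  moreover have "\<not> bounded_reach y s s'" if "s' \<in> {S..T}" "S < s' \<or> s' = T" for s'
  proof
    assume br: "bounded_reach y s s'"
    then have "s' \<noteq> T" using nb by auto
    then have "s' < T" using that by auto
    then have "s' \<in> A" using br that \<open>s + \<delta> \<le> S\<close> \<delta>(1) by (auto simp: A_def)
    then show False using cSup_upper[OF _ A(2), of s'] that \<open>s' < T\<close> by (auto simp: S_def)
  qed
  ultimately show ?thesis using \<delta>(1) by (intro that[of S]) (auto simp: explodes_def)
qed

text \<open>Choose trajectories from \<open>y\<close> that become larger and larger by time \<open>S\<close>. Their positions at time \<open>s'\<close>
  remain bounded and cluster at a point \<open>b\<close>, and reachability from \<open>b\<close> is unbounded by time \<open>S\<close> as well:
  otherwise the same would hold near \<open>b\<close>, where the chosen trajectories pass. The point \<open>b\<close> itself need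
  not be reachable from \<open>y\<close>, but it is reached from a nearby state, by \<open>traj_covers_ball\<close>.\<close>
lemma explosion_moves:
  assumes ex: "explodes y s S" and s: "t0 \<le> s" and s': "s < s'" "s' < S" and \<epsilon>: "\<epsilon> > 0"
  obtains w y' S' where "w \<in> controls U T s" "norm (y - y') < \<epsilon>" "S' \<le> S" "explodes (traj w s y' s') s' S'"
proof -
  have sT: "s \<in> {t0..T}" "s' \<in> {t0..T}" "s' \<in> {s..T}" and ST: "S \<le> T" using ex s s' by (auto simp: explodes_def)
  obtain K where K: "\<And>u r. u \<in> controls U T s \<Longrightarrow> r \<in> {s..s'} \<Longrightarrow> norm (traj u s y r) \<le> K"
    using ex s' unfolding explodes_def bounded_reach_def by (metis atLeastLessThan_iff less_imp_le)
  have "\<exists>w r. w \<in> controls U T s \<and> r \<in> {s..min T (S + 1 / (real j + 1))} \<and> norm (traj w s y r) > real j" for j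
  proof -
    have "\<not> bounded_reach y s (min T (S + 1 / (real j + 1)))"
      using ex ST unfolding explodes_def by (auto simp: min_def)
    then show ?thesis unfolding bounded_reach_def by (meson not_le)
  qed
  then obtain w r where w: "\<And>j. w j \<in> controls U T s" and
    r: "\<And>j. r j \<in> {s..min T (S + 1 / (real j + 1))}" "\<And>j. norm (traj (w j) s y (r j)) > real j"
    by metis
  let ?x = "\<lambda>j. traj (w j) s y s'"
  have "?x j \<in> cball 0 K" for j using K[OF w, of s' j] s' by auto
  with compact_cball[of "0::'a" K, unfolded compact_def, rule_format, of ?x]
  obtain b q where q: "strict_mono (q :: nat \<Rightarrow> nat)" "(?x \<circ> q) \<longlonglongrightarrow> b" by blast
  have near: "\<exists>N. \<forall>n\<ge>N. norm (b - ?x (q n)) < e" if "e > 0" for e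
    using LIMSEQ_D[OF q(2) that] by (simp add: norm_minus_commute)
  have unbounded: "\<not> bounded_reach b s' s''" if s'': "s'' \<in> {S..T}" "S < s'' \<or> s'' = T" for s''
  proof
    assume "bounded_reach b s' s''"
    then obtain e K' where e: "e > 0" and K': "\<And>y' u r. norm (b - y') < e \<Longrightarrow> u \<in> controls U T s' \<Longrightarrow>
        r \<in> {s'..s''} \<Longrightarrow> norm (traj u s' y' r) \<le> K'"
      using bounded_reach_nearby[of b s' s''] sT(2) s''(1) by (metis atLeastAtMost_iff)
    obtain N where N: "\<And>n. n \<ge> N \<Longrightarrow> norm (b - ?x (q n)) < e" using near[OF e] by blast
    obtain N1 where N1: "real N1 > max K K'" using reals_Archimedean2 by blast
    obtain N2 where N2: "s'' < T \<Longrightarrow> 1 / (real N2 + 1) < s'' - S"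
      using reals_Archimedean[of "s'' - S"] s'' by (cases "s'' < T") (auto simp: inverse_eq_divide add.commute)
    define n where "n = Max {N, N1, N2}"
    define j where "j = q n"
    have n: "N \<le> n" "N1 \<le> n" "N2 \<le> n" by (auto simp: n_def)
    have j: "N1 \<le> j" "N2 \<le> j" using seq_suble[OF q(1), of n] n by (auto simp: j_def)
    have big: "norm (traj (w j) s y (r j)) > max K K'" using r(2)[of j] N1 j(1) by linarith
    have "1 / (real j + 1) \<le> 1 / (real N2 + 1)" using j(2) by (simp add: frac_le)
    then have rj: "r j \<le> s''" using r(1)[of j] N2 s'' by (cases "s'' < T") auto
    show False
    proof (cases "r j \<le> s'")
      case True
      then show False using K[OF w, of "r j" j] r(1)[of j] big by auto
    next
      case False
      have "norm (traj (w j) s' (?x j) (r j)) \<le> K'"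
        using N[OF n(1)] controls_subset[OF w, of s' j] s' rj False by (intro K') (auto simp: j_def)
      moreover have "traj (w j) s' (?x j) (r j) = traj (w j) s y (r j)"
        by (rule traj_restart[OF sT(1) w]) (use sT False r(1)[of j] in auto)
      ultimately show False using big by simp
    qed
  qed
  then have "\<not> bounded_reach b s' T" using ST by auto
  then obtain S' where S': "explodes b s' S'" using ex_explodes[OF sT(2)] by blast
  have "S' \<le> S"
  proof (rule ccontr)
    assume "\<not> S' \<le> S"
    then have "bounded_reach b s' ((S + S') / 2)" using S' s' by (auto simp: explodes_def)
    moreover have "(S + S') / 2 \<in> {S..T}" "S < (S + S') / 2"
      using \<open>\<not> S' \<le> S\<close> S' by (auto simp: explodes_def)
    ultimately show False using unbounded by blast
  qed
  obtain L where lip: "lipschitz_upto (K + 1) L" using f_lipschitz by blast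
  note L = lipschitz_uptoD[OF lip]
  let ?E = "exp (L * (T - t0))"
  define \<rho> where "\<rho> = min \<epsilon> (1 / (2 * ?E))"
  have \<rho>: "\<rho> > 0" "\<rho> \<le> \<epsilon>" "\<rho> * ?E < 1"
  proof -
    have "\<rho> * ?E \<le> 1 / (2 * ?E) * ?E" unfolding \<rho>_def by (intro mult_right_mono) auto
    then show "\<rho> * ?E < 1" by simp
  qed (use \<epsilon> in \<open>auto simp: \<rho>_def\<close>)
  have "\<rho> / ?E > 0" using \<rho>(1) by simp
  from near[OF this] obtain n where n: "norm (b - ?x (q n)) < \<rho> / ?E" by blast
  have "ball (?x (q n)) (\<rho> / ?E) \<subseteq> (\<lambda>y'. traj (w (q n)) s y' s') ` ball y \<rho>"
    by (rule traj_covers_ball[OF sT(1) K[OF w] w sT(3) lip \<rho>(1,3)])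
  moreover have "b \<in> ball (?x (q n)) (\<rho> / ?E)" using n by (simp add: dist_norm norm_minus_commute)
  ultimately obtain y' where y': "y' \<in> ball y \<rho>" "b = traj (w (q n)) s y' s'" by blast
  have "norm (y - y') < \<epsilon>" using y'(1) \<rho>(2) by (simp add: dist_norm)
  then show ?thesis using that[OF w[of "q n"]] \<open>S' \<le> S\<close> S' y'(2) by blast
qed

text \<open>One step of the construction of an exploding trajectory, as seen from the initial time \<open>\<tau>\<close>: the move of
  \<open>explosion_moves\<close> starts at a slightly perturbed state, and openness of the flow map from \<open>\<tau>\<close> to \<open>s\<close>
  translates this into a small perturbation of \<open>x\<close>. The remaining time before the explosion is at least
  halved, and the control changes from time \<open>s\<close> on only.\<close>
lemma explosion_step:
  assumes \<tau>: "\<tau> \<in> {t0..T}" and u: "u \<in> controls U T \<tau>" and s: "\<tau> \<le> s"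
    and ex: "explodes (traj u \<tau> x s) s S" and \<epsilon>: "\<epsilon> > 0"
  obtains u' x' S' where "u' \<in> controls U T \<tau>" "\<And>t. t \<in> {\<tau>..<s} \<Longrightarrow> u' t = u t" "norm (x - x') < \<epsilon>" "S' \<le> S"
    "explodes (traj u' \<tau> x' ((s + S) / 2)) ((s + S) / 2) S'"
proof -
  define s' where "s' = (s + S) / 2"
  have sS: "s < S" "S \<le> T" using ex by (auto simp: explodes_def)
  then have s': "s < s'" "s' < S" by (auto simp: s'_def)
  have sT: "s \<in> {\<tau>..T}" "s \<in> {t0..T}" "t0 \<le> s" using s sS \<tau> by auto
  have "open ((\<lambda>y. traj u \<tau> y s) ` ball x \<epsilon>)" by (rule traj_open_image[OF \<tau> u sT(1)]) simp
  moreover have "traj u \<tau> x s \<in> (\<lambda>y. traj u \<tau> y s) ` ball x \<epsilon>" using \<epsilon> by auto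
  ultimately obtain e where e: "e > 0" "ball (traj u \<tau> x s) e \<subseteq> (\<lambda>y. traj u \<tau> y s) ` ball x \<epsilon>"
    by (meson open_contains_ball)
  obtain w y' S' where w: "w \<in> controls U T s" and y': "norm (traj u \<tau> x s - y') < e" and S': "S' \<le> S"
    and ex': "explodes (traj w s y' s') s' S'"
    using explosion_moves[OF ex sT(3) s' e(1)] by blast
  have "y' \<in> ball (traj u \<tau> x s) e" using y' by (simp add: dist_norm)
  then obtain x' where x': "x' \<in> ball x \<epsilon>" "y' = traj u \<tau> x' s" using e(2) by blast
  define u' where "u' t = (if t < s then u t else w t)" for t
  have u'c: "u' \<in> controls U T \<tau>"
  proof -
    have "u' \<in> borel_measurable (lebesgue_on {\<tau>..T})"
    proof -
      have "u \<in> borel_measurable (lebesgue_on ({\<tau>..T} \<inter> {t. t < s}))"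
        by (rule measurable_restrict_mono[OF controls_measurable[OF u]]) auto
      moreover have "w \<in> borel_measurable (lebesgue_on ({\<tau>..T} \<inter> {t. \<not> t < s}))"
        by (rule measurable_restrict_mono[OF controls_measurable[OF w]]) auto
      moreover have "{t \<in> space (lebesgue_on {\<tau>..T}). t < s} \<in> sets (lebesgue_on {\<tau>..T})"
      proof -
        have "{t \<in> space (lebesgue_on {\<tau>..T}). t < s} = {\<tau>..T} \<inter> {..<s}" by auto
        then show ?thesis by (simp add: sets_restrict_space_iff)
      qed
      ultimately show ?thesis unfolding u'_def[abs_def]
        by (subst measurable_If_restrict_space_iff) (simp_all add: restrict_restrict_space)
    qed
    moreover have "u' t \<in> U" if "t \<in> {\<tau>..T}" for t
      using controls_in[OF u, of t] controls_in[OF w, of t] that by (auto simp: u'_def)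
    ultimately show ?thesis by (rule controlsI)
  qed
  have "traj u' \<tau> x' s = y'"
    unfolding x'(2) by (rule traj_cong_before[OF \<tau> u u'c]) (use sT in \<open>auto simp: u'_def\<close>)
  then have "traj u' \<tau> x' s' = traj u' s y' s'"
    using traj_restart[OF \<tau> u'c, of s s' x'] sT s' sS by auto
  also have "\<dots> = traj w s y' s'"
    by (rule traj_cong_after[OF sT(2) w]) (use controls_subset[OF u'c] sT s' sS in \<open>auto simp: u'_def\<close>)
  finally have "explodes (traj u' \<tau> x' s') s' S'" using ex' by simp
  moreover have "norm (x - x') < \<epsilon>" using x'(1) by (simp add: dist_norm)
  ultimately show ?thesis using that[OF u'c] S' unfolding s'_def by (simp add: u'_def)
qed

text \<open>Otherwise iterate \<open>explosion_step\<close> with perturbations \<open>(1/2)\<^sup>n\<close>. The initial states \<open>x n\<close> converge to some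
  \<open>z\<close>, and the controls \<open>u n\<close>, which agree on longer and longer intervals, fit together to a control \<open>v\<close>.
  The trajectory of \<open>z\<close> under \<open>v\<close> exists up to time \<open>T\<close> and is bounded. For large \<open>n\<close> the state reached from
  \<open>x n\<close> at time \<open>s n\<close> is thus bounded as well, so that from there all trajectories remain bounded for a
  time \<open>\<delta>\<close> that does not depend on \<open>n\<close>; but they explode within time \<open>S n - s n\<close>, which tends to zero.\<close>
theorem reach_bounded:
  assumes \<tau>: "\<tau> \<in> {t0..T}"
  shows "bounded_reach x0 \<tau> T"
proof (rule ccontr)
  assume "\<not> bounded_reach x0 \<tau> T"
  from ex_explodes[OF \<tau> this] obtain S0 where S0: "explodes x0 \<tau> S0" .
  obtain u0 where u0: "u0 \<in> U" using U(2) by blast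
  have u0c: "(\<lambda>_. u0) \<in> controls U T \<tau>" by (rule controlsI) (use u0 in auto)
  define good where "good = (\<lambda>(s, S, u, x). \<tau> \<le> s \<and> u \<in> controls U T \<tau> \<and> explodes (traj u \<tau> x s) s S)"
  define next_to :: "nat \<Rightarrow> real \<times> real \<times> (real \<Rightarrow> real^'m) \<times> 'a \<Rightarrow> real \<times> real \<times> (real \<Rightarrow> real^'m) \<times> 'a \<Rightarrow> bool"
    where "next_to = (\<lambda>(n :: nat) (s, S, u, x) (s', S', u', x').
      s' = (s + S) / 2 \<and> S' \<le> S \<and> (\<forall>t\<in>{\<tau>..<s}. u' t = u t) \<and> norm (x - x') < (1 / 2) ^ n)"
  have "\<exists>\<sigma>. \<forall>n. good (\<sigma> n) \<and> next_to n (\<sigma> n) (\<sigma> (Suc n))"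
  proof (rule dependent_nat_choice)
    have "good (\<tau>, S0, \<lambda>_. u0, x0)"
      unfolding good_def using S0 u0c traj(2)[OF \<tau> u0c] by simp
    then show "\<exists>z. good z" by blast
    fix z n assume z: "good z"
    obtain s S u x where z_eq: "z = (s, S, u, x)" by (cases z)
    have g: "\<tau> \<le> s" "u \<in> controls U T \<tau>" "explodes (traj u \<tau> x s) s S"
      using z by (auto simp: good_def z_eq)
    obtain u' x' S' where "u' \<in> controls U T \<tau>" "\<And>t. t \<in> {\<tau>..<s} \<Longrightarrow> u' t = u t" "norm (x - x') < (1 / 2) ^ n"
      "S' \<le> S" "explodes (traj u' \<tau> x' ((s + S) / 2)) ((s + S) / 2) S'"
      using explosion_step[OF \<tau> g(2,1,3), of "(1 / 2) ^ n"] by auto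
    moreover have "\<tau> \<le> (s + S) / 2" using g by (auto simp: explodes_def)
    ultimately have "good ((s + S) / 2, S', u', x') \<and> next_to n z ((s + S) / 2, S', u', x')"
      by (auto simp: good_def next_to_def z_eq)
    then show "\<exists>z'. good z' \<and> next_to n z z'" by blast
  qed
  then obtain \<sigma> where \<sigma>: "\<And>n. good (\<sigma> n)" "\<And>n. next_to n (\<sigma> n) (\<sigma> (Suc n))" by blast
  define s where "s n = fst (\<sigma> n)" for n
  define S where "S n = fst (snd (\<sigma> n))" for n
  define u where "u n = fst (snd (snd (\<sigma> n)))" for n
  define x where "x n = snd (snd (snd (\<sigma> n)))" for n
  have \<sigma>_eq: "\<sigma> n = (s n, S n, u n, x n)" for n by (simp add: s_def S_def u_def x_def)
  have g: "\<tau> \<le> s n" "u n \<in> controls U T \<tau>" "explodes (traj (u n) \<tau> (x n) (s n)) (s n) (S n)" for n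
    using \<sigma>(1)[of n] by (auto simp: good_def \<sigma>_eq)
  have nx: "s (Suc n) = (s n + S n) / 2" "S (Suc n) \<le> S n" "\<And>t. t \<in> {\<tau>..<s n} \<Longrightarrow> u (Suc n) t = u n t"
    "norm (x n - x (Suc n)) < (1 / 2) ^ n" for n
    using \<sigma>(2)[of n] by (auto simp: next_to_def \<sigma>_eq)
  have sS: "s n < S n" "S n \<le> T" for n using g(3)[of n] by (auto simp: explodes_def)
  have s_mono: "s m \<le> s n" if "m \<le> n" for m n
  proof (rule lift_Suc_mono_le[OF _ that])
    show "s n \<le> s (Suc n)" for n using nx(1)[of n] sS(1)[of n] by simp
  qed
  have S_mono: "S n \<le> S m" if "m \<le> n" for m n
    using that by (rule lift_Suc_antimono_le[rotated]) (use nx(2) in auto)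
  have u_coh: "u n t = u m t" if "m \<le> n" "t \<in> {\<tau>..<s m}" for m n t
    using that
  proof (induction n rule: dec_induct)
    case (step n)
    then show ?case using nx(3)[of t n] s_mono[of m n] by auto
  qed simp
  have gap: "S n - s n \<le> (S 0 - s 0) * (1 / 2) ^ n" for n
  proof (induction n)
    case (Suc n)
    have "S (Suc n) - s (Suc n) \<le> (S n - s n) / 2" using nx(1,2)[of n] by (simp add: field_simps)
    then show ?case using Suc by simp
  qed simp
  obtain \<sigma>' where \<sigma>': "\<And>n. s n \<le> \<sigma>'" "\<And>t. t < \<sigma>' \<Longrightarrow> \<exists>n. t < s n"
  proof -
    have bdd: "bdd_above (range s)"
    proof (rule bdd_aboveI[of _ T], clarify)
      show "s n \<le> T" for n using sS[of n] by simp
    qed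
    show ?thesis
    proof (rule that[of "Sup (range s)"])
      show "s n \<le> Sup (range s)" for n by (rule cSup_upper[OF _ bdd]) simp
      show "\<exists>n. t < s n" if "t < Sup (range s)" for t
        using less_cSup_iff[of "range s" t] bdd that by auto
    qed
  qed
  \<comment> \<open>The second disjunct only makes the least index exist from time \<open>\<sigma>'\<close> on, where the control may be arbitrary.\<close>
  define N where "N t = (LEAST n. t < s n \<or> t \<ge> \<sigma>')" for t
  define v where "v t = u (N t) t" for t
  have Nm: "N \<in> measurable (lebesgue_on {\<tau>..T}) (count_space UNIV)"
    unfolding N_def[abs_def]
  proof (rule measurable_Least)
    fix n
    have "{t \<in> space (lebesgue_on {\<tau>..T}). t < s n \<or> t \<ge> \<sigma>'} = {\<tau>..T} \<inter> ({..<s n} \<union> {\<sigma>'..})" by auto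
    then show "Measurable.pred (lebesgue_on {\<tau>..T}) (\<lambda>t. t < s n \<or> t \<ge> \<sigma>')"
      unfolding pred_def by (simp add: sets_restrict_space_iff)
  qed
  have vc: "v \<in> controls U T \<tau>"
  proof (rule controlsI)
    show "v \<in> borel_measurable (lebesgue_on {\<tau>..T})"
      unfolding v_def[abs_def]
      by (rule measurable_compose_countable[OF controls_measurable[OF g(2)] Nm])
    show "v t \<in> U" if "t \<in> {\<tau>..T}" for t
      unfolding v_def by (rule controls_in[OF g(2) that])
  qed
  have v_eq: "v t = u n t" if "t \<in> {\<tau>..<s n}" for t n
  proof -
    have P: "t < s n \<or> t \<ge> \<sigma>'" using that by auto
    have le: "N t \<le> n" unfolding N_def by (rule Least_le[where P = "\<lambda>n. t < s n \<or> t \<ge> \<sigma>'", OF P])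
    have "t < s (N t) \<or> t \<ge> \<sigma>'" unfolding N_def by (rule LeastI[where P = "\<lambda>n. t < s n \<or> t \<ge> \<sigma>'", OF P])
    then have "t < s (N t)" using that \<sigma>'(1)[of n] by auto
    then show ?thesis using u_coh[OF le] that by (simp add: v_def)
  qed
  have xs: "summable (\<lambda>n. x (Suc n) - x n)"
  proof (rule summable_comparison_test')
    show "summable (\<lambda>n. (1 / 2 :: real) ^ n)" by (simp add: summable_geometric)
    show "norm (x (Suc n) - x n) \<le> (1 / 2) ^ n" if "n \<ge> 0" for n
      using nx(4)[of n] by (simp add: norm_minus_commute)
  qed
  then obtain l where "(\<lambda>n. \<Sum>k<n. x (Suc k) - x k) \<longlonglongrightarrow> l" using summable_LIMSEQ by blast
  then have "(\<lambda>n. x n - x 0) \<longlonglongrightarrow> l" by (simp add: sum_lessThan_telescope[of x])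
  from tendsto_add[OF this tendsto_const[of "x 0"]] have x_lim: "x \<longlonglongrightarrow> l + x 0" by simp
  define z where "z = l + x 0"
  obtain K where K: "K \<ge> 0" "\<And>r. r \<in> {\<tau>..T} \<Longrightarrow> norm (traj v \<tau> z r) \<le> K"
    using continuous_on_Icc_bounded[OF integral_solutionD(1)[OF traj(1)[OF \<tau> vc]]] by blast
  obtain L where lip: "lipschitz_upto (K + 1) L" using f_lipschitz by blast
  note L = lipschitz_uptoD[OF lip]
  obtain \<delta> where \<delta>: "\<delta> > 0" "\<And>s y u r. s \<in> {t0..T} \<Longrightarrow> norm y \<le> K + 1 \<Longrightarrow> u \<in> controls U T s \<Longrightarrow>
      r \<in> {s..min T (s + \<delta>)} \<Longrightarrow> norm (traj u s y r) \<le> K + 1 + 1"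
    using bounded_reach_short_time[of "K + 1"] by blast
  have "(\<lambda>n. norm (z - x n) * exp (L * (T - t0))) \<longlonglongrightarrow> 0"
    using x_lim by (auto simp: z_def intro!: tendsto_eq_intros)
  then have e1: "\<forall>\<^sub>F n in sequentially. norm (z - x n) * exp (L * (T - t0)) < 1"
    by (rule order_tendstoD) simp
  have "(\<lambda>n. (S 0 - s 0) * (1 / 2) ^ n) \<longlonglongrightarrow> 0"
    by (intro tendsto_mult_right_zero LIMSEQ_realpow_zero) auto
  then have e2: "\<forall>\<^sub>F n in sequentially. (S 0 - s 0) * (1 / 2) ^ n < \<delta>"
    by (rule order_tendstoD) (rule \<delta>(1))
  obtain n where n: "norm (z - x n) * exp (L * (T - t0)) < 1" "(S 0 - s 0) * (1 / 2) ^ n < \<delta>"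
    using eventually_happens[OF eventually_conj[OF e1 e2]] by auto
  define b where "b = traj (u n) \<tau> (x n) (s n)"
  have sn: "s n \<in> {\<tau>..T}" "s n \<in> {t0..T}" using g(1)[of n] sS[of n] \<tau> by auto
  have "b = traj v \<tau> (x n) (s n)"
    unfolding b_def
    by (rule traj_cong_before[OF \<tau> g(2) vc, where s' = "s n", symmetric]) (use sn v_eq in auto)
  then have "norm b \<le> K + 1"
    using traj_close(2)[OF \<tau> K(2) vc order_refl lip n(1) sn(1)] by simp
  then have br: "bounded_reach b (s n) (min T (s n + \<delta>))"
    unfolding bounded_reach_def using \<delta>(2)[OF sn(2)] by blast
  have "S n < s n + \<delta>" using gap[of n] n(2) by linarith
  then have "min T (s n + \<delta>) \<in> {S n..T}" "S n < min T (s n + \<delta>) \<or> min T (s n + \<delta>) = T"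
    using sS[of n] by (auto simp: min_def)
  then show False using br g(3)[of n] unfolding explodes_def b_def by blast
qed

corollary solutions_bounded:
  assumes "\<tau> \<in> {t0..T}"
  obtains K where "K \<ge> 0" "\<And>u x r. u \<in> controls U T \<tau> \<Longrightarrow> integral_solution f u \<tau> T x \<Longrightarrow> x \<tau> = x0 \<Longrightarrow>
    r \<in> {\<tau>..T} \<Longrightarrow> norm (x r) \<le> K"
proof -
  obtain K where K: "\<And>u r. u \<in> controls U T \<tau> \<Longrightarrow> r \<in> {\<tau>..T} \<Longrightarrow> norm (traj u \<tau> x0 r) \<le> K"
    using reach_bounded[OF assms, of x0] unfolding bounded_reach_def by blast
  show ?thesis
  proof (rule that[of "max K 0"])
    fix u x r assume A: "u \<in> controls U T \<tau>" "integral_solution f u \<tau> T x" "x \<tau> = x0" "r \<in> {\<tau>..T}"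
    then have "traj u \<tau> x0 r = x r" by (intro traj_eq[OF assms A(1,2)]) auto
    then show "norm (x r) \<le> max K 0" using K[OF A(1,4)] by simp
  qed simp
qed

end

section \<open>The adjoint equation\<close>

text \<open>The component of \<open>f\<close> along \<open>b\<close> is the difference of the control Hamiltonians for \<open>p = b\<close> and \<open>p = 0\<close>, so
  bounds on \<open>hx\<close> bound its gradient.\<close>
lemma locally_lipschitz_of_hamiltonian:
  fixes f :: "'a::euclidean_space \<Rightarrow> 'b::metric_space \<Rightarrow> real \<Rightarrow> 'a"
  assumes U: "compact U"
    and hx_cont: "continuous_on (UNIV \<times> U \<times> {t0..T}) (\<lambda>((x, p), u, t). hx x p u t)"
    and hx_deriv: "\<And>x p u t. u \<in> U \<Longrightarrow> t \<in> {t0..T} \<Longrightarrow>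
          ((\<lambda>y. p \<bullet> f y u t - F y u t) has_derivative (\<lambda>h. hx x p u t \<bullet> h)) (at x)"
  shows "\<exists>L\<ge>0. \<forall>x y u t. norm x \<le> R \<longrightarrow> norm y \<le> R \<longrightarrow> u \<in> U \<longrightarrow> t \<in> {t0..T} \<longrightarrow>
          norm (f x u t - f y u t) \<le> L * norm (x - y)"
proof -
  have "compact ((cball (0::'a) R \<times> cball (0::'a) 1) \<times> U \<times> {t0..T})"
    by (intro compact_Times U) auto
  from continuous_on_compact_bounded[OF this continuous_on_subset[OF hx_cont]]
  obtain M where M: "M \<ge> 0" "\<And>z. z \<in> (cball 0 R \<times> cball 0 1) \<times> U \<times> {t0..T} \<Longrightarrow>
      norm ((\<lambda>((x, p), u, t). hx x p u t) z) \<le> M" by auto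
  have M': "norm (hx x p u t) \<le> M" if "norm x \<le> R" "norm p \<le> 1" "u \<in> U" "t \<in> {t0..T}" for x p u t
    using M(2)[of "((x, p), u, t)"] that by auto
  have "norm (f x u t - f y u t) \<le> (real DIM('a) * (2 * M)) * norm (x - y)"
    if xy: "norm x \<le> R" "norm y \<le> R" and ut: "u \<in> U" "t \<in> {t0..T}" for x y u t
  proof -
    have "\<bar>(f x u t - f y u t) \<bullet> b\<bar> \<le> 2 * M * norm (x - y)" if b: "b \<in> Basis" for b
    proof -
      have "\<bar>b \<bullet> f x u t - b \<bullet> f y u t\<bar> \<le> 2 * M * norm (x - y)"
      proof (rule gradient_bound[of "cball 0 R" _ "\<lambda>z. hx z b u t - hx z 0 u t"])
        fix z :: 'a assume z: "z \<in> cball 0 R"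
        have "((\<lambda>y. (b \<bullet> f y u t - F y u t) - (0 \<bullet> f y u t - F y u t)) has_derivative
            (\<lambda>h. hx z b u t \<bullet> h - hx z 0 u t \<bullet> h)) (at z)"
          by (intro has_derivative_diff hx_deriv ut)
        then show "((\<lambda>y. b \<bullet> f y u t) has_derivative (\<lambda>h. (hx z b u t - hx z 0 u t) \<bullet> h)) (at z)"
          by (simp add: inner_diff_left)
        have "norm (hx z b u t - hx z 0 u t) \<le> norm (hx z b u t) + norm (hx z 0 u t)"
          by (rule norm_triangle_ineq4)
        then show "norm (hx z b u t - hx z 0 u t) \<le> 2 * M"
          using M'[of z b u t] M'[of z 0 u t] z ut b by simp
      qed (use xy in auto)
      then show ?thesis by (simp add: inner_commute[of _ b] inner_diff_right)
    qed
    then have "(\<Sum>b\<in>Basis. \<bar>(f x u t - f y u t) \<bullet> b\<bar>) \<le> of_nat (card (Basis :: 'a set)) * (2 * M * norm (x - y))"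
      by (intro sum_bounded_above) auto
    then show ?thesis using norm_le_l1[of "f x u t - f y u t"] by simp
  qed
  then show ?thesis using M(1) by (intro exI[of _ "real DIM('a) * (2 * M)"]) auto
qed

text \<open>Here \<open>hx x p u t\<close> is the gradient in \<open>x\<close> of the control Hamiltonian. The assumption \<open>max_unique\<close> is what
  differentiability of the Hamiltonian contributes: all maximizers give the same velocity and the same
  adjoint velocity.\<close>
locale control_cost = control_flow U t0 T f
  for U :: "(real^'m) set" and t0 T :: real and f :: "'a::euclidean_space \<Rightarrow> real^'m \<Rightarrow> real \<Rightarrow> 'a" +
  fixes F :: "'a \<Rightarrow> real^'m \<Rightarrow> real \<Rightarrow> real" and hx :: "'a \<Rightarrow> 'a \<Rightarrow> real^'m \<Rightarrow> real \<Rightarrow> 'a"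
  assumes F_cont: "continuous_on (UNIV \<times> U \<times> {t0..T}) (\<lambda>(x, u, t). F x u t)"
    and hx_cont: "continuous_on (UNIV \<times> U \<times> {t0..T}) (\<lambda>((x, p), u, t). hx x p u t)"
    and hx_deriv: "\<And>x p u t. u \<in> U \<Longrightarrow> t \<in> {t0..T} \<Longrightarrow>
          ((\<lambda>y. p \<bullet> f y u t - F y u t) has_derivative (\<lambda>h. hx x p u t \<bullet> h)) (at x)"
    and max_unique: "\<And>x p u v t. t \<in> {t0..T} \<Longrightarrow>
          u \<in> argmax_on U (\<lambda>u. p \<bullet> f x u t - F x u t) \<Longrightarrow> v \<in> argmax_on U (\<lambda>u. p \<bullet> f x u t - F x u t) \<Longrightarrow>
          f x u t = f x v t \<and> hx x p u t = hx x p v t"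
begin

abbreviation ham :: "'a \<Rightarrow> 'a \<Rightarrow> real^'m \<Rightarrow> real \<Rightarrow> real" where
  "ham x p u t \<equiv> p \<bullet> f x u t - F x u t"

text \<open>The equation \<open>p' = - hx x p u t\<close> along a fixed state trajectory, read as a control system for \<open>p\<close> whose control is
  \<open>t \<mapsto> (x t, u t)\<close>.\<close>
abbreviation adjoint_solution where
  "adjoint_solution x u a b p \<equiv>
     integral_solution (\<lambda>p w t. - hx (fst w) p (snd w) t) (\<lambda>t. (x t, u t)) a b p"

lemma f_cont_pair: "continuous_on (UNIV \<times> U \<times> {t0..T}) (\<lambda>((x, p), u, t). f x u t)"
proof -
  have "continuous_on (UNIV \<times> U \<times> {t0..T}) (\<lambda>z. (\<lambda>(x, u, t). f x u t) (fst (fst z), fst (snd z), snd (snd z)))"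
    by (rule continuous_on_compose2[OF f_cont]) (auto intro!: continuous_intros)
  then show ?thesis by (simp add: split_def)
qed

lemma F_cont_pair: "continuous_on (UNIV \<times> U \<times> {t0..T}) (\<lambda>((x, p), u, t). F x u t)"
proof -
  have "continuous_on (UNIV \<times> U \<times> {t0..T}) (\<lambda>z. (\<lambda>(x, u, t). F x u t) (fst (fst z), fst (snd z), snd (snd z)))"
    by (rule continuous_on_compose2[OF F_cont]) (auto intro!: continuous_intros)
  then show ?thesis by (simp add: split_def)
qed

lemma ham_cont_pair: "continuous_on (UNIV \<times> U \<times> {t0..T}) (\<lambda>((x, p), u, t). ham x p u t)"
proof -
  have "continuous_on (UNIV \<times> U \<times> {t0..T}) (\<lambda>z. snd (fst z) \<bullet> (\<lambda>((x, p), u, t). f x u t) z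
      - (\<lambda>((x, p), u, t). F x u t) z)"
    by (intro continuous_intros f_cont_pair F_cont_pair)
  then show ?thesis by (simp add: split_def)
qed

definition bounds_upto :: "real \<Rightarrow> real \<Rightarrow> bool" where
  "bounds_upto R M \<longleftrightarrow> 0 \<le> M \<and> (\<forall>x p u t. norm x \<le> R \<longrightarrow> norm p \<le> R \<longrightarrow> u \<in> U \<longrightarrow> t \<in> {t0..T} \<longrightarrow>
      norm (f x u t) \<le> M \<and> \<bar>F x u t\<bar> \<le> M \<and> norm (hx x p u t) \<le> M)"

lemma bounds_uptoD:
  assumes "bounds_upto R M"
  shows "0 \<le> M" "\<And>x p u t. norm x \<le> R \<Longrightarrow> norm p \<le> R \<Longrightarrow> u \<in> U \<Longrightarrow> t \<in> {t0..T} \<Longrightarrow>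
      norm (f x u t) \<le> M \<and> \<bar>F x u t\<bar> \<le> M \<and> norm (hx x p u t) \<le> M"
  using assms unfolding bounds_upto_def by blast+

lemma uniform_bounds: "\<exists>M. bounds_upto R M"
proof -
  let ?S = "(cball (0::'a) R \<times> cball (0::'a) R) \<times> U \<times> {t0..T}"
  have S: "compact ?S" by (intro compact_Times U) auto
  have sub: "?S \<subseteq> UNIV \<times> U \<times> {t0..T}" by auto
  have "continuous_on ?S (\<lambda>z. ((\<lambda>((x, p), u, t). f x u t) z, (\<lambda>((x, p), u, t). F x u t) z, (\<lambda>((x, p), u, t). hx x p u t) z))"
    by (intro continuous_on_Pair continuous_on_subset[OF f_cont_pair sub] continuous_on_subset[OF F_cont_pair sub]
        continuous_on_subset[OF hx_cont sub])
  from continuous_on_compact_bounded[OF S this]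
  obtain M where M: "M \<ge> 0" "\<And>z. z \<in> ?S \<Longrightarrow> norm ((\<lambda>((x, p), u, t). f x u t) z,
      (\<lambda>((x, p), u, t). F x u t) z, (\<lambda>((x, p), u, t). hx x p u t) z) \<le> M" by blast
  have "bounds_upto R M" unfolding bounds_upto_def
  proof (intro conjI[OF M(1)] allI impI)
    fix x p :: 'a and u t assume A: "norm x \<le> R" "norm p \<le> R" "u \<in> U" "t \<in> {t0..T}"
    have "norm (f x u t, F x u t, hx x p u t) \<le> M" using M(2)[of "((x, p), u, t)"] A by simp
    then show "norm (f x u t) \<le> M \<and> \<bar>F x u t\<bar> \<le> M \<and> norm (hx x p u t) \<le> M"
      using norm_fst_le[of "f x u t" "(F x u t, hx x p u t)"] norm_snd_le[of "(F x u t, hx x p u t)" "f x u t"]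
        norm_fst_le[of "F x u t" "hx x p u t"] norm_snd_le[of "hx x p u t" "F x u t"] by auto
  qed
  then show ?thesis ..
qed

lemma ham_lipschitz:
  assumes M: "\<And>x p u t. norm x \<le> R \<Longrightarrow> norm p \<le> R \<Longrightarrow> u \<in> U \<Longrightarrow> t \<in> {t0..T} \<Longrightarrow> norm (hx x p u t) \<le> M"
    and xyp: "norm x \<le> R" "norm y \<le> R" "norm p \<le> R" and ut: "u \<in> U" "t \<in> {t0..T}"
  shows "\<bar>ham x p u t - ham y p u t\<bar> \<le> M * norm (x - y)"
  by (rule gradient_bound[of "cball 0 R" _ "\<lambda>z. hx z p u t"]) (use hx_deriv ut M xyp in auto)

lemma ham_taylor:
  assumes e: "e > 0"
  obtains d where "d > 0"
    "\<And>x y p u t. norm x \<le> R \<Longrightarrow> norm y \<le> R \<Longrightarrow> norm p \<le> R \<Longrightarrow> u \<in> U \<Longrightarrow> t \<in> {t0..T} \<Longrightarrow> norm (y - x) < d \<Longrightarrow>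
       \<bar>ham y p u t - ham x p u t - hx x p u t \<bullet> (y - x)\<bar> \<le> e * norm (y - x)"
proof -
  let ?S = "(cball (0::'a) R \<times> cball (0::'a) R) \<times> U \<times> {t0..T}"
  have S: "compact ?S" by (intro compact_Times U) auto
  have "uniformly_continuous_on ?S (\<lambda>((x, p), u, t). hx x p u t)"
    by (rule compact_uniformly_continuous[OF continuous_on_subset[OF hx_cont] S]) auto
  then obtain d where d: "d > 0" "\<And>z z'. z \<in> ?S \<Longrightarrow> z' \<in> ?S \<Longrightarrow> dist z' z < d \<Longrightarrow>
      dist ((\<lambda>((x, p), u, t). hx x p u t) z') ((\<lambda>((x, p), u, t). hx x p u t) z) < e"
    using e unfolding uniformly_continuous_on_def by meson
  show ?thesis
  proof (rule that[OF d(1)])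
    fix x y p :: 'a and u t
    assume A: "norm x \<le> R" "norm y \<le> R" "norm p \<le> R" "u \<in> U" "t \<in> {t0..T}" "norm (y - x) < d"
    let ?g = "\<lambda>z. ham z p u t - hx x p u t \<bullet> z"
    have "\<bar>?g y - ?g x\<bar> \<le> e * norm (y - x)"
    proof (rule gradient_bound[of "cball 0 R \<inter> ball x d" _ "\<lambda>z. hx z p u t - hx x p u t"])
      show "convex (cball 0 R \<inter> ball x d)" by (intro convex_Int) auto
      fix z assume z: "z \<in> cball 0 R \<inter> ball x d"
      have "(?g has_derivative (\<lambda>h. hx z p u t \<bullet> h - hx x p u t \<bullet> h)) (at z)"
        by (intro has_derivative_diff hx_deriv A bounded_linear_imp_has_derivative bounded_linear_inner_right)
      then show "(?g has_derivative (\<lambda>h. (hx z p u t - hx x p u t) \<bullet> h)) (at z)"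
        by (simp add: inner_diff_left)
      have "dist ((z, p), u, t) ((x, p), u, t) < d" using z by (simp add: dist_Pair_Pair dist_commute)
      then show "norm (hx z p u t - hx x p u t) \<le> e"
        using d(2)[of "((x, p), u, t)" "((z, p), u, t)"] z A by (simp add: dist_norm)
    qed (use A d(1) in \<open>auto simp: dist_norm norm_minus_commute\<close>)
    then show "\<bar>ham y p u t - ham x p u t - hx x p u t \<bullet> (y - x)\<bar> \<le> e * norm (y - x)"
      by (simp add: inner_diff_right algebra_simps)
  qed
qed

text \<open>The control Hamiltonian is affine in \<open>p\<close>, hence so is \<open>hx\<close>, and its linear part is determined by the
  values at the basis vectors and at zero.\<close>
lemma hx_lipschitz_costate:
  obtains L where "L \<ge> 0"
    "\<And>x p q u t. norm x \<le> R \<Longrightarrow> u \<in> U \<Longrightarrow> t \<in> {t0..T} \<Longrightarrow> norm (hx x p u t - hx x q u t) \<le> L * norm (p - q)"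
proof -
  obtain M where "bounds_upto (max R 1) M" using uniform_bounds by blast
  note M = bounds_uptoD[OF this]
  show ?thesis
  proof (rule that[of "real DIM('a) * (2 * M)"])
    fix x p q :: 'a and u t assume A: "norm x \<le> R" "u \<in> U" "t \<in> {t0..T}"
    let ?v = "\<Sum>b\<in>Basis. ((p - q) \<bullet> b) *\<^sub>R (hx x b u t - hx x 0 u t)"
    have d1: "((\<lambda>y. ham y p u t - ham y q u t) has_derivative (\<lambda>h. hx x p u t \<bullet> h - hx x q u t \<bullet> h)) (at x)"
      by (intro has_derivative_diff hx_deriv A)
    have "((\<lambda>y. \<Sum>b\<in>Basis. ((p - q) \<bullet> b) * (ham y b u t - ham y 0 u t)) has_derivative
        (\<lambda>h. \<Sum>b\<in>Basis. ((p - q) \<bullet> b) * (hx x b u t \<bullet> h - hx x 0 u t \<bullet> h))) (at x)"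
      by (intro has_derivative_sum has_derivative_mult_right has_derivative_diff hx_deriv A)
    moreover have "(\<lambda>y. \<Sum>b\<in>Basis. ((p - q) \<bullet> b) * (ham y b u t - ham y 0 u t)) = (\<lambda>y. ham y p u t - ham y q u t)"
      using euclidean_inner[of "p - q" "f y u t" for y] by (simp add: fun_eq_iff inner_diff_left inner_commute)
    ultimately have d2: "((\<lambda>y. ham y p u t - ham y q u t) has_derivative
        (\<lambda>h. \<Sum>b\<in>Basis. ((p - q) \<bullet> b) * (hx x b u t \<bullet> h - hx x 0 u t \<bullet> h))) (at x)"
      by simp
    note has_derivative_unique[OF d1 d2]
    then have "(hx x p u t - hx x q u t) \<bullet> h = ?v \<bullet> h" for h
      by (simp add: fun_eq_iff inner_diff_left inner_sum_left)
    then have "hx x p u t - hx x q u t = ?v" using vector_eq_rdot by blast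
    also have "norm ?v \<le> of_nat (card (Basis :: 'a set)) * (norm (p - q) * (2 * M))"
    proof (rule sum_norm_bound)
      fix b :: 'a assume b: "b \<in> Basis"
      have "norm (hx x b u t - hx x 0 u t) \<le> norm (hx x b u t) + norm (hx x 0 u t)"
        by (rule norm_triangle_ineq4)
      also have "\<dots> \<le> M + M"
        using A b by (intro add_mono) (auto intro!: M(2)[THEN conjunct2, THEN conjunct2] simp: max_def)
      finally show "norm (((p - q) \<bullet> b) *\<^sub>R (hx x b u t - hx x 0 u t)) \<le> norm (p - q) * (2 * M)"
        using Basis_le_norm[OF b, of "p - q"] by (simp add: mult_mono del: mult_2)
    qed
    finally show "norm (hx x p u t - hx x q u t) \<le> real DIM('a) * (2 * M) * norm (p - q)"
      by (simp add: mult_ac)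
  qed (use M in auto)
qed

lemma along_measurable:
  assumes x: "continuous_on {\<tau>..T} x" and p: "continuous_on {\<tau>..T} p" and \<tau>: "t0 \<le> \<tau>"
    and u: "u \<in> controls U T \<tau>"
  shows "(\<lambda>t. f (x t) (u t) t) \<in> borel_measurable (lebesgue_on {\<tau>..T})"
    "(\<lambda>t. F (x t) (u t) t) \<in> borel_measurable (lebesgue_on {\<tau>..T})"
    "(\<lambda>t. hx (x t) (p t) (u t) t) \<in> borel_measurable (lebesgue_on {\<tau>..T})"
    "(\<lambda>t. ham (x t) (p t) (u t) t) \<in> borel_measurable (lebesgue_on {\<tau>..T})"
proof -
  note comp = borel_measurable_comp_control[OF _ compact_imp_closed[OF U(1)] closed_atLeastAtMost
      _ controls_measurable[OF u] controls_in[OF u]]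
  have xp: "continuous_on {\<tau>..T} (\<lambda>t. (x t, p t))" using x p by (rule continuous_on_Pair)
  have D: "{\<tau>..T} \<subseteq> {t0..T}" using \<tau> by auto
  show "(\<lambda>t. f (x t) (u t) t) \<in> borel_measurable (lebesgue_on {\<tau>..T})"
    by (rule comp[OF f_cont x _ D])
  show "(\<lambda>t. F (x t) (u t) t) \<in> borel_measurable (lebesgue_on {\<tau>..T})"
    by (rule comp[OF F_cont x _ D])
  show "(\<lambda>t. hx (x t) (p t) (u t) t) \<in> borel_measurable (lebesgue_on {\<tau>..T})"
    using comp[where g = "\<lambda>(x, p). hx x p", OF _ xp _ D] hx_cont by (simp add: split_def)
  show "(\<lambda>t. ham (x t) (p t) (u t) t) \<in> borel_measurable (lebesgue_on {\<tau>..T})"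
    using comp[where g = "\<lambda>(x, p). ham x p", OF _ xp _ D] ham_cont_pair by (simp add: split_def)
qed

lemma along_integrable:
  assumes x: "continuous_on {\<tau>..T} x" and p: "continuous_on {\<tau>..T} p" and \<tau>: "t0 \<le> \<tau>"
    and u: "u \<in> controls U T \<tau>"
  shows "(\<lambda>t. f (x t) (u t) t) integrable_on {\<tau>..T}" "(\<lambda>t. F (x t) (u t) t) integrable_on {\<tau>..T}"
    "(\<lambda>t. hx (x t) (p t) (u t) t) integrable_on {\<tau>..T}"
proof -
  obtain K1 where K1: "\<And>t. t \<in> {\<tau>..T} \<Longrightarrow> norm (x t) \<le> K1" using continuous_on_Icc_bounded[OF x] by blast
  obtain K2 where K2: "\<And>t. t \<in> {\<tau>..T} \<Longrightarrow> norm (p t) \<le> K2" using continuous_on_Icc_bounded[OF p] by blast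
  obtain M where "bounds_upto (max K1 K2) M" using uniform_bounds by blast
  note M = bounds_uptoD[OF this]
  have b: "norm (f (x t) (u t) t) \<le> M \<and> \<bar>F (x t) (u t) t\<bar> \<le> M \<and> norm (hx (x t) (p t) (u t) t) \<le> M"
    if "t \<in> {\<tau>..T}" for t
    using K1[OF that] K2[OF that] that \<tau> by (intro M(2) controls_in[OF u]) auto
  show "(\<lambda>t. f (x t) (u t) t) integrable_on {\<tau>..T}" "(\<lambda>t. F (x t) (u t) t) integrable_on {\<tau>..T}"
    "(\<lambda>t. hx (x t) (p t) (u t) t) integrable_on {\<tau>..T}"
    using b by (intro bounded_measurable_integrable_on[OF along_measurable(1)[OF assms]]
        bounded_measurable_integrable_on[OF along_measurable(2)[OF assms]]
        bounded_measurable_integrable_on[OF along_measurable(3)[OF assms]], auto)+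
qed

lemma ex_adjoint:
  assumes x: "continuous_on {\<tau>..T} x" and \<tau>: "\<tau> \<in> {t0..T}" and u: "u \<in> controls U T \<tau>"
  obtains p where "adjoint_solution x u \<tau> T p" "p T = 0"
proof -
  obtain K where K: "\<And>t. t \<in> {\<tau>..T} \<Longrightarrow> norm (x t) \<le> K" using continuous_on_Icc_bounded[OF x] by blast
  obtain L where L: "L \<ge> 0" "\<And>x p q u t. norm x \<le> K \<Longrightarrow> u \<in> U \<Longrightarrow> t \<in> {t0..T} \<Longrightarrow>
      norm (hx x p u t - hx x q u t) \<le> L * norm (p - q)"
    using hx_lipschitz_costate[of K] by blast
  have int: "(\<lambda>s. hx (x s) (q s) (u s) s) integrable_on {\<tau>..T}" if "continuous_on {\<tau>..T} q" for q
    using along_integrable(3)[OF x that _ u] \<tau> by auto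
  obtain p where p: "continuous_on {\<tau>..T} p"
    "\<And>t. t \<in> {\<tau>..T} \<Longrightarrow> p t = integral {t..T} (\<lambda>s. hx (x s) (p s) (u s) s)"
  proof (rule backward_integral_equation[where G = "\<lambda>s p. hx (x s) p (u s) s", OF _ L(1) int])
    show "\<tau> \<le> T" using \<tau> by simp
    show "norm (hx (x s) p (u s) s - hx (x s) q (u s) s) \<le> L * norm (p - q)" if "s \<in> {\<tau>..T}" for s p q
      using K[OF that] that \<tau> by (intro L controls_in[OF u]) auto
    fix p assume "continuous_on {\<tau>..T} p"
      "\<And>t. t \<in> {\<tau>..T} \<Longrightarrow> p t = integral {t..T} (\<lambda>s. hx (x s) (p s) (u s) s)"
    then show thesis by (rule that)
  qed
  have "adjoint_solution x u \<tau> T p"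
    unfolding integral_solution_def fst_conv snd_conv
  proof (intro conjI p(1) allI impI)
    fix r s assume rs: "\<tau> \<le> r \<and> r \<le> s \<and> s \<le> T"
    let ?h = "\<lambda>s. hx (x s) (p s) (u s) s"
    have i: "?h integrable_on {a..b}" if "\<tau> \<le> a" "b \<le> T" for a b
      by (rule integrable_on_subinterval[OF int[OF p(1)]]) (use that in auto)
    have "integral {r..T} ?h = integral {r..s} ?h + integral {s..T} ?h"
      using Henstock_Kurzweil_Integration.integral_combine[of r s T ?h] rs i by auto
    then have "p s - p r = - integral {r..s} ?h" using p(2)[of r] p(2)[of s] rs by auto
    then show "((\<lambda>t. - ?h t) has_integral p s - p r) {r..s}"
      using i[of r s] rs by (auto intro!: has_integral_neg integrable_integral)
  qed
  moreover have "p T = 0" using p(2)[of T] \<tau> by simp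
  ultimately show ?thesis by (rule that)
qed

lemma adjoint_unique:
  assumes x: "continuous_on {\<tau>..T} x" and \<tau>: "\<tau> \<in> {t0..T}" and u: "u \<in> controls U T \<tau>"
    and p: "adjoint_solution x u \<tau> T p" and q: "adjoint_solution x u \<tau> T q" and eq: "p T = q T"
    and t: "t \<in> {\<tau>..T}"
  shows "p t = q t"
proof -
  obtain K where K: "\<And>t. t \<in> {\<tau>..T} \<Longrightarrow> norm (x t) \<le> K" using continuous_on_Icc_bounded[OF x] by blast
  obtain L where L: "L \<ge> 0" "\<And>x p q u t. norm x \<le> K \<Longrightarrow> u \<in> U \<Longrightarrow> t \<in> {t0..T} \<Longrightarrow>
      norm (hx x p u t - hx x q u t) \<le> L * norm (p - q)"
    using hx_lipschitz_costate[of K] by blast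
  have "norm (p t - q t) \<le> norm (p T - q T) * exp (L * (T - t))"
  proof (rule integral_solution_gronwall(2)[OF p q L(1)])
    fix s assume s: "s \<in> {\<tau>..T}"
    have "norm (hx (x s) (p s) (u s) s - hx (x s) (q s) (u s) s) \<le> L * norm (p s - q s)"
      using K[OF s] s \<tau> by (intro L controls_in[OF u]) auto
    then show "norm (- hx (fst (x s, u s)) (p s) (snd (x s, u s)) s - - hx (fst (x s, u s)) (q s) (snd (x s, u s)) s)
        \<le> L * norm (p s - q s)" by (simp add: norm_minus_commute)
  qed (use t in auto)
  then show ?thesis using eq by simp
qed

lemma adjoint_bounded:
  obtains P where "P \<ge> 0" "\<And>\<tau> x u p t. \<tau> \<in> {t0..T} \<Longrightarrow> (\<And>t. t \<in> {\<tau>..T} \<Longrightarrow> norm (x t) \<le> K) \<Longrightarrow>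
     u \<in> controls U T \<tau> \<Longrightarrow> adjoint_solution x u \<tau> T p \<Longrightarrow> p T = 0 \<Longrightarrow> t \<in> {\<tau>..T} \<Longrightarrow> norm (p t) \<le> P"
proof -
  obtain L where L: "L \<ge> 0" "\<And>x p q u t. norm x \<le> K \<Longrightarrow> u \<in> U \<Longrightarrow> t \<in> {t0..T} \<Longrightarrow>
      norm (hx x p u t - hx x q u t) \<le> L * norm (p - q)"
    using hx_lipschitz_costate[of K] by blast
  obtain M where "bounds_upto (max K 0) M" using uniform_bounds by blast
  note M = bounds_uptoD[OF this]
  show ?thesis
  proof (rule that[of "M * \<bar>T - t0\<bar> * exp (L * \<bar>T - t0\<bar>)"])
    fix \<tau> x u p t
    assume \<tau>: "\<tau> \<in> {t0..T}" and K: "\<And>t. t \<in> {\<tau>..T} \<Longrightarrow> norm (x t) \<le> K" and u: "u \<in> controls U T \<tau>"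
      and p: "adjoint_solution x u \<tau> T p" and pT: "p T = 0" and t: "t \<in> {\<tau>..T}"
    note pc = integral_solutionD(1)[OF p]
    have "norm (p t) \<le> M * (T - \<tau>) * exp (L * (T - t))"
    proof (rule gronwall_integral_backward[OF _ L(1) _ t])
      show "continuous_on {\<tau>..T} (\<lambda>t. norm (p t))" by (intro continuous_intros pc)
      fix s assume s: "s \<in> {\<tau>..T}"
      have pi: "(\<lambda>t. norm (p t)) integrable_on {s..T}"
        by (intro integrable_continuous_interval continuous_intros continuous_on_subset[OF pc]) (use s in auto)
      have h: "((\<lambda>t. - hx (x t) (p t) (u t) t) has_integral p T - p s) {s..T}"
        using integral_solutionD(2)[OF p, of s T] s by auto
      have "norm (integral {s..T} (\<lambda>t. - hx (x t) (p t) (u t) t)) \<le> integral {s..T} (\<lambda>t. M + L * norm (p t))"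
      proof (rule integral_norm_bound_integral)
        show "(\<lambda>t. - hx (x t) (p t) (u t) t) integrable_on {s..T}" using h by blast
        show "(\<lambda>t. M + L * norm (p t)) integrable_on {s..T}"
          using integrable_add[OF integrable_const_ivl[of M s T] integrable_cmul[OF pi, of L]] by simp
        fix r assume r: "r \<in> {s..T}"
        have rr: "r \<in> {\<tau>..T}" "r \<in> {t0..T}" using r s \<tau> by auto
        have "norm (hx (x r) (p r) (u r) r) \<le> norm (hx (x r) 0 (u r) r) + norm (hx (x r) (p r) (u r) r - hx (x r) 0 (u r) r)"
          by (rule norm_triangle_sub)
        also have "\<dots> \<le> M + L * norm (p r - 0)"
          using M(2)[of "x r" 0 "u r" r] K[OF rr(1)] controls_in[OF u rr(1)] rr
          by (intro add_mono L) auto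
        finally show "norm (- hx (x r) (p r) (u r) r) \<le> M + L * norm (p r)" by simp
      qed
      also have "\<dots> = M * (T - s) + L * integral {s..T} (\<lambda>t. norm (p t))"
        using integral_add[OF integrable_const_ivl[of M s T] integrable_cmul[OF pi, of L]] s by (simp add: mult.commute)
      also have "\<dots> \<le> M * (T - \<tau>) + L * integral {s..T} (\<lambda>t. norm (p t))"
        using s M(1) by (intro add_right_mono mult_left_mono) auto
      finally show "norm (p s) \<le> M * (T - \<tau>) + L * integral {s..T} (\<lambda>t. norm (p t))"
        using integral_unique[OF h] pT by simp
    qed
    also have "\<dots> \<le> M * \<bar>T - t0\<bar> * exp (L * \<bar>T - t0\<bar>)"
      using M(1) L(1) t \<tau> by (intro mult_mono) (auto intro!: mult_left_mono)
    finally show "norm (p t) \<le> M * \<bar>T - t0\<bar> * exp (L * \<bar>T - t0\<bar>)" .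
  qed (use M in auto)
qed

section \<open>Needle variations of the cost\<close>

abbreviation cost :: "real \<Rightarrow> (real \<Rightarrow> real^'m) \<Rightarrow> (real \<Rightarrow> 'a) \<Rightarrow> real" where
  "cost \<tau> u x \<equiv> integral {\<tau>..T} (\<lambda>t. F (x t) (u t) t)"

lemma indicator_integral_le:
  assumes E: "E \<in> sets lebesgue" "E \<subseteq> {\<tau>..T}"
  shows "indicat_real E integrable_on {a..b}" "integral {a..b} (indicat_real E) \<le> measure lebesgue E"
    "(indicat_real E has_integral measure lebesgue E) {\<tau>..T}"
proof -
  have Em: "E \<in> lmeasurable"
    by (rule bounded_set_imp_lmeasurable[OF bounded_subset[OF bounded_closed_interval[of \<tau> T]] E(1)]) (use E in auto)
  have i: "(indicat_real E has_integral measure lebesgue (E \<inter> {c..d})) {c..d}" for c d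
  proof -
    have m: "E \<inter> {c..d} \<in> lmeasurable" using Em by (intro fmeasurable.Int) auto
    show ?thesis
      unfolding has_integral_iff integrable_on_indicator
      using m Equivalence_Lebesgue_Henstock_Integration.integral_indicator[OF m] by blast
  qed
  show "indicat_real E integrable_on {a..b}" using i by blast
  have "integral {a..b} (indicat_real E) = measure lebesgue (E \<inter> {a..b})"
    using i by (rule integral_unique)
  also have "\<dots> \<le> measure lebesgue E" using Em by (intro measure_mono_fmeasurable) auto
  finally show "integral {a..b} (indicat_real E) \<le> measure lebesgue E" .
  have "E \<inter> {\<tau>..T} = E" using E(2) by auto
  then show "(indicat_real E has_integral measure lebesgue E) {\<tau>..T}" using i[of \<tau> T] by simp
qed

text \<open>On \<open>E\<close> the velocities differ by at most \<open>2 * M\<close>, elsewhere by the Lipschitz bound; Gronwall does the rest.\<close>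
lemma needle_state_estimate:
  assumes \<tau>: "\<tau> \<in> {t0..T}" and u: "u \<in> controls U T \<tau>" and v: "v \<in> controls U T \<tau>"
    and x: "integral_solution f u \<tau> T x" and y: "integral_solution f v \<tau> T y" and xy: "x \<tau> = y \<tau>"
    and lip: "lipschitz_upto R L"
    and M: "M \<ge> 0" "\<And>x u t. norm x \<le> R \<Longrightarrow> u \<in> U \<Longrightarrow> t \<in> {t0..T} \<Longrightarrow> norm (f x u t) \<le> M"
    and R: "\<And>t. t \<in> {\<tau>..T} \<Longrightarrow> norm (x t) \<le> R" "\<And>t. t \<in> {\<tau>..T} \<Longrightarrow> norm (y t) \<le> R"
    and E: "E \<in> sets lebesgue" "E \<subseteq> {\<tau>..T}" "\<And>t. t \<in> {\<tau>..T} - E \<Longrightarrow> v t = u t" and t: "t \<in> {\<tau>..T}"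
  shows "norm (y t - x t) \<le> 2 * M * exp (L * (T - t0)) * measure lebesgue E"
proof -
  note L = lipschitz_uptoD[OF lip]
  let ?\<mu> = "measure lebesgue E"
  have "norm (x t - y t) \<le> 2 * M * ?\<mu> * exp (L * (t - \<tau>))"
  proof (rule gronwall_integral[OF _ L(1) _ t])
    show c: "continuous_on {\<tau>..T} (\<lambda>t. norm (x t - y t))"
      by (intro continuous_intros integral_solutionD(1)[OF x] integral_solutionD(1)[OF y])
    fix s assume s: "s \<in> {\<tau>..T}"
    have ci: "(\<lambda>t. norm (x t - y t)) integrable_on {\<tau>..s}"
      by (intro integrable_continuous_interval continuous_on_subset[OF c]) (use s in auto)
    have ind: "indicat_real E integrable_on {\<tau>..s}" "integral {\<tau>..s} (indicat_real E) \<le> ?\<mu>"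
      using indicator_integral_le(1,2)[OF E(1,2), of \<tau> s] by auto
    note i1 = integrable_cmul[OF ci, of L] and i2 = integrable_cmul[OF ind(1), of "2 * M"]
    have "norm ((x s - y s) - (x \<tau> - y \<tau>)) \<le> integral {\<tau>..s} (\<lambda>t. L * norm (x t - y t) + 2 * M * indicat_real E t)"
    proof (rule integral_solution_diff_le[OF x y])
      show "(\<lambda>t. L * norm (x t - y t) + 2 * M * indicat_real E t) integrable_on {\<tau>..s}"
        using integrable_add[OF i1 i2] by simp
      fix r assume r: "r \<in> {\<tau>..s}"
      then have r': "r \<in> {\<tau>..T}" "r \<in> {t0..T}" using s \<tau> by auto
      have *: "norm (f (x r) (u r) r - f (y r) (u r) r) \<le> L * norm (x r - y r)"
        by (intro L R r' controls_in[OF u])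
      show "norm (f (x r) (u r) r - f (y r) (v r) r) \<le> L * norm (x r - y r) + 2 * M * indicat_real E r"
      proof (cases "r \<in> E")
        case False
        then show ?thesis using * E(3)[of r] r' by simp
      next
        case True
        have "norm (f (x r) (u r) r - f (y r) (v r) r) \<le> norm (f (x r) (u r) r) + norm (f (y r) (v r) r)"
          by (rule norm_triangle_ineq4)
        also have "\<dots> \<le> M + M" by (intro add_mono M R r' controls_in[OF u] controls_in[OF v])
        also have "\<dots> \<le> L * norm (x r - y r) + 2 * M * indicat_real E r" using True L(1) by simp
        finally show ?thesis .
      qed
    qed (use s in auto)
    also have "\<dots> = L * integral {\<tau>..s} (\<lambda>t. norm (x t - y t)) + 2 * M * integral {\<tau>..s} (indicat_real E)"
      using integral_add[OF i1 i2] by simp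
    also have "\<dots> \<le> L * integral {\<tau>..s} (\<lambda>t. norm (x t - y t)) + 2 * M * ?\<mu>"
      using ind(2) M(1) by (intro add_left_mono mult_left_mono) auto
    finally show "norm (x s - y s) \<le> 2 * M * ?\<mu> + L * integral {\<tau>..s} (\<lambda>t. norm (x t - y t))"
      using xy by simp
  qed
  also have "\<dots> \<le> 2 * M * ?\<mu> * exp (L * (T - t0))"
    using M(1) t \<tau> L(1) by (intro mult_left_mono) (auto intro: mult_left_mono)
  finally show ?thesis by (simp add: norm_minus_commute mult_ac)
qed

text \<open>An exact formula. The integral of the derivative of \<open>p \<bullet> (y - x)\<close> vanishes because \<open>x \<tau> = y \<tau>\<close> and \<open>p T = 0\<close>;
  subtracting it from the difference of the running costs turns these into control Hamiltonians.\<close>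
theorem cost_difference:
  assumes \<tau>: "\<tau> \<in> {t0..T}" and u: "u \<in> controls U T \<tau>" and v: "v \<in> controls U T \<tau>"
    and x: "integral_solution f u \<tau> T x" and y: "integral_solution f v \<tau> T y" and xy: "x \<tau> = y \<tau>"
    and p: "adjoint_solution x u \<tau> T p" "p T = 0"
  shows "((\<lambda>t. ham (x t) (p t) (u t) t + hx (x t) (p t) (u t) t \<bullet> (y t - x t) - ham (y t) (p t) (v t) t)
      has_integral cost \<tau> v y - cost \<tau> u x) {\<tau>..T}"
proof -
  note xc = integral_solutionD(1)[OF x] and yc = integral_solutionD(1)[OF y] and pc = integral_solutionD(1)[OF p(1)]
  define \<pi> where "\<pi> t = - hx (x t) (p t) (u t) t" for t
  define \<delta> where "\<delta> t = f (y t) (v t) t - f (x t) (u t) t" for t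
  obtain R where R: "\<And>t. t \<in> {\<tau>..T} \<Longrightarrow> norm (x t, y t, p t) \<le> R"
    using continuous_on_Icc_bounded[OF continuous_on_Pair[OF xc continuous_on_Pair[OF yc pc]]] by blast
  have R': "norm (x t) \<le> R" "norm (y t) \<le> R" "norm (p t) \<le> R" if "t \<in> {\<tau>..T}" for t
    using R[OF that] norm_fst_le[of "x t" "(y t, p t)"] norm_snd_le[of "(y t, p t)" "x t"]
      norm_fst_le[of "y t" "p t"] norm_snd_le[of "p t" "y t"] by auto
  obtain M where "bounds_upto R M" using uniform_bounds by blast
  note M = bounds_uptoD[OF this]
  have tau0: "t0 \<le> \<tau>" using \<tau> by simp
  note mx = along_measurable[OF xc pc tau0 u] and my = along_measurable[OF yc pc tau0 v]
  have bx: "norm (f (x t) (u t) t) \<le> M" "norm (\<pi> t) \<le> M" "norm (f (y t) (v t) t) \<le> M" if t: "t \<in> {\<tau>..T}" for t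
    using M(2)[OF R'(1,3)[OF t] controls_in[OF u t]] M(2)[OF R'(2,3)[OF t] controls_in[OF v t]] t \<tau>
    by (auto simp: \<pi>_def)
  have b\<delta>: "norm (\<delta> t) \<le> 2 * M" if t: "t \<in> {\<tau>..T}" for t
    using norm_triangle_ineq4[of "f (y t) (v t) t" "f (x t) (u t) t"] bx[OF t] by (simp add: \<delta>_def)
  have pm: "p \<in> borel_measurable (lebesgue_on {\<tau>..T})" "(\<lambda>t. y t - x t) \<in> borel_measurable (lebesgue_on {\<tau>..T})"
    by (intro continuous_imp_measurable_on_sets_lebesgue continuous_intros xc yc pc, simp)+
  have "((\<lambda>t. p t \<bullet> \<delta> t + \<pi> t \<bullet> (y t - x t)) has_integral p T \<bullet> (y T - x T) - p \<tau> \<bullet> (y \<tau> - x \<tau>)) {\<tau>..T}"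
  proof (rule has_integral_inner_product_rule[where C = "2 * M"])
    show "(\<pi> has_integral p s - p r) {r..s}" if "\<tau> \<le> r" "r \<le> s" "s \<le> T" for r s
      using integral_solutionD(2)[OF p(1) that] by (simp add: \<pi>_def[abs_def])
    show "(\<delta> has_integral (y s - x s) - (y r - x r)) {r..s}" if "\<tau> \<le> r" "r \<le> s" "s \<le> T" for r s
      using has_integral_diff[OF integral_solutionD(2)[OF y that] integral_solutionD(2)[OF x that]]
      by (simp add: \<delta>_def[abs_def] algebra_simps)
    show "norm (\<pi> t) \<le> 2 * M" if "t \<in> {\<tau>..T}" for t using bx(2)[OF that] M(1) by simp
    show "(\<lambda>t. p t \<bullet> \<delta> t + \<pi> t \<bullet> (y t - x t)) integrable_on {\<tau>..T}"
    proof (rule bounded_measurable_integrable_on[where C = "R * (2 * M) + M * (2 * R)"])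
      show "(\<lambda>t. p t \<bullet> \<delta> t + \<pi> t \<bullet> (y t - x t)) \<in> borel_measurable (lebesgue_on {\<tau>..T})"
        unfolding \<delta>_def \<pi>_def
        by (intro borel_measurable_add borel_measurable_inner borel_measurable_diff borel_measurable_uminus pm mx(1,3) my(1))
      fix t assume t: "t \<in> {\<tau>..T}"
      have "norm (p t \<bullet> \<delta> t + \<pi> t \<bullet> (y t - x t)) \<le> norm (p t) * norm (\<delta> t) + norm (\<pi> t) * norm (y t - x t)"
        unfolding real_norm_def by (intro order_trans[OF abs_triangle_ineq] add_mono Cauchy_Schwarz_ineq2)
      also have "\<dots> \<le> R * (2 * M) + M * (2 * R)"
      proof (intro add_mono mult_mono)
        show "norm (y t - x t) \<le> 2 * R"
          using norm_triangle_ineq4[of "y t" "x t"] R'[OF t] by simp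
        show "0 \<le> R" using R'(1)[OF t] norm_ge_zero order_trans by blast
      qed (use R'[OF t] b\<delta>[OF t] bx[OF t] M(1) in auto)
      finally show "norm (p t \<bullet> \<delta> t + \<pi> t \<bullet> (y t - x t)) \<le> R * (2 * M) + M * (2 * R)" .
    qed
    show "\<tau> \<le> T" using \<tau> by simp
  qed (rule b\<delta>)
  then have "((\<lambda>t. p t \<bullet> \<delta> t + \<pi> t \<bullet> (y t - x t)) has_integral 0) {\<tau>..T}" using p(2) xy by simp
  moreover have "((\<lambda>t. F (y t) (v t) t) has_integral cost \<tau> v y) {\<tau>..T}"
    "((\<lambda>t. F (x t) (u t) t) has_integral cost \<tau> u x) {\<tau>..T}"
    by (intro integrable_integral along_integrable(2)[OF yc pc tau0 v] along_integrable(2)[OF xc pc tau0 u])+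
  ultimately have "((\<lambda>t. F (y t) (v t) t - F (x t) (u t) t - (p t \<bullet> \<delta> t + \<pi> t \<bullet> (y t - x t)))
      has_integral cost \<tau> v y - cost \<tau> u x - 0) {\<tau>..T}"
    by (intro has_integral_diff)
  then show ?thesis by (simp add: \<delta>_def \<pi>_def inner_diff_right algebra_simps)
qed

text \<open>By \<open>needle_state_estimate\<close> the states differ by at most a constant times the measure of \<open>E\<close>. In
  \<open>cost_difference\<close> the integrand off \<open>E\<close> is a Taylor remainder, hence of smaller order than this measure,
  and on \<open>E\<close> it is at most \<open>- \<epsilon>\<close> plus terms of the order of this measure. All constants come from bounds on
  \<open>x\<close> and \<open>p\<close> that are common to all controls.\<close>
theorem needle_variation:
  assumes \<tau>: "\<tau> \<in> {t0..<T}" and \<epsilon>: "\<epsilon> > 0"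
  obtains \<mu> where "\<mu> > 0"
    "\<And>u v x y p E. u \<in> controls U T \<tau> \<Longrightarrow> v \<in> controls U T \<tau> \<Longrightarrow>
       integral_solution f u \<tau> T x \<Longrightarrow> x \<tau> = x0 \<Longrightarrow> integral_solution f v \<tau> T y \<Longrightarrow> y \<tau> = x0 \<Longrightarrow>
       adjoint_solution x u \<tau> T p \<Longrightarrow> p T = 0 \<Longrightarrow>
       E \<in> sets lebesgue \<Longrightarrow> E \<subseteq> {\<tau>..T} \<Longrightarrow> measure lebesgue E \<le> \<mu> \<Longrightarrow>
       (\<And>t. t \<in> {\<tau>..T} - E \<Longrightarrow> v t = u t) \<Longrightarrow>
       (\<And>t. t \<in> E \<Longrightarrow> ham (x t) (p t) (u t) t + \<epsilon> \<le> ham (x t) (p t) (v t) t) \<Longrightarrow>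
       cost \<tau> v y \<le> cost \<tau> u x - \<epsilon> / 2 * measure lebesgue E"
proof -
  have \<tau>': "\<tau> \<in> {t0..T}" "\<tau> < T" using \<tau> by auto
  obtain K where K: "K \<ge> 0" "\<And>u x r. u \<in> controls U T \<tau> \<Longrightarrow> integral_solution f u \<tau> T x \<Longrightarrow> x \<tau> = x0 \<Longrightarrow>
      r \<in> {\<tau>..T} \<Longrightarrow> norm (x r) \<le> K"
    using solutions_bounded[OF \<tau>'(1), of x0] by blast
  obtain P where P: "P \<ge> 0" "\<And>\<tau> x u p t. \<tau> \<in> {t0..T} \<Longrightarrow> (\<And>t. t \<in> {\<tau>..T} \<Longrightarrow> norm (x t) \<le> K) \<Longrightarrow>
     u \<in> controls U T \<tau> \<Longrightarrow> adjoint_solution x u \<tau> T p \<Longrightarrow> p T = 0 \<Longrightarrow> t \<in> {\<tau>..T} \<Longrightarrow> norm (p t) \<le> P"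
    using adjoint_bounded[of K] by blast
  define R where "R = max K P"
  obtain M where "bounds_upto R M" using uniform_bounds by blast
  note M = bounds_uptoD[OF this]
  obtain L where lip: "lipschitz_upto R L" using f_lipschitz by blast
  note L = lipschitz_uptoD[OF lip]
  define C where "C = 2 * M * exp (L * (T - t0))"
  have C: "C \<ge> 0" using M(1) by (simp add: C_def)
  define c where "c = C + 1"
  define M1 where "M1 = M + 1"
  have cM: "c > 0" "C \<le> c" "M1 > 0" "M \<le> M1" using C M(1) by (auto simp: c_def M1_def)
  \<comment> \<open>Half of the gain is given away: a quarter to the Taylor remainder off \<open>E\<close>, controlled by \<open>e\<close>, and a quarter to the first-order terms on \<open>E\<close>, controlled by \<open>\<mu>\<close>.\<close>
  define e where "e = \<epsilon> / (4 * c * (T - \<tau>))"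
  have nz: "c \<noteq> 0" "M1 \<noteq> 0" "T - \<tau> \<noteq> 0" using cM \<tau>'(2) by auto
  have e: "e > 0" "e * C * (T - \<tau>) \<le> \<epsilon> / 4"
  proof -
    show "e > 0" unfolding e_def using \<epsilon> cM \<tau>'(2) by (intro divide_pos_pos mult_pos_pos) auto
    then have "e * C * (T - \<tau>) \<le> e * c * (T - \<tau>)"
      using \<tau>'(2) cM by (intro mult_right_mono mult_left_mono) auto
    also have "\<dots> = \<epsilon> / 4" unfolding e_def using nz by (simp del: right_diff_distrib_numeral)
    finally show "e * C * (T - \<tau>) \<le> \<epsilon> / 4" .
  qed
  obtain d where d: "d > 0" "\<And>x y p u t. norm x \<le> R \<Longrightarrow> norm y \<le> R \<Longrightarrow> norm p \<le> R \<Longrightarrow> u \<in> U \<Longrightarrow> t \<in> {t0..T} \<Longrightarrow>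
      norm (y - x) < d \<Longrightarrow> \<bar>ham y p u t - ham x p u t - hx x p u t \<bullet> (y - x)\<bar> \<le> e * norm (y - x)"
    using ham_taylor[OF e(1), of R] by blast
  define \<mu> where "\<mu> = min (\<epsilon> / (8 * M1 * c)) (d / (2 * c))"
  have \<mu>: "\<mu> > 0" using \<epsilon> cM d(1) by (simp add: \<mu>_def)
  have \<mu>1: "2 * M * (C * \<mu>) \<le> \<epsilon> / 4"
  proof -
    have "2 * M * (C * \<mu>) \<le> 2 * M1 * (c * (\<epsilon> / (8 * M1 * c)))"
      using M(1) C cM \<mu> by (intro mult_mono) (auto simp: \<mu>_def)
    also have "\<dots> = \<epsilon> / 4" using nz by simp
    finally show ?thesis .
  qed
  have \<mu>2: "C * \<mu> < d"
  proof -
    have "C * \<mu> \<le> c * (d / (2 * c))"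
      using C cM \<mu> by (intro mult_mono) (auto simp: \<mu>_def)
    also have "\<dots> = d / 2" using nz by simp
    finally show ?thesis using d(1) by simp
  qed
  have main: "cost \<tau> v y \<le> cost \<tau> u x - \<epsilon> / 2 * measure lebesgue E"
    if u: "u \<in> controls U T \<tau>" and v: "v \<in> controls U T \<tau>"
      and x: "integral_solution f u \<tau> T x" "x \<tau> = x0" and y: "integral_solution f v \<tau> T y" "y \<tau> = x0"
      and p: "adjoint_solution x u \<tau> T p" "p T = 0"
      and E: "E \<in> sets lebesgue" "E \<subseteq> {\<tau>..T}" "measure lebesgue E \<le> \<mu>" "\<And>t. t \<in> {\<tau>..T} - E \<Longrightarrow> v t = u t"
      and gain: "\<And>t. t \<in> E \<Longrightarrow> ham (x t) (p t) (u t) t + \<epsilon> \<le> ham (x t) (p t) (v t) t"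
    for u v x y p E
  proof -
    let ?m = "measure lebesgue E"
    have R: "norm (x t) \<le> R" "norm (y t) \<le> R" "norm (p t) \<le> R" if t: "t \<in> {\<tau>..T}" for t
    proof -
      show "norm (x t) \<le> R" using K(2)[OF u x t] by (simp add: R_def)
      show "norm (y t) \<le> R" using K(2)[OF v y t] by (simp add: R_def)
      have "norm (p t) \<le> P" by (rule P(2)[OF \<tau>'(1) _ u p t]) (use K(2)[OF u x] in auto)
      then show "norm (p t) \<le> R" by (simp add: R_def)
    qed
    have Mf: "norm (f x u t) \<le> M" if "norm x \<le> R" "u \<in> U" "t \<in> {t0..T}" for x u t
      using M(2)[of x x] that by blast
    have Mh: "norm (hx x p u t) \<le> M" if "norm x \<le> R" "norm p \<le> R" "u \<in> U" "t \<in> {t0..T}" for x p u t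
      using M(2)[of x p] that by blast
    have yx: "norm (y t - x t) \<le> C * ?m" if t: "t \<in> {\<tau>..T}" for t
      unfolding C_def
      by (rule needle_state_estimate[OF \<tau>'(1) u v x(1) y(1) _ lip M(1) Mf _ _ E(1,2,4) t])
         (use x(2) y(2) R in auto)
    have m: "0 \<le> ?m" by simp
    have Cm: "C * ?m \<le> C * \<mu>" using E(3) C by (rule mult_left_mono)
    let ?b = "\<lambda>t. e * (C * ?m) + (- \<epsilon> + \<epsilon> / 4) * indicat_real E t"
    have "cost \<tau> v y - cost \<tau> u x \<le> e * (C * ?m) * (T - \<tau>) + (- \<epsilon> + \<epsilon> / 4) * ?m"
    proof (rule has_integral_le[OF cost_difference[OF \<tau>'(1) u v x(1) y(1) _ p]])
      show "x \<tau> = y \<tau>" using x y by simp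
      have 1: "((\<lambda>t. e * (C * ?m)) has_integral e * (C * ?m) * (T - \<tau>)) {\<tau>..T}"
        using has_integral_const_real[of "e * (C * ?m)" \<tau> T] \<tau>'(2) by (simp add: mult.commute)
      have 2: "((\<lambda>t. (- \<epsilon> + \<epsilon> / 4) * indicat_real E t) has_integral (- \<epsilon> + \<epsilon> / 4) * ?m) {\<tau>..T}"
        by (intro has_integral_mult_right indicator_integral_le(3) E)
      show "(?b has_integral e * (C * ?m) * (T - \<tau>) + (- \<epsilon> + \<epsilon> / 4) * ?m) {\<tau>..T}"
        by (rule has_integral_add[OF 1 2])
      fix t assume t: "t \<in> {\<tau>..T}"
      have tD: "t \<in> {t0..T}" using t \<tau> by auto
      note R[OF t] and yx = yx[OF t]
      show "ham (x t) (p t) (u t) t + hx (x t) (p t) (u t) t \<bullet> (y t - x t) - ham (y t) (p t) (v t) t \<le> ?b t"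
      proof (cases "t \<in> E")
        case False
        have "\<bar>ham (y t) (p t) (u t) t - ham (x t) (p t) (u t) t - hx (x t) (p t) (u t) t \<bullet> (y t - x t)\<bar>
            \<le> e * norm (y t - x t)"
          using yx Cm \<mu>2 by (intro d(2) R[OF t] tD controls_in[OF u t]) auto
        also have "\<dots> \<le> e * (C * ?m)" using yx e(1) by (intro mult_left_mono) auto
        finally show ?thesis using False E(4)[of t] t by simp
      next
        case True
        have "\<bar>ham (y t) (p t) (v t) t - ham (x t) (p t) (v t) t\<bar> \<le> M * norm (y t - x t)"
          by (rule ham_lipschitz[OF Mh R(2,1,3)[OF t] controls_in[OF v t] tD])
        also have "\<dots> \<le> M * (C * \<mu>)" using yx Cm M(1) by (intro mult_left_mono) auto
        finally have 1: "ham (x t) (p t) (v t) t - ham (y t) (p t) (v t) t \<le> M * (C * \<mu>)" by linarith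
        have "hx (x t) (p t) (u t) t \<bullet> (y t - x t) \<le> norm (hx (x t) (p t) (u t) t) * norm (y t - x t)"
          by (rule norm_cauchy_schwarz)
        also have "\<dots> \<le> M * (C * \<mu>)"
          using Mh[OF R(1,3)[OF t] controls_in[OF u t] tD] yx Cm M(1) by (intro mult_mono) auto
        finally have 2: "hx (x t) (p t) (u t) t \<bullet> (y t - x t) \<le> M * (C * \<mu>)" .
        have "0 \<le> e * (C * ?m)" using e(1) C m by simp
        then show ?thesis using 1 2 gain[OF True] \<mu>1 True by simp
      qed
    qed
    also have "e * (C * ?m) * (T - \<tau>) = (e * C * (T - \<tau>)) * ?m" by (simp add: mult_ac)
    also have "\<dots> \<le> \<epsilon> / 4 * ?m" using e(2) m by (rule mult_right_mono)
    finally show ?thesis by (simp add: algebra_simps)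
  qed
  show ?thesis by (rule that[OF \<mu> main])
qed

section \<open>The maximum condition along a minimizing sequence\<close>

lemma controls_splice:
  assumes u: "u \<in> controls U T \<tau>" and w: "w \<in> controls U T \<tau>" and E: "E \<in> sets lebesgue"
  shows "(\<lambda>t. if t \<in> E then w t else u t) \<in> controls U T \<tau>"
proof (rule controlsI)
  have "{t \<in> space (lebesgue_on {\<tau>..T}). t \<in> E} \<in> sets (lebesgue_on {\<tau>..T})"
  proof -
    have "{t \<in> space (lebesgue_on {\<tau>..T}). t \<in> E} = {\<tau>..T} \<inter> E" by auto
    then show ?thesis using E by (auto simp: sets_restrict_space)
  qed
  then show "(\<lambda>t. if t \<in> E then w t else u t) \<in> borel_measurable (lebesgue_on {\<tau>..T})"
    by (intro measurable_If controls_measurable[OF u] controls_measurable[OF w])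
qed (use controls_in[OF u] controls_in[OF w] in auto)

lemma ham_selection:
  assumes x: "continuous_on {\<tau>..T} x" and p: "continuous_on {\<tau>..T} p" and \<tau>: "t0 \<le> \<tau>"
  obtains w where "w \<in> controls U T \<tau>" "\<And>t. t \<in> {\<tau>..T} \<Longrightarrow> w t \<in> argmax_on U (\<lambda>v. ham (x t) (p t) v t)"
proof -
  have "continuous_on ({\<tau>..T} \<times> U) (\<lambda>z. (\<lambda>((x, p), u, t). ham x p u t) ((x (fst z), p (fst z)), snd z, fst z))"
    by (rule continuous_on_compose2[OF ham_cont_pair])
      (use \<tau> in \<open>auto intro!: continuous_intros continuous_on_compose2[OF x] continuous_on_compose2[OF p]\<close>)
  then have "continuous_on ({\<tau>..T} \<times> U) (\<lambda>(t, v). ham (x t) (p t) v t)" by (simp add: split_def)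
  from measurable_argmax_selection[OF U this] obtain w where w: "w \<in> borel_measurable (lebesgue_on {\<tau>..T})"
    "\<And>t. t \<in> {\<tau>..T} \<Longrightarrow> w t \<in> argmax_on U (\<lambda>v. ham (x t) (p t) v t)" by blast
  have "w \<in> controls U T \<tau>" by (rule controlsI[OF w(1)]) (use w(2) in \<open>auto simp: argmax_on_def\<close>)
  then show ?thesis using that w(2) by blast
qed

text \<open>Needle variations are allowed on sets of measure at most \<open>\<mu>\<close> only. So the set where \<open>w\<close> gains \<open>\<epsilon>\<close> over \<open>u\<close> is
  cut by a grid of step at most \<open>\<mu>\<close>: on each piece the gain lowers the cost, which can happen by
  \<open>\<eta>\<close> at most.\<close>
theorem maximum_condition_in_measure:
  assumes \<tau>: "\<tau> \<in> {t0..<T}" and \<epsilon>: "\<epsilon> > 0"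
  obtains C where "C \<ge> 0"
    "\<And>m \<eta> u x p w. u \<in> controls U T \<tau> \<Longrightarrow> integral_solution f u \<tau> T x \<Longrightarrow> x \<tau> = x0 \<Longrightarrow>
       adjoint_solution x u \<tau> T p \<Longrightarrow> p T = 0 \<Longrightarrow> w \<in> controls U T \<tau> \<Longrightarrow>
       (\<And>v y. v \<in> controls U T \<tau> \<Longrightarrow> integral_solution f v \<tau> T y \<Longrightarrow> y \<tau> = x0 \<Longrightarrow> m \<le> cost \<tau> v y) \<Longrightarrow>
       cost \<tau> u x \<le> m + \<eta> \<Longrightarrow>
       {t \<in> {\<tau>..T}. ham (x t) (p t) (u t) t + \<epsilon> \<le> ham (x t) (p t) (w t) t} \<in> lmeasurable \<and>
       measure lebesgue {t \<in> {\<tau>..T}. ham (x t) (p t) (u t) t + \<epsilon> \<le> ham (x t) (p t) (w t) t} \<le> C * \<eta>"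
proof -
  have \<tau>': "\<tau> \<in> {t0..T}" "t0 \<le> \<tau>" "\<tau> < T" using \<tau> by auto
  obtain \<mu> where \<mu>: "\<mu> > 0" and needle:
    "\<And>u v x y p E. u \<in> controls U T \<tau> \<Longrightarrow> v \<in> controls U T \<tau> \<Longrightarrow>
       integral_solution f u \<tau> T x \<Longrightarrow> x \<tau> = x0 \<Longrightarrow> integral_solution f v \<tau> T y \<Longrightarrow> y \<tau> = x0 \<Longrightarrow>
       adjoint_solution x u \<tau> T p \<Longrightarrow> p T = 0 \<Longrightarrow>
       E \<in> sets lebesgue \<Longrightarrow> E \<subseteq> {\<tau>..T} \<Longrightarrow> measure lebesgue E \<le> \<mu> \<Longrightarrow>
       (\<And>t. t \<in> {\<tau>..T} - E \<Longrightarrow> v t = u t) \<Longrightarrow>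
       (\<And>t. t \<in> E \<Longrightarrow> ham (x t) (p t) (u t) t + \<epsilon> \<le> ham (x t) (p t) (v t) t) \<Longrightarrow>
       cost \<tau> v y \<le> cost \<tau> u x - \<epsilon> / 2 * measure lebesgue E"
    using needle_variation[OF \<tau> \<epsilon>, of x0] by blast
  obtain n :: nat where n: "(T - \<tau>) / \<mu> < real n" using reals_Archimedean2 by blast
  have n0: "n > 0" using n \<mu> \<tau>'(3) by (intro gr0I) (auto simp: field_simps)
  define h where "h = (T - \<tau>) / real n"
  have h: "h > 0" "h \<le> \<mu>" "real n * h = T - \<tau>"
    using n n0 \<mu> \<tau>'(3) by (auto simp: h_def field_simps)
  show ?thesis
  proof (rule that[of "real n * (2 / \<epsilon>)"])
    show "0 \<le> real n * (2 / \<epsilon>)" using \<epsilon> by simp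
    fix m \<eta> u x p w
    assume u: "u \<in> controls U T \<tau>" and x: "integral_solution f u \<tau> T x" "x \<tau> = x0"
      and p: "adjoint_solution x u \<tau> T p" "p T = 0" and w: "w \<in> controls U T \<tau>"
      and m: "\<And>v y. v \<in> controls U T \<tau> \<Longrightarrow> integral_solution f v \<tau> T y \<Longrightarrow> y \<tau> = x0 \<Longrightarrow> m \<le> cost \<tau> v y"
      and \<eta>: "cost \<tau> u x \<le> m + \<eta>"
    note xc = integral_solutionD(1)[OF x(1)] and pc = integral_solutionD(1)[OF p(1)]
    define E where "E = {t \<in> {\<tau>..T}. ham (x t) (p t) (u t) t + \<epsilon> \<le> ham (x t) (p t) (w t) t}"
    have "{t \<in> space (lebesgue_on {\<tau>..T}). ham (x t) (p t) (u t) t + \<epsilon> \<le> ham (x t) (p t) (w t) t}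
        \<in> sets (lebesgue_on {\<tau>..T})"
      by (intro borel_measurable_le borel_measurable_add borel_measurable_const
          along_measurable(4)[OF xc pc \<tau>'(2) u] along_measurable(4)[OF xc pc \<tau>'(2) w])
    then have E: "E \<in> sets lebesgue" unfolding E_def by (simp add: sets_restrict_space_iff)
    have Em: "E \<in> lmeasurable"
      by (rule bounded_set_imp_lmeasurable[OF bounded_subset[OF bounded_closed_interval[of \<tau> T]] E])
         (auto simp: E_def)
    define I where "I i = {\<tau> + real i * h..\<tau> + real (Suc i) * h}" for i
    have piece: "measure lebesgue (E \<inter> I i) \<le> 2 / \<epsilon> * \<eta>" for i
    proof -
      let ?E = "E \<inter> I i"
      let ?v = "\<lambda>t. if t \<in> ?E then w t else u t"
      have Es: "?E \<in> sets lebesgue" using E by (auto simp: I_def)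
      have v: "?v \<in> controls U T \<tau>" by (rule controls_splice[OF u w Es])
      obtain y where y: "integral_solution f ?v \<tau> T y" "y \<tau> = x0"
        using ex_solution[OF \<tau>'(1) v] by blast
      have "measure lebesgue ?E \<le> measure lebesgue (I i)"
        by (rule measure_mono_fmeasurable) (use Es in \<open>auto simp: I_def\<close>)
      also have "\<dots> = h" using h(1) by (simp add: I_def algebra_simps)
      finally have Emu: "measure lebesgue ?E \<le> \<mu>" using h(2) by simp
      have "cost \<tau> ?v y \<le> cost \<tau> u x - \<epsilon> / 2 * measure lebesgue ?E"
      proof (rule needle[OF u v x y p Es _ Emu])
        show "?E \<subseteq> {\<tau>..T}" unfolding E_def by blast
        show "?v t = u t" if "t \<in> {\<tau>..T} - ?E" for t using that by auto
        show "ham (x t) (p t) (u t) t + \<epsilon> \<le> ham (x t) (p t) (?v t) t" if t: "t \<in> ?E" for t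
        proof -
          have "ham (x t) (p t) (u t) t + \<epsilon> \<le> ham (x t) (p t) (w t) t" using t unfolding E_def by blast
          then show ?thesis using t by simp
        qed
      qed
      then have "\<epsilon> / 2 * measure lebesgue ?E \<le> \<eta>" using m[OF v y] \<eta> by linarith
      then show ?thesis using \<epsilon> by (simp add: field_simps)
    qed
    have Ei: "E \<inter> I i \<in> lmeasurable" for i
      unfolding I_def by (rule fmeasurable.Int[OF Em]) simp
    have "E \<subseteq> (\<Union>i<n. E \<inter> I i)"
    proof
      fix t assume t: "t \<in> E"
      then have t': "\<tau> \<le> t" "t \<le> T" by (auto simp: E_def)
      show "t \<in> (\<Union>i<n. E \<inter> I i)"
      \<comment> \<open>The endpoint \<open>T\<close> lies in the last piece, where rounding down would give the index \<open>n\<close>.\<close>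
      proof (cases "t = T")
        case True
        have "T = \<tau> + real (Suc (n - 1)) * h" using h(3) n0 by simp
        then have "t \<in> I (n - 1)" using True h(1) by (auto simp: I_def algebra_simps)
        then show ?thesis using t n0 by (intro UN_I[of "n - 1"]) auto
      next
        case False
        define i where "i = nat \<lfloor>(t - \<tau>) / h\<rfloor>"
        have nn: "(t - \<tau>) / h \<ge> 0" using t' h by simp
        have i1: "real i \<le> (t - \<tau>) / h" "(t - \<tau>) / h < real i + 1"
          using nn by (auto simp: i_def)
        have "(t - \<tau>) / h < real n" using False t' h by (simp add: pos_divide_less_eq)
        then have "i < n" using i1(1) by linarith
        moreover have "real i * h \<le> t - \<tau>" "t - \<tau> < (real i + 1) * h"
          using i1 h(1) by (auto simp: pos_le_divide_eq pos_divide_less_eq)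
        then have "t \<in> I i" by (auto simp: I_def algebra_simps)
        ultimately show ?thesis using t by blast
      qed
    qed
    then have "measure lebesgue E \<le> measure lebesgue (\<Union>i<n. E \<inter> I i)"
    proof (rule measure_mono_fmeasurable)
      show "E \<in> sets lebesgue" by fact
      show "(\<Union>i<n. E \<inter> I i) \<in> lmeasurable" by (rule fmeasurable.finite_UN) (use Ei in auto)
    qed
    also have "\<dots> \<le> (\<Sum>i<n. measure lebesgue (E \<inter> I i))"
      by (rule measure_UNION_le) (use Ei[THEN fmeasurableD] in auto)
    also have "\<dots> \<le> (\<Sum>i<n. 2 / \<epsilon> * \<eta>)" by (intro sum_mono piece)
    also have "\<dots> = real n * (2 / \<epsilon>) * \<eta>" by simp
    finally show "{t \<in> {\<tau>..T}. ham (x t) (p t) (u t) t + \<epsilon> \<le> ham (x t) (p t) (w t) t} \<in> lmeasurable \<and>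
       measure lebesgue {t \<in> {\<tau>..T}. ham (x t) (p t) (u t) t + \<epsilon> \<le> ham (x t) (p t) (w t) t} \<le> real n * (2 / \<epsilon>) * \<eta>"
      using Em unfolding E_def by blast
  qed
qed

lemma cost_bounded_below:
  assumes \<tau>: "\<tau> \<in> {t0..T}"
  obtains B where "\<And>u x. u \<in> controls U T \<tau> \<Longrightarrow> integral_solution f u \<tau> T x \<Longrightarrow> x \<tau> = x0 \<Longrightarrow> B \<le> cost \<tau> u x"
proof -
  obtain K where K: "K \<ge> 0" "\<And>u x r. u \<in> controls U T \<tau> \<Longrightarrow> integral_solution f u \<tau> T x \<Longrightarrow> x \<tau> = x0 \<Longrightarrow>
      r \<in> {\<tau>..T} \<Longrightarrow> norm (x r) \<le> K"
    using solutions_bounded[OF \<tau>, of x0] by blast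
  obtain M where "bounds_upto K M" using uniform_bounds by blast
  note M = bounds_uptoD[OF this]
  show ?thesis
  proof (rule that[of "- M * (T - \<tau>)"])
    fix u x assume u: "u \<in> controls U T \<tau>" and x: "integral_solution f u \<tau> T x" "x \<tau> = x0"
    note xc = integral_solutionD(1)[OF x(1)]
    have "integral {\<tau>..T} (\<lambda>t. - M) \<le> cost \<tau> u x"
    proof (rule integral_le)
      show "(\<lambda>t. F (x t) (u t) t) integrable_on {\<tau>..T}"
        by (rule along_integrable(2)[OF xc xc _ u]) (use \<tau> in auto)
      fix t assume t: "t \<in> {\<tau>..T}"
      have "\<bar>F (x t) (u t) t\<bar> \<le> M"
        using M(2)[of "x t" "x t" "u t" t] K(2)[OF u x t] controls_in[OF u t] t \<tau> by auto
      then show "- M \<le> F (x t) (u t) t" by linarith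
    qed (rule integrable_const_ivl)
    then show "- M * (T - \<tau>) \<le> cost \<tau> u x" using \<tau> by (simp add: mult.commute)
  qed
qed

text \<open>Choose \<open>u k\<close> so close to optimal that the set where the maximum condition fails by \<open>(1/2)\<^sup>k\<close> has measure at most
  \<open>(1/2)\<^sup>k\<close>. By the lemma of Borel and Cantelli almost every \<open>t\<close> lies in only finitely many of these sets.\<close>
theorem minimizing_sequence:
  assumes \<tau>: "\<tau> \<in> {t0..<T}"
  obtains m u x p N where
    "\<And>v y. v \<in> controls U T \<tau> \<Longrightarrow> integral_solution f v \<tau> T y \<Longrightarrow> y \<tau> = x0 \<Longrightarrow> m \<le> cost \<tau> v y"
    "\<And>k :: nat. u k \<in> controls U T \<tau>" "\<And>k. integral_solution f (u k) \<tau> T (x k)" "\<And>k. x k \<tau> = x0"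
    "\<And>k. adjoint_solution (x k) (u k) \<tau> T (p k)" "\<And>k. p k T = 0"
    "(\<lambda>k. cost \<tau> (u k) (x k)) \<longlonglongrightarrow> m" "negligible N"
    "\<And>t. t \<in> {\<tau>..T} - N \<Longrightarrow> \<forall>\<^sub>F k in sequentially. \<forall>v\<in>U.
        ham (x k t) (p k t) v t \<le> ham (x k t) (p k t) (u k t) t + (1 / 2) ^ k"
proof -
  have \<tau>': "\<tau> \<in> {t0..T}" "t0 \<le> \<tau>" using \<tau> by auto
  define J where "J = {cost \<tau> u x |u x. u \<in> controls U T \<tau> \<and> integral_solution f u \<tau> T x \<and> x \<tau> = x0}"
  define m where "m = Inf J"
  have bdd: "bdd_below J"
  proof -
    obtain B where "\<And>u x. u \<in> controls U T \<tau> \<Longrightarrow> integral_solution f u \<tau> T x \<Longrightarrow> x \<tau> = x0 \<Longrightarrow> B \<le> cost \<tau> u x"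
      using cost_bounded_below[OF \<tau>'(1), of x0] by blast
    then show ?thesis unfolding J_def by (intro bdd_belowI[of _ B]) blast
  qed
  have ne: "J \<noteq> {}"
  proof -
    obtain u0 where u0: "u0 \<in> U" using U(2) by blast
    have "(\<lambda>_. u0) \<in> controls U T \<tau>" by (rule controlsI) (use u0 in auto)
    then show ?thesis using ex_solution[OF \<tau>'(1), of "\<lambda>_. u0" x0] unfolding J_def by blast
  qed
  have m: "m \<le> cost \<tau> v y" if "v \<in> controls U T \<tau>" "integral_solution f v \<tau> T y" "y \<tau> = x0" for v y
    unfolding m_def by (rule cInf_lower[OF _ bdd]) (use that in \<open>auto simp: J_def\<close>)
  define good where "good k z = (case z of (u, x, p, w) \<Rightarrow> u \<in> controls U T \<tau> \<and> integral_solution f u \<tau> T x \<and> x \<tau> = x0 \<and>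
      adjoint_solution x u \<tau> T p \<and> p T = 0 \<and> cost \<tau> u x \<le> m + (1 / 2) ^ k \<and>
      (\<forall>t\<in>{\<tau>..T}. w t \<in> argmax_on U (\<lambda>v. ham (x t) (p t) v t)) \<and>
      {t \<in> {\<tau>..T}. ham (x t) (p t) (u t) t + (1 / 2) ^ k \<le> ham (x t) (p t) (w t) t} \<in> lmeasurable \<and>
      measure lebesgue {t \<in> {\<tau>..T}. ham (x t) (p t) (u t) t + (1 / 2) ^ k \<le> ham (x t) (p t) (w t) t} \<le> (1 / 2) ^ k)"
    for k :: nat and z
  have ex: "\<exists>z. good k z"
    for k :: nat
  proof -
    let ?e = "(1 / 2 :: real) ^ k"
    have e: "?e > 0" by simp
    obtain C where C: "C \<ge> 0" and meas:
      "\<And>m \<eta> u x p w. u \<in> controls U T \<tau> \<Longrightarrow> integral_solution f u \<tau> T x \<Longrightarrow> x \<tau> = x0 \<Longrightarrow>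
       adjoint_solution x u \<tau> T p \<Longrightarrow> p T = 0 \<Longrightarrow> w \<in> controls U T \<tau> \<Longrightarrow>
       (\<And>v y. v \<in> controls U T \<tau> \<Longrightarrow> integral_solution f v \<tau> T y \<Longrightarrow> y \<tau> = x0 \<Longrightarrow> m \<le> cost \<tau> v y) \<Longrightarrow>
       cost \<tau> u x \<le> m + \<eta> \<Longrightarrow>
       {t \<in> {\<tau>..T}. ham (x t) (p t) (u t) t + ?e \<le> ham (x t) (p t) (w t) t} \<in> lmeasurable \<and>
       measure lebesgue {t \<in> {\<tau>..T}. ham (x t) (p t) (u t) t + ?e \<le> ham (x t) (p t) (w t) t} \<le> C * \<eta>"
      using maximum_condition_in_measure[OF \<tau> e, of x0] by blast
    \<comment> \<open>This excess over the infimum makes both the cost and the exceptional set as small as required.\<close>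
    define \<eta> where "\<eta> = ?e / (C + 1)"
    have \<eta>0: "\<eta> > 0" unfolding \<eta>_def using C by (intro divide_pos_pos) auto
    have "\<eta> * (C + 1) = ?e" unfolding \<eta>_def using C by simp
    then have \<eta>: "\<eta> > 0" "\<eta> \<le> ?e" "C * \<eta> \<le> ?e"
      using \<eta>0 mult_nonneg_nonneg[OF C less_imp_le[OF \<eta>0]] by (auto simp: algebra_simps)
    have "m < m + \<eta>" using \<eta>(1) by simp
    then obtain c where "c \<in> J" "c < m + \<eta>" using cInf_lessD[OF ne] unfolding m_def by blast
    then obtain u x where u: "u \<in> controls U T \<tau>" and x: "integral_solution f u \<tau> T x" "x \<tau> = x0"
      and c: "cost \<tau> u x \<le> m + \<eta>" unfolding J_def by (auto intro: less_imp_le)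
    obtain p where p: "adjoint_solution x u \<tau> T p" "p T = 0"
      using ex_adjoint[OF integral_solutionD(1)[OF x(1)] \<tau>'(1) u] by blast
    obtain w where w: "w \<in> controls U T \<tau>" "\<And>t. t \<in> {\<tau>..T} \<Longrightarrow> w t \<in> argmax_on U (\<lambda>v. ham (x t) (p t) v t)"
      using ham_selection[OF integral_solutionD(1)[OF x(1)] integral_solutionD(1)[OF p(1)] \<tau>'(2)] by blast
    have mm: "{t \<in> {\<tau>..T}. ham (x t) (p t) (u t) t + ?e \<le> ham (x t) (p t) (w t) t} \<in> lmeasurable \<and>
       measure lebesgue {t \<in> {\<tau>..T}. ham (x t) (p t) (u t) t + ?e \<le> ham (x t) (p t) (w t) t} \<le> C * \<eta>"
      by (rule meas[OF u x p w(1) m c])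
    have c': "cost \<tau> u x \<le> m + ?e" using c \<eta>(2) by linarith
    have mm': "measure lebesgue {t \<in> {\<tau>..T}. ham (x t) (p t) (u t) t + ?e \<le> ham (x t) (p t) (w t) t} \<le> ?e"
      using conjunct2[OF mm] \<eta>(3) by linarith
    show ?thesis
      by (rule exI[of _ "(u, x, p, w)"])
         (unfold good_def prod.case, intro conjI ballI u x p c' w(2) conjunct1[OF mm] mm')
  qed
  then obtain z where z: "\<And>k. good k (z k)" by metis
  define u where "u k = fst (z k)" for k
  define x where "x k = fst (snd (z k))" for k
  define p where "p k = fst (snd (snd (z k)))" for k
  define w where "w k = snd (snd (snd (z k)))" for k
  have g: "good k (u k, x k, p k, w k)" for k using z[of k] by (simp add: u_def x_def p_def w_def)
  note g' = g[unfolded good_def prod.case]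
  have seq: "\<And>k. u k \<in> controls U T \<tau>" "\<And>k. integral_solution f (u k) \<tau> T (x k)" "\<And>k. x k \<tau> = x0"
    "\<And>k. adjoint_solution (x k) (u k) \<tau> T (p k)" "\<And>k. p k T = 0" and c: "\<And>k. cost \<tau> (u k) (x k) \<le> m + (1 / 2) ^ k"
    and w: "\<And>k. \<forall>t\<in>{\<tau>..T}. w k t \<in> argmax_on U (\<lambda>v. ham (x k t) (p k t) v t)"
    and E: "\<And>k. {t \<in> {\<tau>..T}. ham (x k t) (p k t) (u k t) t + (1 / 2) ^ k \<le> ham (x k t) (p k t) (w k t) t} \<in> lmeasurable"
      "\<And>k. measure lebesgue {t \<in> {\<tau>..T}. ham (x k t) (p k t) (u k t) t + (1 / 2) ^ k \<le> ham (x k t) (p k t) (w k t) t} \<le> (1 / 2) ^ k"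
    using g' by blast+
  define A where "A k = {t \<in> {\<tau>..T}. ham (x k t) (p k t) (u k t) t + (1 / 2) ^ k \<le> ham (x k t) (p k t) (w k t) t}" for k
  have A: "A k \<in> lmeasurable" "measure lebesgue (A k) \<le> (1 / 2) ^ k" for k
    unfolding A_def by (rule E)+
  have "AE t in lebesgue. \<forall>\<^sub>F k in sequentially. t \<in> space lebesgue - A k"
  proof (rule borel_cantelli_AE1)
    show "A k \<in> sets lebesgue" for k using A(1) by (rule fmeasurableD)
    show "emeasure lebesgue (A k) < \<infinity>" for k
      using fmeasurableD2[OF A(1)[of k]] by (simp only: infinity_ennreal_def less_top)
    show "summable (\<lambda>k. measure lebesgue (A k))"
      by (rule summable_comparison_test'[of "\<lambda>k. (1 / 2 :: real) ^ k" 0]) (use A(2) in \<open>auto simp: summable_geometric\<close>)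
  qed
  then obtain N where N: "N \<in> null_sets lebesgue"
    "{t \<in> space lebesgue. \<not> (\<forall>\<^sub>F k in sequentially. t \<in> space lebesgue - A k)} \<subseteq> N"
    unfolding eventually_ae_filter by blast
  show ?thesis
  proof (rule that[where m = m and u = u and x = x and p = p and N = N])
    show "m \<le> cost \<tau> v y" if "v \<in> controls U T \<tau>" "integral_solution f v \<tau> T y" "y \<tau> = x0" for v y
      by (rule m[OF that])
    show "negligible N" using N(1) by (simp add: negligible_iff_null_sets)
    have "(\<lambda>k. m + (1 / 2 :: real) ^ k) \<longlonglongrightarrow> m + 0"
      by (intro tendsto_add tendsto_const LIMSEQ_realpow_zero) auto
    then have "(\<lambda>k. m + (1 / 2 :: real) ^ k) \<longlonglongrightarrow> m" by simp
    then show "(\<lambda>k. cost \<tau> (u k) (x k)) \<longlonglongrightarrow> m"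
      by (rule tendsto_sandwich[OF _ _ tendsto_const, rotated 2])
         (use m[OF seq(1,2,3)] c in auto)
  next
    fix t assume t: "t \<in> {\<tau>..T} - N"
    then have "\<forall>\<^sub>F k in sequentially. t \<notin> A k" using N(2) by auto
    then show "\<forall>\<^sub>F k in sequentially. \<forall>v\<in>U. ham (x k t) (p k t) v t \<le> ham (x k t) (p k t) (u k t) t + (1 / 2) ^ k"
    proof eventually_elim
      case (elim k)
      have tt: "t \<in> {\<tau>..T}" using t by simp
      then have lt: "ham (x k t) (p k t) (w k t) t < ham (x k t) (p k t) (u k t) t + (1 / 2) ^ k"
        using elim by (auto simp: A_def)
      show ?case
      proof
        fix v assume "v \<in> U"
        then have "ham (x k t) (p k t) v t \<le> ham (x k t) (p k t) (w k t) t"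
          using w[of k] tt by (auto simp: argmax_on_def)
        then show "ham (x k t) (p k t) v t \<le> ham (x k t) (p k t) (u k t) t + (1 / 2) ^ k" using lt by linarith
      qed
    qed
  qed (rule seq)+
qed

section \<open>An optimal control satisfying the maximum condition\<close>

lemma argmax_F_unique:
  assumes "t \<in> {t0..T}" "u \<in> argmax_on U (\<lambda>u. ham x p u t)" "v \<in> argmax_on U (\<lambda>u. ham x p u t)"
  shows "F x u t = F x v t"
proof -
  have "ham x p u t = ham x p v t" using assms(2,3) unfolding argmax_on_def by force
  then show ?thesis using max_unique[OF assms] by simp
qed

lemma near_maximizers_converge:
  assumes lim: "x \<longlonglongrightarrow> x'" "p \<longlonglongrightarrow> p'" "t \<longlonglongrightarrow> t'"
    and t: "\<And>k. t k \<in> {t0..T}" "t' \<in> {t0..T}" and u: "\<And>k. u k \<in> U"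
    and near: "\<forall>\<^sub>F k in sequentially. \<forall>v\<in>U. ham (x k) (p k) v (t k) \<le> ham (x k) (p k) (u k) (t k) + \<epsilon> k"
    and \<epsilon>: "\<epsilon> \<longlonglongrightarrow> 0" and w: "w \<in> argmax_on U (\<lambda>v. ham x' p' v t')"
  shows "(\<lambda>k. f (x k) (u k) (t k)) \<longlonglongrightarrow> f x' w t'" "(\<lambda>k. F (x k) (u k) (t k)) \<longlonglongrightarrow> F x' w t'"
    "(\<lambda>k. hx (x k) (p k) (u k) (t k)) \<longlonglongrightarrow> hx x' p' w t'"
proof -
  obtain n where n: "\<And>k v. v \<in> U \<Longrightarrow> ham (x (k + n)) (p (k + n)) v (t (k + n)) \<le>
      ham (x (k + n)) (p (k + n)) (u (k + n)) (t (k + n)) + \<epsilon> (k + n)"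
    using near unfolding eventually_sequentially by (metis le_add2)
  let ?S = "(UNIV :: ('a \<times> 'a) set) \<times> {t0..T}"
  define X where "X k = ((x (k + n), p (k + n)), t (k + n))" for k
  have X: "X \<longlonglongrightarrow> ((x', p'), t')"
    unfolding X_def by (intro tendsto_Pair LIMSEQ_ignore_initial_segment lim)
  have swap: "continuous_on (?S \<times> U) (\<lambda>(z, v). g (fst z) v (snd z))"
    if g: "continuous_on (UNIV \<times> U \<times> {t0..T}) (\<lambda>(xp, u, t). g xp u t)"
    for g :: "'a \<times> 'a \<Rightarrow> real^'m \<Rightarrow> real \<Rightarrow> 'z::metric_space"
  proof -
    have "continuous_on (?S \<times> U) (\<lambda>zv. (\<lambda>(xp, u, t). g xp u t) (fst (fst zv), snd zv, snd (fst zv)))"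
      by (rule continuous_on_compose2[OF g]) (auto intro!: continuous_intros)
    then show ?thesis by (simp add: split_def)
  qed
  note conv = near_argmax_tendsto[where S = ?S and X = X and x = "((x', p'), t')" and u = "\<lambda>k. u (k + n)"
      and \<epsilon> = "\<lambda>k. \<epsilon> (k + n)" and \<phi> = "\<lambda>z v. ham (fst (fst z)) (snd (fst z)) v (snd z)",
      OF U(1) swap[of "\<lambda>xp. ham (fst xp) (snd xp)"] _ X _ _ u _ LIMSEQ_ignore_initial_segment[OF \<epsilon>]]
  have lim_g: "(\<lambda>k. g (x k, p k) (u k) (t k)) \<longlonglongrightarrow> g (x', p') w t'"
    if g: "continuous_on (UNIV \<times> U \<times> {t0..T}) (\<lambda>(xp, u, t). g xp u t)"
      and un: "\<And>v. v \<in> argmax_on U (\<lambda>v. ham x' p' v t') \<Longrightarrow> g (x', p') v t' = g (x', p') w t'"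
    for g :: "'a \<times> 'a \<Rightarrow> real^'m \<Rightarrow> real \<Rightarrow> 'z::metric_space"
  proof -
    have "(\<lambda>k. g (fst (X k)) (u (k + n)) (snd (X k))) \<longlonglongrightarrow> g (x', p') w t'"
    proof (rule conv[where g = "\<lambda>z v. g (fst z) v (snd z)"])
      show "continuous_on (UNIV \<times> U \<times> {t0..T}) (\<lambda>(xp, u, t). ham (fst xp) (snd xp) u t)"
        using ham_cont_pair by (simp add: split_def)
      show "continuous_on (?S \<times> U) (\<lambda>(z, v). g (fst z) v (snd z))" by (rule swap[OF g])
    qed (use t n un in \<open>auto simp: X_def\<close>)
    then have "(\<lambda>k. g (x (k + n), p (k + n)) (u (k + n)) (t (k + n))) \<longlonglongrightarrow> g (x', p') w t'"
      by (simp add: X_def)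
    then show ?thesis by (rule LIMSEQ_offset)
  qed
  show "(\<lambda>k. f (x k) (u k) (t k)) \<longlonglongrightarrow> f x' w t'"
    using lim_g[of "\<lambda>xp. f (fst xp)"] f_cont_pair max_unique[OF t(2) _ w] by (simp add: split_def)
  show "(\<lambda>k. F (x k) (u k) (t k)) \<longlonglongrightarrow> F x' w t'"
    using lim_g[of "\<lambda>xp. F (fst xp)"] F_cont_pair argmax_F_unique[OF t(2) _ w] by (simp add: split_def)
  show "(\<lambda>k. hx (x k) (p k) (u k) (t k)) \<longlonglongrightarrow> hx x' p' w t'"
    using lim_g[of "\<lambda>xp. hx (fst xp) (snd xp)"] hx_cont max_unique[OF t(2) _ w] by (simp add: split_def)
qed

lemma lebesgue_integral_eq_cost:
  assumes x: "continuous_on {\<tau>..T} x" and \<tau>: "t0 \<le> \<tau>" and u: "u \<in> controls U T \<tau>"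
  shows "(\<integral>t. F (x t) (u t) t \<partial>lebesgue_on {\<tau>..T}) = cost \<tau> u x"
proof -
  obtain K where K: "\<And>t. t \<in> {\<tau>..T} \<Longrightarrow> norm (x t) \<le> K" using continuous_on_Icc_bounded[OF x] by blast
  obtain M where "bounds_upto K M" using uniform_bounds by blast
  note M = bounds_uptoD[OF this]
  have "integrable (lebesgue_on {\<tau>..T}) (\<lambda>t. F (x t) (u t) t)"
  proof (rule measurable_bounded_by_integrable_imp_lebesgue_integrable[where g = "\<lambda>_. M"])
    show "(\<lambda>t. F (x t) (u t) t) \<in> borel_measurable (lebesgue_on {\<tau>..T})"
      by (rule along_measurable(2)[OF x x \<tau> u])
    show "integrable (lebesgue_on {\<tau>..T}) (\<lambda>_. M)"
      by (intro continuous_imp_integrable_real continuous_on_const)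
    show "norm (F (x t) (u t) t) \<le> M" if t: "t \<in> {\<tau>..T}" for t
      using M(2)[OF K[OF t] K[OF t] controls_in[OF u t], of t] t \<tau> by auto
  qed simp
  then show ?thesis by (rule lebesgue_integral_eq_integral) simp
qed

text \<open>Take the uniform limit \<open>(X, P')\<close> of a subsequence of the states and adjoint states of a minimizing sequence, and
  any measurable selection \<open>w\<close> of maximizers along it. Dominated convergence carries the two integral
  equations and the cost over to \<open>w\<close>. The velocities of the limit do not depend on the choice of the
  maximizer and are therefore continuous in time, so that the limit is differentiable everywhere.\<close>
theorem ex_optimal_extremal:
  assumes \<tau>: "\<tau> \<in> {t0..<T}"
  obtains w x p where "w \<in> controls U T \<tau>" "integral_solution f w \<tau> T x" "x \<tau> = x0"
    "adjoint_solution x w \<tau> T p" "p T = 0"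
    "\<And>t. t \<in> {\<tau>..T} \<Longrightarrow> w t \<in> argmax_on U (\<lambda>v. ham (x t) (p t) v t)"
    "\<And>t. t \<in> {\<tau>..T} \<Longrightarrow> (x has_vector_derivative f (x t) (w t) t) (at t within {\<tau>..T})"
    "\<And>t. t \<in> {\<tau>..T} \<Longrightarrow> (p has_vector_derivative - hx (x t) (p t) (w t) t) (at t within {\<tau>..T})"
    "\<And>v y. v \<in> controls U T \<tau> \<Longrightarrow> integral_solution f v \<tau> T y \<Longrightarrow> y \<tau> = x0 \<Longrightarrow> cost \<tau> w x \<le> cost \<tau> v y"
proof -
  have \<tau>': "\<tau> \<in> {t0..T}" "t0 \<le> \<tau>" "\<tau> \<le> T" using \<tau> by auto
  obtain m u x p N where
    m: "\<And>v y. v \<in> controls U T \<tau> \<Longrightarrow> integral_solution f v \<tau> T y \<Longrightarrow> y \<tau> = x0 \<Longrightarrow> m \<le> cost \<tau> v y"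
    and u: "\<And>k :: nat. u k \<in> controls U T \<tau>" and x: "\<And>k. integral_solution f (u k) \<tau> T (x k)" "\<And>k. x k \<tau> = x0"
    and p: "\<And>k. adjoint_solution (x k) (u k) \<tau> T (p k)" "\<And>k. p k T = 0"
    and cm: "(\<lambda>k. cost \<tau> (u k) (x k)) \<longlonglongrightarrow> m" and N: "negligible N"
    and near: "\<And>t. t \<in> {\<tau>..T} - N \<Longrightarrow> \<forall>\<^sub>F k in sequentially. \<forall>v\<in>U.
        ham (x k t) (p k t) v t \<le> ham (x k t) (p k t) (u k t) t + (1 / 2) ^ k"
    using minimizing_sequence[OF \<tau>, of x0] by blast
  obtain K where K: "K \<ge> 0" "\<And>u x r. u \<in> controls U T \<tau> \<Longrightarrow> integral_solution f u \<tau> T x \<Longrightarrow> x \<tau> = x0 \<Longrightarrow>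
      r \<in> {\<tau>..T} \<Longrightarrow> norm (x r) \<le> K"
    using solutions_bounded[OF \<tau>'(1), of x0] by blast
  obtain P where P: "P \<ge> 0" "\<And>\<tau> x u p t. \<tau> \<in> {t0..T} \<Longrightarrow> (\<And>t. t \<in> {\<tau>..T} \<Longrightarrow> norm (x t) \<le> K) \<Longrightarrow>
     u \<in> controls U T \<tau> \<Longrightarrow> adjoint_solution x u \<tau> T p \<Longrightarrow> p T = 0 \<Longrightarrow> t \<in> {\<tau>..T} \<Longrightarrow> norm (p t) \<le> P"
    using adjoint_bounded[of K] by blast
  define R where "R = max K P"
  have xR: "norm (x k t) \<le> R" and pR: "norm (p k t) \<le> R" if t: "t \<in> {\<tau>..T}" for k t
  proof -
    show "norm (x k t) \<le> R" using K(2)[OF u x(1,2) t] by (simp add: R_def le_max_iff_disj)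
    have "norm (p k t) \<le> P" by (rule P(2)[OF \<tau>'(1) K(2)[OF u x] u p t])
    then show "norm (p k t) \<le> R" by (simp add: R_def)
  qed
  obtain M where "bounds_upto R M" using uniform_bounds by blast
  note M = bounds_uptoD[OF this]
  have b: "norm (f (x k t) (u k t) t) \<le> M" "norm (F (x k t) (u k t) t) \<le> M" "norm (- hx (x k t) (p k t) (u k t) t) \<le> M"
    if t: "t \<in> {\<tau>..T}" for k t
    using M(2)[OF xR[OF t] pR[OF t] controls_in[OF u t], of t k k k] t \<tau> by auto
  have lip: "norm (z s - z r) \<le> M * \<bar>s - r\<bar>"
    if z: "\<And>r s. \<tau> \<le> r \<Longrightarrow> r \<le> s \<Longrightarrow> s \<le> T \<Longrightarrow> (h has_integral z s - z r) {r..s}"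
      and h: "\<And>t. t \<in> {\<tau>..T} \<Longrightarrow> norm (h t) \<le> M" and rs: "r \<in> {\<tau>..T}" "s \<in> {\<tau>..T}"
    for z h :: "real \<Rightarrow> 'a" and r s
  proof -
    have *: "norm (z b - z a) \<le> M * (b - a)" if "\<tau> \<le> a" "a \<le> b" "b \<le> T" for a b
      using has_integral_bound[of M h "z b - z a" a b] z[OF that] h M(1) that by auto
    show ?thesis
      using *[of r s] *[of s r] rs by (cases "r \<le> s") (auto simp: norm_minus_commute)
  qed
  have xlip: "norm (x k s - x k r) \<le> M * \<bar>s - r\<bar>" if "r \<in> {\<tau>..T}" "s \<in> {\<tau>..T}" for k r s
    by (rule lip[OF integral_solutionD(2)[OF x(1)] b(1) that])
  have plip: "norm (p k s - p k r) \<le> M * \<bar>s - r\<bar>" if "r \<in> {\<tau>..T}" "s \<in> {\<tau>..T}" for k r s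
    by (rule lip[OF integral_solutionD(2)[OF p(1), unfolded fst_conv snd_conv] b(3) that])
  obtain g q where gc: "continuous_on {\<tau>..T} g" and q: "strict_mono (q :: nat \<Rightarrow> nat)"
    and ul: "\<And>e. 0 < e \<Longrightarrow> \<exists>N. \<forall>n t. n \<ge> N \<and> t \<in> {\<tau>..T} \<longrightarrow> norm ((x (q n) t, p (q n) t) - g t) < e"
  proof (rule Arzela_Ascoli[of "{\<tau>..T}" "\<lambda>k t. (x k t, p k t)" "R + R"])
    show "compact {\<tau>..T}" by simp
    show "norm (x k t, p k t) \<le> R + R" if "t \<in> {\<tau>..T}" for k t
      using norm_Pair_le[of "x k t" "p k t"] xR[OF that, of k] pR[OF that, of k] by linarith
    fix r e :: real assume r: "r \<in> {\<tau>..T}" and e: "0 < e"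
    show "\<exists>d>0. \<forall>k y. y \<in> {\<tau>..T} \<and> norm (r - y) < d \<longrightarrow> norm ((x k r, p k r) - (x k y, p k y)) < e"
    proof (intro exI[of _ "e / (2 * M + 1)"] conjI allI impI)
      show "e / (2 * M + 1) > 0" using e M(1) by simp
      fix k y assume y: "y \<in> {\<tau>..T} \<and> norm (r - y) < e / (2 * M + 1)"
      have "norm ((x k r, p k r) - (x k y, p k y)) \<le> norm (x k r - x k y) + norm (p k r - p k y)"
        using norm_Pair_le[of "x k r - x k y" "p k r - p k y"] by simp
      also have "\<dots> \<le> M * \<bar>r - y\<bar> + M * \<bar>r - y\<bar>" using y r by (intro add_mono xlip plip) auto
      also have "\<dots> \<le> (2 * M + 1) * \<bar>r - y\<bar>" by (simp add: algebra_simps)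
      also have "\<dots> < e" using y M(1) by (simp add: pos_less_divide_eq mult.commute)
      finally show "norm ((x k r, p k r) - (x k y, p k y)) < e" .
    qed
  next
    fix g k assume "continuous_on {\<tau>..T} g" "strict_mono (k :: nat \<Rightarrow> nat)"
      "\<And>e. 0 < e \<Longrightarrow> \<exists>N. \<forall>n t. n \<ge> N \<and> t \<in> {\<tau>..T} \<longrightarrow> norm ((x (k n) t, p (k n) t) - g t) < e"
    then show thesis by (rule that)
  qed
  define X where "X t = fst (g t)" for t
  define P' where "P' t = snd (g t)" for t
  have Xc: "continuous_on {\<tau>..T} X" and Pc: "continuous_on {\<tau>..T} P'"
    unfolding X_def P'_def by (intro continuous_intros gc)+
  have lim: "(\<lambda>n. x (q n) t) \<longlonglongrightarrow> X t" "(\<lambda>n. p (q n) t) \<longlonglongrightarrow> P' t" if t: "t \<in> {\<tau>..T}" for t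
  proof -
    have "(\<lambda>n. (x (q n) t, p (q n) t)) \<longlonglongrightarrow> g t"
      unfolding LIMSEQ_iff using ul t by meson
    from tendsto_fst[OF this] tendsto_snd[OF this]
    show "(\<lambda>n. x (q n) t) \<longlonglongrightarrow> X t" "(\<lambda>n. p (q n) t) \<longlonglongrightarrow> P' t" by (simp_all add: X_def P'_def)
  qed
  obtain w where w: "w \<in> controls U T \<tau>" "\<And>t. t \<in> {\<tau>..T} \<Longrightarrow> w t \<in> argmax_on U (\<lambda>v. ham (X t) (P' t) v t)"
    using ham_selection[OF Xc Pc \<tau>'(2)] by blast
  have q_lim: "filterlim q sequentially sequentially" by (rule filterlim_subseq[OF q])
  have conv: "(\<lambda>n. f (x (q n) t) (u (q n) t) t) \<longlonglongrightarrow> f (X t) (w t) t"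
    "(\<lambda>n. F (x (q n) t) (u (q n) t) t) \<longlonglongrightarrow> F (X t) (w t) t"
    "(\<lambda>n. hx (x (q n) t) (p (q n) t) (u (q n) t) t) \<longlonglongrightarrow> hx (X t) (P' t) (w t) t"
    if t: "t \<in> {\<tau>..T} - N" for t
  proof -
    have t': "t \<in> {\<tau>..T}" "t \<in> {t0..T}" using t \<tau> by auto
    have "\<forall>\<^sub>F n in sequentially. \<forall>v\<in>U.
        ham (x (q n) t) (p (q n) t) v t \<le> ham (x (q n) t) (p (q n) t) (u (q n) t) t + (1 / 2) ^ q n"
      using eventually_compose_filterlim[OF near[OF t] q_lim] .
    moreover have "(\<lambda>n. (1 / 2 :: real) ^ q n) \<longlonglongrightarrow> 0"
      using filterlim_compose[OF LIMSEQ_realpow_zero q_lim, of "1 / 2"] by simp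
    ultimately show "(\<lambda>n. f (x (q n) t) (u (q n) t) t) \<longlonglongrightarrow> f (X t) (w t) t"
      "(\<lambda>n. F (x (q n) t) (u (q n) t) t) \<longlonglongrightarrow> F (X t) (w t) t"
      "(\<lambda>n. hx (x (q n) t) (p (q n) t) (u (q n) t) t) \<longlonglongrightarrow> hx (X t) (P' t) (w t) t"
      using near_maximizers_converge[where x = "\<lambda>n. x (q n) t" and p = "\<lambda>n. p (q n) t" and t = "\<lambda>n. t"
        and u = "\<lambda>n. u (q n) t" and \<epsilon> = "\<lambda>n. (1 / 2) ^ q n", OF lim[OF t'(1)] tendsto_const t'(2,2)
          controls_in[OF u t'(1)] _ _ w(2)[OF t'(1)]] by blast+
  qed
  have Ms: "(\<lambda>t. M) integrable_on {r..s}" for r s :: real by (rule integrable_const_ivl)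
  have Xs: "integral_solution f w \<tau> T X"
    unfolding integral_solution_def
  proof (intro conjI Xc allI impI)
    fix r s assume rs: "\<tau> \<le> r \<and> r \<le> s \<and> s \<le> T"
    have hi: "((\<lambda>t. f (x (q n) t) (u (q n) t) t) has_integral x (q n) s - x (q n) r) {r..s}" for n
      by (rule integral_solutionD(2)[OF x(1)]) (use rs in auto)
    note dc = dominated_convergence_ae[where f = "\<lambda>n t. f (x (q n) t) (u (q n) t) t" and S = "{r..s}"
        and g = "\<lambda>t. f (X t) (w t) t", OF has_integral_integrable[OF hi] Ms _ N]
    have i: "(\<lambda>t. f (X t) (w t) t) integrable_on {r..s}" by (rule dc(1)) (use b(1) conv(1) rs in auto)
    have "(\<lambda>n. integral {r..s} (\<lambda>t. f (x (q n) t) (u (q n) t) t)) \<longlonglongrightarrow> integral {r..s} (\<lambda>t. f (X t) (w t) t)"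
      by (rule dc(2)) (use b(1) conv(1) rs in auto)
    then have "(\<lambda>n. x (q n) s - x (q n) r) \<longlonglongrightarrow> integral {r..s} (\<lambda>t. f (X t) (w t) t)"
      by (simp add: integral_unique[OF hi])
    moreover have "(\<lambda>n. x (q n) s - x (q n) r) \<longlonglongrightarrow> X s - X r"
      by (intro tendsto_diff lim) (use rs in auto)
    ultimately have "integral {r..s} (\<lambda>t. f (X t) (w t) t) = X s - X r" by (rule LIMSEQ_unique)
    then show "((\<lambda>t. f (X t) (w t) t) has_integral X s - X r) {r..s}" using integrable_integral[OF i] by simp
  qed
  have Ps: "adjoint_solution X w \<tau> T P'"
    unfolding integral_solution_def fst_conv snd_conv
  proof (intro conjI Pc allI impI)
    fix r s assume rs: "\<tau> \<le> r \<and> r \<le> s \<and> s \<le> T"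
    have hi: "((\<lambda>t. - hx (x (q n) t) (p (q n) t) (u (q n) t) t) has_integral p (q n) s - p (q n) r) {r..s}" for n
      using integral_solutionD(2)[OF p(1), of r s "q n"] rs by simp
    note dc = dominated_convergence_ae[where f = "\<lambda>n t. - hx (x (q n) t) (p (q n) t) (u (q n) t) t" and S = "{r..s}"
        and g = "\<lambda>t. - hx (X t) (P' t) (w t) t", OF has_integral_integrable[OF hi] Ms _ N]
    have le: "norm (- hx (x (q n) t) (p (q n) t) (u (q n) t) t) \<le> M" if "t \<in> {r..s}" for n t
      by (rule b(3)) (use that rs in auto)
    have cv: "(\<lambda>n. - hx (x (q n) t) (p (q n) t) (u (q n) t) t) \<longlonglongrightarrow> - hx (X t) (P' t) (w t) t"
      if "t \<in> {r..s} - N" for t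
      by (intro tendsto_minus conv(3)) (use that rs in auto)
    have i: "(\<lambda>t. - hx (X t) (P' t) (w t) t) integrable_on {r..s}" by (rule dc(1)[OF le cv])
    have "(\<lambda>n. integral {r..s} (\<lambda>t. - hx (x (q n) t) (p (q n) t) (u (q n) t) t))
        \<longlonglongrightarrow> integral {r..s} (\<lambda>t. - hx (X t) (P' t) (w t) t)"
      by (rule dc(2)[OF le cv])
    then have "(\<lambda>n. p (q n) s - p (q n) r) \<longlonglongrightarrow> integral {r..s} (\<lambda>t. - hx (X t) (P' t) (w t) t)"
      by (simp only: integral_unique[OF hi])
    moreover have "(\<lambda>n. p (q n) s - p (q n) r) \<longlonglongrightarrow> P' s - P' r"
      by (intro tendsto_diff lim) (use rs in auto)
    ultimately have "integral {r..s} (\<lambda>t. - hx (X t) (P' t) (w t) t) = P' s - P' r" by (rule LIMSEQ_unique)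
    then show "((\<lambda>t. - hx (X t) (P' t) (w t) t) has_integral P' s - P' r) {r..s}" using integrable_integral[OF i] by simp
  qed
  have "(\<lambda>n. cost \<tau> (u (q n)) (x (q n))) \<longlonglongrightarrow> cost \<tau> w X"
  proof (rule dominated_convergence_ae(2)[OF _ Ms _ N])
    show "(\<lambda>t. F (x (q n) t) (u (q n) t) t) integrable_on {\<tau>..T}" for n
      by (rule along_integrable(2)[OF integral_solutionD(1)[OF x(1)] integral_solutionD(1)[OF p(1)] \<tau>'(2) u])
  qed (use b(2) conv(2) in auto)
  moreover have "(\<lambda>n. cost \<tau> (u (q n)) (x (q n))) \<longlonglongrightarrow> m"
    using LIMSEQ_subseq_LIMSEQ[OF cm q] by (simp add: o_def)
  ultimately have cost: "cost \<tau> w X = m" by (rule LIMSEQ_unique)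
  have cont: "continuous_on {\<tau>..T} (\<lambda>t. f (X t) (w t) t)" "continuous_on {\<tau>..T} (\<lambda>t. - hx (X t) (P' t) (w t) t)"
  proof -
    have seq: "(\<lambda>n. f (X (a n)) (w (a n)) (a n)) \<longlonglongrightarrow> f (X t) (w t) t"
      "(\<lambda>n. hx (X (a n)) (P' (a n)) (w (a n)) (a n)) \<longlonglongrightarrow> hx (X t) (P' t) (w t) t"
      if a: "\<And>n. a n \<in> {\<tau>..T}" "t \<in> {\<tau>..T}" "a \<longlonglongrightarrow> t" for a t
    proof -
      have aD: "a n \<in> {t0..T}" for n using a(1)[of n] \<tau> by auto
      have tD: "t \<in> {t0..T}" using a(2) \<tau> by auto
      have Xa: "(\<lambda>n. X (a n)) \<longlonglongrightarrow> X t" and Pa: "(\<lambda>n. P' (a n)) \<longlonglongrightarrow> P' t"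
        by (rule continuous_on_tendsto_compose[OF Xc a(3,2)] continuous_on_tendsto_compose[OF Pc a(3,2)],
            use a(1) in auto)+
      have nr: "\<forall>\<^sub>F n in sequentially. \<forall>v\<in>U. ham (X (a n)) (P' (a n)) v (a n) \<le>
          ham (X (a n)) (P' (a n)) (w (a n)) (a n) + 0"
        using w(2)[OF a(1)] by (auto simp: argmax_on_def)
      note c = near_maximizers_converge[OF Xa Pa a(3) aD tD controls_in[OF w(1) a(1)] nr tendsto_const w(2)[OF a(2)]]
      show "(\<lambda>n. f (X (a n)) (w (a n)) (a n)) \<longlonglongrightarrow> f (X t) (w t) t"
        "(\<lambda>n. hx (X (a n)) (P' (a n)) (w (a n)) (a n)) \<longlonglongrightarrow> hx (X t) (P' t) (w t) t"
        by (rule c(1), rule c(3))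
    qed
    show "continuous_on {\<tau>..T} (\<lambda>t. f (X t) (w t) t)"
      by (rule continuous_on_sequentiallyI, rule seq(1)) auto
    have "continuous_on {\<tau>..T} (\<lambda>t. hx (X t) (P' t) (w t) t)"
      by (rule continuous_on_sequentiallyI, rule seq(2)) auto
    then show "continuous_on {\<tau>..T} (\<lambda>t. - hx (X t) (P' t) (w t) t)" by (rule continuous_on_minus)
  qed
  show ?thesis
  proof (rule that[OF w(1) Xs _ Ps _ w(2)])
    show "X \<tau> = x0" using lim(1)[of \<tau>] x(2) \<tau>'(3) by (simp add: LIMSEQ_const_iff)
    show "P' T = 0" using lim(2)[of T] p(2) \<tau>'(3) by (simp add: LIMSEQ_const_iff)
    show "cost \<tau> w X \<le> cost \<tau> v y" if "v \<in> controls U T \<tau>" "integral_solution f v \<tau> T y" "y \<tau> = x0" for v y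
      using m[OF that] cost by simp
    show "(X has_vector_derivative f (X t) (w t) t) (at t within {\<tau>..T})" if "t \<in> {\<tau>..T}" for t
      by (rule has_vector_derivative_of_integral[OF cont(1) _ that]) (use integral_solutionD(2)[OF Xs] in auto)
    show "(P' has_vector_derivative - hx (X t) (P' t) (w t) t) (at t within {\<tau>..T})" if "t \<in> {\<tau>..T}" for t
      by (rule has_vector_derivative_of_integral[OF cont(2) _ that]) (use integral_solutionD(2)[OF Ps] in auto)
  qed
qed

end

section \<open>The Hamiltonian and the optimality theorem\<close>

lemma has_derivative_gradient:
  fixes g :: "real^'n \<Rightarrow> real"
  assumes "g differentiable (at x)"
  shows "(g has_derivative (\<lambda>h. gradient g x \<bullet> h)) (at x)"
proof -
  let ?D = "frechet_derivative g (at x)"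
  have D: "(g has_derivative ?D) (at x)" using assms by (simp add: frechet_derivative_works)
  then have lin: "linear ?D" by (rule has_derivative_linear)
  have "?D h = gradient g x \<bullet> h" for h
  proof -
    have "(\<Sum>i\<in>UNIV. h $ i *\<^sub>R axis i 1) = h"
      using basis_expansion[of h] by (simp add: scalar_mult_eq_scaleR)
    then have "?D h = ?D (\<Sum>i\<in>UNIV. h $ i *\<^sub>R axis i 1)" by simp
    also have "\<dots> = (\<Sum>i\<in>UNIV. h $ i * ?D (axis i 1))" by (simp add: linear_sum[OF lin] linear_scale[OF lin])
    also have "\<dots> = gradient g x \<bullet> h" by (simp add: gradient_def inner_vec_def mult.commute)
    finally show ?thesis .
  qed
  then show ?thesis using D by (metis ext)
qed

lemma gradient_eqI:
  fixes g :: "real^'n \<Rightarrow> real"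
  assumes "(g has_derivative (\<lambda>h. v \<bullet> h)) (at x)"
  shows "gradient g x = v"
proof -
  have "frechet_derivative g (at x) = (\<lambda>h. v \<bullet> h)" using frechet_derivative_at[OF assms] by simp
  then show ?thesis by (simp add: gradient_def vec_eq_iff inner_axis)
qed

lemma control_hamiltonian_eq_inner: "control_hamiltonian f F x p u t = p \<bullet> f x u t - F x u t"
  by (simp add: control_hamiltonian_def inner_vec_def)

text \<open>For a maximizer \<open>u\<close> the difference between the Hamiltonian and the control Hamiltonian for this \<open>u\<close> is nonnegative
  and vanishes at \<open>(x, p)\<close>, so its partial derivatives there are zero.\<close>
lemma hamiltonian_envelope:
  fixes f :: "real^'n \<Rightarrow> real^'m \<Rightarrow> real \<Rightarrow> real^'n"
  assumes U: "compact U"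
    and f_cont: "\<And>x. continuous_on U (\<lambda>u. f x u t)" and F_cont: "\<And>x. continuous_on U (\<lambda>u. F x u t)"
    and diff: "(\<lambda>(y, q). hamiltonian U f F y q t) differentiable (at (x, p))"
    and hx: "((\<lambda>y. p \<bullet> f y u t - F y u t) has_derivative (\<lambda>h. v \<bullet> h)) (at x)"
    and u: "u \<in> argmax_on U (\<lambda>u. p \<bullet> f x u t - F x u t)"
  shows "gradient (\<lambda>q. hamiltonian U f F x q t) p = f x u t" "gradient (\<lambda>y. hamiltonian U f F y p t) x = v"
proof -
  let ?H = "\<lambda>y q. hamiltonian U f F y q t"
  have uU: "u \<in> U" using u by (simp add: argmax_on_def)
  have ge: "q \<bullet> f y u t - F y u t \<le> ?H y q" for y q
    unfolding hamiltonian_def control_hamiltonian_eq_inner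
  proof (rule cSUP_upper[OF uU])
    have "continuous_on U (\<lambda>u. q \<bullet> f y u t - F y u t)" by (intro continuous_intros f_cont F_cont)
    then have "compact ((\<lambda>u. q \<bullet> f y u t - F y u t) ` U)" using U by (rule compact_continuous_image)
    then show "bdd_above ((\<lambda>u. q \<bullet> f y u t - F y u t) ` U)"
      by (intro bounded_imp_bdd_above compact_imp_bounded)
  qed
  have eq: "?H x p = p \<bullet> f x u t - F x u t"
    unfolding hamiltonian_def control_hamiltonian_eq_inner
    by (rule cSup_eq_maximum) (use u in \<open>auto simp: argmax_on_def\<close>)
  obtain H' where H': "((\<lambda>(y, q). ?H y q) has_derivative H') (at (x, p))"
    using diff by (auto simp: differentiable_def)
  have Hq: "((\<lambda>q. ?H x q) has_derivative (\<lambda>h. H' (0, h))) (at p)"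
  proof -
    have "((\<lambda>q. (x, q)) has_derivative (\<lambda>h. (0, h))) (at p)" by (auto intro!: derivative_eq_intros)
    from has_derivative_compose[OF this, of "\<lambda>(y, q). ?H y q" H'] H' show ?thesis by simp
  qed
  have Hy: "((\<lambda>y. ?H y p) has_derivative (\<lambda>h. H' (h, 0))) (at x)"
  proof -
    have "((\<lambda>y. (y, p)) has_derivative (\<lambda>h. (h, 0))) (at x)" by (auto intro!: derivative_eq_intros)
    from has_derivative_compose[OF this, of "\<lambda>(y, q). ?H y q" H'] H' show ?thesis by simp
  qed
  have lin: "((\<lambda>q. q \<bullet> f x u t - F x u t) has_derivative (\<lambda>h. f x u t \<bullet> h)) (at p)"
    by (auto intro!: derivative_eq_intros simp: inner_commute)
  have "(\<lambda>h. H' (0, h) - f x u t \<bullet> h) = (\<lambda>h. 0)"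
    by (rule differential_zero_maxmin[OF _ _ has_derivative_diff[OF Hq lin], where S = UNIV])
       (use ge eq in auto)
  then have "(\<lambda>h. H' (0, h)) = (\<lambda>h. f x u t \<bullet> h)" by (simp add: fun_eq_iff)
  then show "gradient (\<lambda>q. ?H x q) p = f x u t" using Hq by (intro gradient_eqI) simp
  have "(\<lambda>h. H' (h, 0) - v \<bullet> h) = (\<lambda>h. 0)"
    by (rule differential_zero_maxmin[OF _ _ has_derivative_diff[OF Hy hx], where S = UNIV])
       (use ge eq in auto)
  then have "(\<lambda>h. H' (h, 0)) = (\<lambda>h. v \<bullet> h)" by (simp add: fun_eq_iff)
  then show "gradient (\<lambda>y. ?H y p) x = v" using Hy by (intro gradient_eqI) simp
qed

theorem theorem4p1:
  fixes f :: "real^'n \<Rightarrow> real^'m \<Rightarrow> real \<Rightarrow> real^'n"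
    and F :: "real^'n \<Rightarrow> real^'m \<Rightarrow> real \<Rightarrow> real"
    and U :: "(real^'m) set"
    and t0 T :: real
    and \<omega> :: "real \<Rightarrow> real \<Rightarrow> real"
    and \<omega>1 :: "real \<Rightarrow> real"
  assumes "t0 < T"
    and "U \<noteq> {}" and "compact U"
    and standing: "\<And>x0 \<tau> u. \<tau> \<in> {t0..T} \<Longrightarrow> u \<in> controls U T \<tau> \<Longrightarrow>
          \<exists>x. trajectory f T x0 \<tau> u x \<and>
              (\<forall>y. trajectory f T x0 \<tau> u y \<longrightarrow> (\<forall>t\<in>{\<tau>..T}. y t = x t))"
    and i_cont_f: "continuous_on (UNIV \<times> U \<times> {t0..T}) (\<lambda>(x, u, t). f x u t)"
    and i_cont_F: "continuous_on (UNIV \<times> U \<times> {t0..T}) (\<lambda>(x, u, t). F x u t)"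
    and i_modulus: "modulus \<omega>"
    and i_f: "\<And>t i. t \<in> {t0..T} \<Longrightarrow> has_modulus_in_x U \<omega> (\<lambda>x u. f x u t $ i)"
    and i_F: "\<And>t. t \<in> {t0..T} \<Longrightarrow> has_modulus_in_x U \<omega> (\<lambda>x u. F x u t)"
    and ii_diff_f: "\<And>x u t. u \<in> U \<Longrightarrow> t \<in> {t0..T} \<Longrightarrow> (\<lambda>y. f y u t) differentiable (at x)"
    and ii_diff_F: "\<And>x u t. u \<in> U \<Longrightarrow> t \<in> {t0..T} \<Longrightarrow> (\<lambda>y. F y u t) differentiable (at x)"
    and ii_cont_f: "continuous_on (UNIV \<times> U \<times> {t0..T}) (\<lambda>(x, u, t). jacobian (\<lambda>y. f y u t) (at x))"
    and ii_cont_F: "continuous_on (UNIV \<times> U \<times> {t0..T}) (\<lambda>(x, u, t). gradient (\<lambda>y. F y u t) x)"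
    and ii_omega1_nonneg: "\<And>r. 0 \<le> r \<Longrightarrow> 0 \<le> \<omega>1 r"
    and ii_omega1_lim: "(\<omega>1 \<longlongrightarrow> 0) (at_right 0)"
    and ii_f: "\<And>t i. t \<in> {t0..T} \<Longrightarrow> uniformly_differentiable_in_x U \<omega>1 (\<lambda>x u. f x u t $ i)"
    and ii_F: "\<And>t. t \<in> {t0..T} \<Longrightarrow> uniformly_differentiable_in_x U \<omega>1 (\<lambda>x u. F x u t)"
    and iii_diff: "\<And>x p t. t \<in> {t0..T} \<Longrightarrow>
          (\<lambda>(y, q). hamiltonian U f F y q t) differentiable (at (x, p))"
    and iii_complete: "complete_hamiltonian_system (hamiltonian U f F) t0 T"
    and unique_pmp: "\<And>x0 \<tau>. \<tau> \<in> {t0..<T} \<Longrightarrow>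
          \<exists>u \<in> controls U T \<tau>. pontryagin_max_condition U f F T x0 \<tau> u \<and>
            (\<forall>v \<in> controls U T \<tau>. pontryagin_max_condition U f F T x0 \<tau> v \<longrightarrow>
               (AE t in lebesgue_on {\<tau>..T}. v t = u t))"
  shows "\<forall>x0. \<forall>\<tau>\<in>{t0..<T}. \<forall>u\<in>controls U T \<tau>.
           pontryagin_max_condition U f F T x0 \<tau> u \<longrightarrow> optimal_control U f F T x0 \<tau> u"
proof -
  define J where "J x u t = jacobian (\<lambda>y. f y u t) (at x)" for x u t
  define hx where "hx x p u t = p v* J x u t - gradient (\<lambda>y. F y u t) x" for x p u t
  have hx_deriv: "((\<lambda>y. p \<bullet> f y u t - F y u t) has_derivative (\<lambda>h. hx x p u t \<bullet> h)) (at x)"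
    if ut: "u \<in> U" "t \<in> {t0..T}" for x p u t
  proof -
    have "((\<lambda>y. f y u t) has_derivative (\<lambda>h. J x u t *v h)) (at x)"
      using ii_diff_f[OF ut] unfolding J_def jacobian_works .
    then have "((\<lambda>y. p \<bullet> f y u t - F y u t) has_derivative
        (\<lambda>h. p \<bullet> (J x u t *v h) - gradient (\<lambda>y. F y u t) x \<bullet> h)) (at x)"
      by (intro has_derivative_diff has_derivative_gradient ii_diff_F ut has_derivative_inner_right)
    then show ?thesis by (simp add: hx_def inner_diff_left dot_lmul_matrix)
  qed
  have hx_cont: "continuous_on (UNIV \<times> U \<times> {t0..T}) (\<lambda>((x, p), u, t). hx x p u t)"
  proof -
    let ?S = "(UNIV :: ((real^'n) \<times> (real^'n)) set) \<times> U \<times> {t0..T}"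
    have "continuous_on ?S (\<lambda>z. (\<lambda>(x, u, t). J x u t) (fst (fst z), fst (snd z), snd (snd z)))"
      unfolding J_def by (rule continuous_on_compose2[OF ii_cont_f]) (auto intro!: continuous_intros)
    then have 1: "continuous_on ?S (\<lambda>z. J (fst (fst z)) (fst (snd z)) (snd (snd z)))" by (simp only: prod.case)
    have "continuous_on ?S (\<lambda>z. (\<lambda>(x, u, t). gradient (\<lambda>y. F y u t) x) (fst (fst z), fst (snd z), snd (snd z)))"
      by (rule continuous_on_compose2[OF ii_cont_F]) (auto intro!: continuous_intros)
    then have 2: "continuous_on ?S (\<lambda>z. gradient (\<lambda>y. F y (fst (snd z)) (snd (snd z))) (fst (fst z)))" by (simp only: prod.case)
    have "continuous_on ?S (\<lambda>z. snd (fst z) v* J (fst (fst z)) (fst (snd z)) (snd (snd z))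
        - gradient (\<lambda>y. F y (fst (snd z)) (snd (snd z))) (fst (fst z)))"
      unfolding vector_matrix_mult_def
      by (intro continuous_on_diff 2 continuous_on_vec_lambda continuous_on_sum continuous_on_mult
          continuous_on_component 1 continuous_on_snd continuous_on_fst continuous_on_id)
    then show ?thesis by (simp add: hx_def split_def)
  qed
  have max_unique: "f x u t = f x v t \<and> hx x p u t = hx x p v t"
    if t: "t \<in> {t0..T}" and u: "u \<in> argmax_on U (\<lambda>u. p \<bullet> f x u t - F x u t)"
      and v: "v \<in> argmax_on U (\<lambda>u. p \<bullet> f x u t - F x u t)" for x p u v t
  proof -
    have fc: "continuous_on U (\<lambda>u. f y u t)" for y
    proof -
      have "continuous_on U (\<lambda>u. (\<lambda>(x, u, t). f x u t) (y, u, t))"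
        by (rule continuous_on_compose2[OF i_cont_f]) (use t in \<open>auto intro!: continuous_intros\<close>)
      then show ?thesis by simp
    qed
    have Fc: "continuous_on U (\<lambda>u. F y u t)" for y
    proof -
      have "continuous_on U (\<lambda>u. (\<lambda>(x, u, t). F x u t) (y, u, t))"
        by (rule continuous_on_compose2[OF i_cont_F]) (use t in \<open>auto intro!: continuous_intros\<close>)
      then show ?thesis by simp
    qed
    have uv: "u \<in> U" "v \<in> U" using u v by (auto simp: argmax_on_def)
    note e = hamiltonian_envelope[OF \<open>compact U\<close> fc Fc iii_diff[OF t]]
    show ?thesis
      using e[OF hx_deriv[OF uv(1) t] u] e[OF hx_deriv[OF uv(2) t] v] by simp
  qed
  interpret control_cost U t0 T f F hx
  proof
    show "compact U" "U \<noteq> {}" by fact+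
    show "continuous_on (UNIV \<times> U \<times> {t0..T}) (\<lambda>(x, u, t). f x u t)" by fact
    show "continuous_on (UNIV \<times> U \<times> {t0..T}) (\<lambda>(x, u, t). F x u t)" by fact
    show "continuous_on (UNIV \<times> U \<times> {t0..T}) (\<lambda>((x, p), u, t). hx x p u t)" by fact
    show "\<exists>L\<ge>0. \<forall>x y u t. norm x \<le> R \<longrightarrow> norm y \<le> R \<longrightarrow> u \<in> U \<longrightarrow> t \<in> {t0..T} \<longrightarrow>
          norm (f x u t - f y u t) \<le> L * norm (x - y)" for R
      by (rule locally_lipschitz_of_hamiltonian[OF \<open>compact U\<close> hx_cont hx_deriv])
    show "\<exists>x. integral_solution f u s T x \<and> x s = y" if su: "s \<in> {t0..T}" "u \<in> controls U T s" for s u y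
    proof -
      obtain x where "trajectory f T y s u x" using standing[OF su, of y] by blast
      then show ?thesis
        using su(1) integral_solution_of_ae_solves[of s T x f u] by (auto simp: trajectory_def)
    qed
  qed (use hx_deriv max_unique in blast)+
  have grad_p: "gradient (\<lambda>q. control_hamiltonian f F x q u t) p = f x u t" for x p u t
    unfolding control_hamiltonian_eq_inner
    by (intro gradient_eqI) (auto intro!: derivative_eq_intros simp: inner_commute)
  have grad_x: "gradient (\<lambda>y. control_hamiltonian f F y p u t) x = hx x p u t"
    if "u \<in> U" "t \<in> {t0..T}" for x p u t
    unfolding control_hamiltonian_eq_inner by (intro gradient_eqI hx_deriv that)
  show ?thesis
  proof (intro allI ballI impI)
    fix x0 \<tau> u assume \<tau>: "\<tau> \<in> {t0..<T}" and u: "u \<in> controls U T \<tau>"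
      and pmp: "pontryagin_max_condition U f F T x0 \<tau> u"
    have \<tau>': "\<tau> \<in> {t0..T}" "t0 \<le> \<tau>" "\<tau> \<le> T" using \<tau> by auto
    obtain w x p where w: "w \<in> controls U T \<tau>" and x: "integral_solution f w \<tau> T x" "x \<tau> = x0"
      and p: "adjoint_solution x w \<tau> T p" "p T = 0"
      and max: "\<And>t. t \<in> {\<tau>..T} \<Longrightarrow> w t \<in> argmax_on U (\<lambda>v. ham (x t) (p t) v t)"
      and x': "\<And>t. t \<in> {\<tau>..T} \<Longrightarrow> (x has_vector_derivative f (x t) (w t) t) (at t within {\<tau>..T})"
      and p': "\<And>t. t \<in> {\<tau>..T} \<Longrightarrow> (p has_vector_derivative - hx (x t) (p t) (w t) t) (at t within {\<tau>..T})"
      and opt: "\<And>v y. v \<in> controls U T \<tau> \<Longrightarrow> integral_solution f v \<tau> T y \<Longrightarrow> y \<tau> = x0 \<Longrightarrow> cost \<tau> w x \<le> cost \<tau> v y"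
      using ex_optimal_extremal[OF \<tau>, of x0] by blast
    note xc = integral_solutionD(1)[OF x(1)] and pc = integral_solutionD(1)[OF p(1)]
    have tD: "t \<in> {t0..T}" if "t \<in> {\<tau>..T}" for t using that \<tau> by auto
    have sol: "control_hamiltonian_solution f F T x0 \<tau> w x p"
    proof -
      obtain K1 where K1: "\<And>t. t \<in> {\<tau>..T} \<Longrightarrow> norm (x t) \<le> K1" using continuous_on_Icc_bounded[OF xc] by blast
      obtain K2 where K2: "\<And>t. t \<in> {\<tau>..T} \<Longrightarrow> norm (p t) \<le> K2" using continuous_on_Icc_bounded[OF pc] by blast
      obtain M where "bounds_upto (max K1 K2) M" using uniform_bounds by blast
      note M = bounds_uptoD[OF this]
      have b: "norm (f (x t) (w t) t) \<le> M" "norm (- hx (x t) (p t) (w t) t) \<le> M" if t: "t \<in> {\<tau>..T}" for t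
        using M(2)[of "x t" "p t" "w t" t] K1[OF t] K2[OF t] controls_in[OF w t] tD[OF t] by auto
      have "ae_solves \<tau> T x (\<lambda>t. f (x t) (w t) t)"
        by (rule ae_solves_of_has_vector_derivative[OF x' b(1) M(1)])
      moreover have "ae_solves \<tau> T p (\<lambda>t. - hx (x t) (p t) (w t) t)"
        by (rule ae_solves_of_has_vector_derivative[OF p' b(2) M(1)])
      then have "ae_solves \<tau> T p (\<lambda>t. - gradient (\<lambda>y. control_hamiltonian f F y (p t) (w t) t) (x t))"
        by (rule ae_solves_cong) (simp only: grad_x[OF controls_in[OF w] tD])
      ultimately show ?thesis
        using x(2) p(2) by (simp add: control_hamiltonian_solution_def grad_p)
    qed
    have unique: "y t = x t \<and> q t = p t"
      if yq: "control_hamiltonian_solution f F T x0 \<tau> w y q" and t: "t \<in> {\<tau>..T}" for y q t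
    proof -
      have y: "integral_solution f w \<tau> T y"
        using yq \<tau>'(3) by (intro integral_solution_of_ae_solves) (auto simp: control_hamiltonian_solution_def grad_p)
      have yx: "y s = x s" if s: "s \<in> {\<tau>..T}" for s
        by (rule solution_unique[OF y x(1) \<tau>'(2) order_refl controls_in[OF w], where r = \<tau>])
           (use yq x(2) \<tau>' s in \<open>auto simp: control_hamiltonian_solution_def\<close>)
      have "ae_solves \<tau> T q (\<lambda>t. - gradient (\<lambda>z. control_hamiltonian f F z (q t) (w t) t) (y t))"
        using yq by (simp add: control_hamiltonian_solution_def)
      then have "ae_solves \<tau> T q (\<lambda>t. - hx (x t) (q t) (w t) t)"
        by (rule ae_solves_cong) (simp only: grad_x[OF controls_in[OF w] tD] yx)
      then have "adjoint_solution x w \<tau> T q"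
        using integral_solution_of_ae_solves[of \<tau> T q "\<lambda>p w t. - hx (fst w) p (snd w) t" "\<lambda>t. (x t, w t)"] \<tau>'(3) by simp
      from adjoint_unique[OF xc \<tau>'(1) w this p(1) _ t] have "q t = p t"
        using yq p(2) by (simp add: control_hamiltonian_solution_def)
      then show ?thesis using yx[OF t] by simp
    qed
    have "AE t in lebesgue_on {\<tau>..T}. \<forall>v\<in>U.
        control_hamiltonian f F (x t) (p t) (w t) t \<ge> control_hamiltonian f F (x t) (p t) v t"
      by (rule AE_I2) (use max in \<open>auto simp: argmax_on_def control_hamiltonian_eq_inner\<close>)
    then have "pontryagin_max_condition U f F T x0 \<tau> w"
      unfolding pontryagin_max_condition_def using sol unique by blast
    \<comment> \<open>Both \<open>w\<close> and the given \<open>u\<close> satisfy the maximum condition, hence agree with the unique such control.\<close>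
    then have "AE t in lebesgue_on {\<tau>..T}. w t = u t"
    proof -
      obtain u' where u': "\<And>v. v \<in> controls U T \<tau> \<Longrightarrow> pontryagin_max_condition U f F T x0 \<tau> v \<Longrightarrow>
          (AE t in lebesgue_on {\<tau>..T}. v t = u' t)"
        using unique_pmp[OF \<tau>, of x0] by blast
      from u'[OF w \<open>pontryagin_max_condition U f F T x0 \<tau> w\<close>] u'[OF u pmp]
      show ?thesis by eventually_elim simp
    qed
    then obtain N where N: "negligible N" "\<And>t. t \<in> {\<tau>..T} - N \<Longrightarrow> w t = u t"
      using AE_lebesgue_on_negligible[of _ "{\<tau>..T}"] by auto
    show "optimal_control U f F T x0 \<tau> u"
      unfolding optimal_control_def
    proof (intro conjI u ballI allI impI)
      fix v y z assume v: "v \<in> controls U T \<tau>" and "trajectory f T x0 \<tau> u y \<and> trajectory f T x0 \<tau> v z"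
      then have y: "integral_solution f u \<tau> T y" "y \<tau> = x0" and z: "integral_solution f v \<tau> T z" "z \<tau> = x0"
        using \<tau>'(3) by (auto simp: trajectory_def intro: integral_solution_of_ae_solves)
      have "integral_solution f w \<tau> T y"
        by (rule integral_solution_cong_ae[OF y(1) N(1)]) (rule N(2))
      then have yx: "y t = x t" if "t \<in> {\<tau>..T}" for t
        by (rule solution_unique[OF _ x(1) \<tau>'(2) order_refl controls_in[OF w], where r = \<tau>])
           (use x(2) y(2) \<tau>' that in auto)
      have "cost \<tau> u y = cost \<tau> w x"
        by (rule integral_spike[OF N(1)]) (use N(2) yx in auto)
      then have "cost \<tau> u y \<le> cost \<tau> v z" using opt[OF v z] by simp
      then show "(\<integral>t. F (y t) (u t) t \<partial>lebesgue_on {\<tau>..T}) \<le> (\<integral>t. F (z t) (v t) t \<partial>lebesgue_on {\<tau>..T})"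
        by (simp only: lebesgue_integral_eq_cost[OF integral_solutionD(1)[OF y(1)] \<tau>'(2) u]
            lebesgue_integral_eq_cost[OF integral_solutionD(1)[OF z(1)] \<tau>'(2) v])
    qed
  qed
qed

end
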